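(* Let $K$ be a completely monotone kernel satisfying condition (A) (see context), with associated measures $\mu$, $\overline{\mu}=\delta_0+\mu$ and $\overline{\mu}_K=K(\infty)\delta_0+\mu$, and let $b\in C^{\chi_b}(\mathbb{R})$, $\sigma\in C^{\chi_\sigma}(\mathbb{R})$ for some $\chi_b,\chi_\sigma\in(0,1]$. Consider a continuous weak solution $X$ of $$X_t=g(t)+\int_0^tK(t-s)\,b(X_s)\,\mathrm{d}s+\int_0^tK(t-s)\,\sigma(X_s)\,\mathrm{d}B_s,\qquad t\in\mathbb{R}_+,$$ where $g\in\mathcal{G}_{\eta_g}$ for some $\eta_g>\eta_*$, and put $\chi_g:=(\eta_g-\eta_* )/2$. Let $K_1,\dots,K_N$ be completely monotone kernels, $K_j(t)=\int_{\mathbb{R}_+}e^{-tx}\,\overline{\nu}_j(\mathrm{d}x)$, whose Bernstein measures $\overline{\nu}_1,\dots,\overline{\nu}_N$ on $\mathbb{R}_+$ satisfy $\overline{\nu}_j\ll\overline{\mu}_K$, $\frac{\mathrm{d}\overline{\nu}_j}{\mathrm{d}\overline{\mu}_K}\in L^2([0,1];\overline{\mu}|_{[0,1]})$ and $$\frac{\mathrm{d}\overline{\nu}_j}{\mathrm{d}\overline{\mu}_K}(x)\le C(1+x)^{\rho_j},\qquad\forall x\in[1,\infty),\ \forall j\in\{1,\dots,N\},$$ for some constants $C>0$ and $\rho_j<\frac12-\eta_*$. Let $\rho:=\max_{j}\rho_j$, and suppose that for fixed $0\le t_1\le\dots\le t_N$: (i) There exists $\gamma_*>0$ such that $$\lambda_j(n)=\Big(\int_0^{1/n}K_j(r)^2\,\mathrm{d}r\Big)^{-1}\le\overline{C}n^{2\gamma_*}$$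 for all $j\in\{1,\dots,N\}$ (and $n\in\mathbb{N}$) and some constant $\overline{C}>0$, and $$\gamma_*<\frac12-(\eta_*+\rho)^++\min\Big\{\Big(\frac12-\eta_*^+\Big),\chi_g\Big\}\chi_\sigma.$$ (ii) There exists a symmetric and positive semidefinite $N\times N$-matrix $\Sigma$ such that for all $i,j\in\{1,\dots,N\}$ with $i\le j$ $$\lim_{n\to\infty}\sqrt{\lambda_i(n)\lambda_j(n)}\int_0^{t_i/n}K_j\Big(\frac{t_j-t_i}{n}+r\Big)K_i(r)\,\mathrm{d}r=\Sigma_{ij}.$$ Let $\overline{X}=(\overline{X}^1,\dots,\overline{X}^N)^\intercal$ be the continuous $N$-dimensional Volterra Ito-process with $$\overline{X}^j_t=\int_0^tK_j(t-s)\,b(X_s)\,\mathrm{d}s+\int_0^tK_j(t-s)\,\sigma(X_s)\,\mathrm{d}B_s,\qquad t\in\mathbb{R}_+.$$ Then, as $n\to\infty$, $$\Big(\sqrt{\lambda_j(n)}\,\overline{X}^j_{t_j/n}\Big)_{j=1,\dots,N}\ \xrightarrow{\ d\ }\ \mathcal{N}\big(0,\sigma(g(0))^2\,\Sigma\big).$$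
   Context: $\mathbb{R}_+=[0,\infty)$; $a^+=\max\{a,0\}$ (with $(-\infty)^+=0$ and the obvious conventions if $\eta_*=-\infty$, e.g. $\chi_g=\infty$). Condition (A): $K:\mathbb{R}_+\to\mathbb{R}_+$ (possibly singular at $0$) is completely monotone with representation $K(t)=K(\infty)+\int_{\mathbb{R}_+}e^{-xt}\,\mu(\mathrm{d}x)$, where $K(\infty)=\lim_{t\to\infty}K(t)\ge0$ and $\mu$ is a Borel measure on $\mathbb{R}_+$ with $\mu(\{0\})=0$ and $$\eta_*=\inf\Big\{\eta\in\mathbb{R}:\int_{\mathbb{R}_+}(1+x)^{-\eta}\,\mu(\mathrm{d}x)<\infty\Big\}\in[-\infty,1/2).$$ For $\eta\in\mathbb{R}$, $\mathcal{H}_\eta$ is the weighted Hilbert space of equivalence classes of functions $y:\mathbb{R}_+\to\mathbb{R}$ with inner product $\langle y,\tilde y\rangle_\eta=y(0)\tilde y(0)+\int_{\mathbb{R}_+}y(x)\tilde y(x)(1+x)^\eta\,\mu(\mathrm{d}x)$. The projection operator is $\Xi y=y(0)+\int_{\mathbb{R}_+}y(x)\,\mu(\mathrm{d}x)$, a continuous linear functional on $\mathcal{H}_\eta$ for $\eta>\eta_*$; the semigroup is $S(t)y(x)=e^{-tx}y(x)$. $\mathcal{G}_\eta$ is the set of functions $g:\mathbb{R}_+\to\mathbb{R}$ for which there is $\xi\in\mathcal{H}_\eta$ with $g(\cdot)=\Xi S(\cdot)\xi$. $\delta_0$ is the Dirac measure at $0$. For $\chi\in(0,1]$, $f\in C^\chi(\mathbb{R})$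 means that there is a constant $C$ with $|f(x)-f(y)|\le C|x-y|^\chi$ for all $x,y\in\mathbb{R}$. A continuous weak solution is an adapted process with continuous paths on some filtered probability space carrying a real Brownian motion $B$, satisfying the equation. *)

theory Defs
  imports "HOL-Probability.Probability"
begin

section \<open>Completely monotone kernels and the spaces of input curves\<close>

text \<open>
  Kernels are functions on the positive half-line that may be singular at \<open>0\<close>; they are
  represented by functions \<open>real \<Rightarrow> real\<close> whose values outside \<open>(0,\<infinity>)\<close> carry no information.
  Measures on \<open>[0,\<infinity>)\<close> are Borel measures on the real line that do not charge the negative reals.
\<close>

definition completely_monotone :: "(real \<Rightarrow> real) \<Rightarrow> bool" where
  "completely_monotone K \<longleftrightarrow>
     (\<forall>n. \<forall>t>0. (deriv ^^ n) K differentiable (at t) \<and> 0 \<le> (-1) ^ n * (deriv ^^ n) K t)"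

definition measure_on_Rplus :: "real measure \<Rightarrow> bool" where
  "measure_on_Rplus \<mu> \<longleftrightarrow> sets \<mu> = sets borel \<and> emeasure \<mu> {..<0} = 0"

definition eta_star :: "real measure \<Rightarrow> ereal" where
  "eta_star \<mu> = Inf {ereal \<eta> | \<eta>. (\<integral>\<^sup>+x\<in>{0..}. ennreal ((1 + x) powr (- \<eta>)) \<partial>\<mu>) < \<infinity>}"

definition condition_A :: "(real \<Rightarrow> real) \<Rightarrow> real \<Rightarrow> real measure \<Rightarrow> bool" where
  "condition_A K Kinf \<mu> \<longleftrightarrow>
     completely_monotone K \<and> (K \<longlongrightarrow> Kinf) at_top \<and> 0 \<le> Kinf \<and>
     measure_on_Rplus \<mu> \<and> emeasure \<mu> {0} = 0 \<and>
     (\<forall>t>0. integrable \<mu> (\<lambda>x. exp (- (x * t))) \<and> K t = Kinf + (\<integral>x. exp (- (x * t)) \<partial>\<mu>)) \<and>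
     eta_star \<mu> < ereal (1/2)"

text \<open>The measure \<open>c \<delta>\<^sub>0 + \<mu>\<close>, for \<open>\<mu>\<close> on the Borel sets of the reals.\<close>

definition atom0_plus :: "real \<Rightarrow> real measure \<Rightarrow> real measure" where
  "atom0_plus c \<mu> =
     measure_of UNIV (sets borel) (\<lambda>A. ennreal c * emeasure (return borel 0) A + emeasure \<mu> A)"

lemma sets_atom0_plus [simp, measurable_cong]: "sets (atom0_plus c \<mu>) = sets borel"
  using sets.sigma_sets_eq[of "borel :: real measure"] by (simp add: atom0_plus_def)

lemma emeasure_atom0_plus:
  assumes "sets \<mu> = sets borel" and "A \<in> sets borel"
  shows "emeasure (atom0_plus c \<mu>) A = ennreal c * indicator A 0 + emeasure \<mu> A"
proof -
  let ?f = "\<lambda>A. ennreal c * emeasure (return borel (0::real)) A + emeasure \<mu> A"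
  have "emeasure (atom0_plus c \<mu>) A = ?f A"
  proof (rule emeasure_measure_of[OF atom0_plus_def])
    show "countably_additive (sets (atom0_plus c \<mu>)) ?f"
      unfolding countably_additive_def
    proof safe
      fix B :: "nat \<Rightarrow> real set"
      assume B: "range B \<subseteq> sets (atom0_plus c \<mu>)" "disjoint_family B"
      have "(\<Sum>i. emeasure (return borel 0) (B i)) = emeasure (return borel 0) (\<Union>i. B i)"
        using B by (intro suminf_emeasure) auto
      moreover have "(\<Sum>i. emeasure \<mu> (B i)) = emeasure \<mu> (\<Union>i. B i)"
        using B assms(1) by (intro suminf_emeasure) auto
      ultimately show "(\<Sum>i. ?f (B i)) = ?f (\<Union>i. B i)"
        by (simp add: suminf_add[symmetric] del: emeasure_return)
    qed
  qed (use assms in \<open>auto simp: positive_def\<close>)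
  with assms(2) show ?thesis by simp
qed

text \<open>
  Version \<open>h\<close> of the density of \<open>\<nu>\<close> with respect to \<open>\<mu>\<close>. It is a function rather than
  \<^const>\<open>RN_deriv\<close> because it is also integrated against a measure
  that may charge a point which \<open>\<mu>\<close> does not charge.
\<close>

definition is_density_version :: "real measure \<Rightarrow> real measure \<Rightarrow> (real \<Rightarrow> real) \<Rightarrow> bool" where
  "is_density_version \<mu> \<nu> h \<longleftrightarrow>
     h \<in> borel_measurable borel \<and> (\<forall>x. 0 \<le> h x) \<and> \<nu> = density \<mu> (\<lambda>x. ennreal (h x))"

text \<open>
  \<open>\<H>\<^sub>\<eta>\<close> is the \<open>L\<^sup>2\<close>-space of \<open>\<delta>\<^sub>0 + (1 + x)\<^sup>\<eta> \<mu>(dx)\<close>; its elements are given by representatives.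
\<close>

definition H_space :: "real measure \<Rightarrow> real \<Rightarrow> (real \<Rightarrow> real) set" where
  "H_space \<mu> \<eta> = {y. y \<in> borel_measurable borel \<and>
     (\<integral>\<^sup>+x\<in>{0..}. ennreal ((y x)\<^sup>2 * (1 + x) powr \<eta>) \<partial>\<mu>) < \<infinity>}"

definition Xi_proj :: "real measure \<Rightarrow> (real \<Rightarrow> real) \<Rightarrow> real" where
  "Xi_proj \<mu> y = y 0 + (\<integral>x. y x \<partial>\<mu>)"

definition semigroup_S :: "real \<Rightarrow> (real \<Rightarrow> real) \<Rightarrow> real \<Rightarrow> real" where
  "semigroup_S t y = (\<lambda>x. exp (- (t * x)) * y x)"

definition G_space :: "real measure \<Rightarrow> real \<Rightarrow> (real \<Rightarrow> real) set" where
  "G_space \<mu> \<eta> = {g. \<exists>\<xi>\<in>H_space \<mu> \<eta>. \<forall>t\<ge>0. g t = Xi_proj \<mu> (semigroup_S t \<xi>)}"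

definition holder :: "real \<Rightarrow> (real \<Rightarrow> real) \<Rightarrow> bool" where
  "holder a f \<longleftrightarrow> (\<exists>C. \<forall>x y. \<bar>f x - f y\<bar> \<le> C * \<bar>x - y\<bar> powr a)"


section \<open>Brownian motion and the Ito integral\<close>

text \<open>
  Filtrations are indexed by all reals to fit the locale \<^locale>\<open>filtration\<close>; a filtration on
  \<open>[0,\<infinity>)\<close> is extended by \<open>F s = F 0\<close> for \<open>s < 0\<close>. Completeness or right-continuity
  is not required.
\<close>

definition filtered_prob_space :: "'a measure \<Rightarrow> (real \<Rightarrow> 'a measure) \<Rightarrow> bool" where
  "filtered_prob_space M F \<longleftrightarrow>
     prob_space M \<and> filtration (space M) F \<and> (\<forall>t. subalgebra M (F t))"

definition adapted :: "(real \<Rightarrow> 'a measure) \<Rightarrow> (real \<Rightarrow> 'a \<Rightarrow> real) \<Rightarrow> bool" where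
  "adapted F X \<longleftrightarrow> (\<forall>t\<ge>0. X t \<in> borel_measurable (F t))"

definition continuous_paths :: "'a measure \<Rightarrow> (real \<Rightarrow> 'a \<Rightarrow> real) \<Rightarrow> bool" where
  "continuous_paths M X \<longleftrightarrow> (\<forall>\<omega>\<in>space M. continuous_on {0..} (\<lambda>t. X t \<omega>))"

definition brownian_motion ::
    "'a measure \<Rightarrow> (real \<Rightarrow> 'a measure) \<Rightarrow> (real \<Rightarrow> 'a \<Rightarrow> real) \<Rightarrow> bool" where
  "brownian_motion M F B \<longleftrightarrow>
     adapted F B \<and> continuous_paths M B \<and> (AE \<omega> in M. B 0 \<omega> = 0) \<and>
     (\<forall>s t. 0 \<le> s \<and> s < t \<longrightarrow>
        distributed M lborel (\<lambda>\<omega>. B t \<omega> - B s \<omega>) (normal_density 0 (sqrt (t - s))) \<and>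
        prob_space.indep_set M (sets (F s))
          {(\<lambda>\<omega>. B t \<omega> - B s \<omega>) -` A \<inter> space M | A. A \<in> sets borel})"

definition progressive :: "(real \<Rightarrow> 'a measure) \<Rightarrow> real \<Rightarrow> (real \<Rightarrow> 'a \<Rightarrow> real) \<Rightarrow> bool" where
  "progressive F t H \<longleftrightarrow>
     (\<forall>u\<in>{0..t}. (\<lambda>(s, \<omega>). H s \<omega>) \<in> borel_measurable (restrict_space borel {0..u} \<Otimes>\<^sub>M F u))"

text \<open>
  The simple process with \<open>k\<close> steps, partition \<open>\<tau>\<close> and heights \<open>\<xi>\<close> takes the value \<open>\<xi> i\<close> on the
  interval \<open>(\<tau> i, \<tau> (i + 1)]\<close>.
\<close>

definition simple_integrand ::
    "'a measure \<Rightarrow> (real \<Rightarrow> 'a measure) \<Rightarrow> real \<Rightarrow> nat \<Rightarrow> (nat \<Rightarrow> real) \<Rightarrow> (nat \<Rightarrow> 'a \<Rightarrow> real) \<Rightarrow> bool"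
where
  "simple_integrand M F t k \<tau> \<xi> \<longleftrightarrow>
     \<tau> 0 = 0 \<and> \<tau> k = t \<and> (\<forall>i<k. \<tau> i \<le> \<tau> (Suc i)) \<and>
     (\<forall>i<k. \<xi> i \<in> borel_measurable (F (\<tau> i)) \<and> (\<exists>c. \<forall>\<omega>\<in>space M. \<bar>\<xi> i \<omega>\<bar> \<le> c))"

definition simple_process ::
    "nat \<Rightarrow> (nat \<Rightarrow> real) \<Rightarrow> (nat \<Rightarrow> 'a \<Rightarrow> real) \<Rightarrow> real \<Rightarrow> 'a \<Rightarrow> real" where
  "simple_process k \<tau> \<xi> s \<omega> = (\<Sum>i<k. \<xi> i \<omega> * indicator {\<tau> i<..\<tau> (Suc i)} s)"

definition simple_integral ::
    "(real \<Rightarrow> 'a \<Rightarrow> real) \<Rightarrow> nat \<Rightarrow> (nat \<Rightarrow> real) \<Rightarrow> (nat \<Rightarrow> 'a \<Rightarrow> real) \<Rightarrow> 'a \<Rightarrow> real" where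
  "simple_integral B k \<tau> \<xi> \<omega> = (\<Sum>i<k. \<xi> i \<omega> * (B (\<tau> (Suc i)) \<omega> - B (\<tau> i) \<omega>))"

text \<open>
  \<open>I\<close> is (a version of) \<open>\<integral>\<^sub>0\<^sup>t H\<^sub>s dB\<^sub>s\<close>: there are simple processes \<open>H\<^sup>m\<close> such that
  \<open>\<integral>\<^sub>0\<^sup>t (H\<^sup>m\<^sub>s - H\<^sub>s)\<^sup>2 ds \<longrightarrow> 0\<close> and \<open>\<integral>\<^sub>0\<^sup>t H\<^sup>m\<^sub>s dB\<^sub>s \<longrightarrow> I\<close>, both in probability. For progressive \<open>H\<close>
  such an approximation exists iff \<open>\<integral>\<^sub>0\<^sup>t H\<^sub>s\<^sup>2 ds < \<infinity>\<close> almost surely, and \<open>I\<close> is then almost surely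
  unique. The measurability requirements on \<open>H\<close> and \<open>I\<close> make the sets below events.
\<close>

definition has_ito_integral ::
    "'a measure \<Rightarrow> (real \<Rightarrow> 'a measure) \<Rightarrow> (real \<Rightarrow> 'a \<Rightarrow> real) \<Rightarrow> real \<Rightarrow>
     (real \<Rightarrow> 'a \<Rightarrow> real) \<Rightarrow> ('a \<Rightarrow> real) \<Rightarrow> bool" where
  "has_ito_integral M F B t H I \<longleftrightarrow>
     progressive F t H \<and> I \<in> borel_measurable M \<and>
     (\<exists>k \<tau> \<xi>. (\<forall>m. simple_integrand M F t (k m) (\<tau> m) (\<xi> m)) \<and>
       (\<forall>\<epsilon>>0. (\<lambda>m. measure M {\<omega>\<in>space M. ennreal \<epsilon> <
           (\<integral>\<^sup>+s\<in>{0..t}. ennreal ((simple_process (k m) (\<tau> m) (\<xi> m) s \<omega> - H s \<omega>)\<^sup>2) \<partial>lborel)})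
         \<longlonglongrightarrow> 0) \<and>
       (\<forall>\<epsilon>>0. (\<lambda>m. measure M {\<omega>\<in>space M.
           \<epsilon> < \<bar>simple_integral B (k m) (\<tau> m) (\<xi> m) \<omega> - I \<omega>\<bar>}) \<longlonglongrightarrow> 0))"

text \<open>
  \<open>Y\<^sub>t = f(t) + \<integral>\<^sub>0\<^sup>t K(t-s) b(X\<^sub>s) ds + \<integral>\<^sub>0\<^sup>t K(t-s) \<sigma>(X\<^sub>s) dB\<^sub>s\<close> almost surely, for every \<open>t \<ge> 0\<close>.
\<close>

definition volterra_ito ::
    "'a measure \<Rightarrow> (real \<Rightarrow> 'a measure) \<Rightarrow> (real \<Rightarrow> 'a \<Rightarrow> real) \<Rightarrow> (real \<Rightarrow> real) \<Rightarrow>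
     (real \<Rightarrow> real) \<Rightarrow> (real \<Rightarrow> real) \<Rightarrow> (real \<Rightarrow> 'a \<Rightarrow> real) \<Rightarrow> (real \<Rightarrow> real) \<Rightarrow>
     (real \<Rightarrow> 'a \<Rightarrow> real) \<Rightarrow> bool" where
  "volterra_ito M F B K b \<sigma> X f Y \<longleftrightarrow>
     (\<forall>t\<ge>0. \<exists>I. has_ito_integral M F B t (\<lambda>s \<omega>. K (t - s) * \<sigma> (X s \<omega>)) I \<and>
        (AE \<omega> in M. Y t \<omega> = f t + (LBINT s:{0..t}. K (t - s) * b (X s \<omega>)) + I \<omega>))"

definition continuous_weak_solution ::
    "'a measure \<Rightarrow> (real \<Rightarrow> 'a measure) \<Rightarrow> (real \<Rightarrow> 'a \<Rightarrow> real) \<Rightarrow> (real \<Rightarrow> real) \<Rightarrow>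
     (real \<Rightarrow> real) \<Rightarrow> (real \<Rightarrow> real) \<Rightarrow> (real \<Rightarrow> real) \<Rightarrow> (real \<Rightarrow> 'a \<Rightarrow> real) \<Rightarrow> bool" where
  "continuous_weak_solution M F B g K b \<sigma> X \<longleftrightarrow>
     filtered_prob_space M F \<and> brownian_motion M F B \<and> adapted F X \<and> continuous_paths M X \<and>
     volterra_ito M F B K b \<sigma> X g X"


section \<open>Scaling, normal laws and convergence in distribution\<close>

text \<open>The scaling \<open>\<lambda>(n)\<close>; it is only meaningful if the integral is nonzero.\<close>

definition scaling :: "(real \<Rightarrow> real) \<Rightarrow> nat \<Rightarrow> real" where
  "scaling K n = inverse (LBINT r:{0..1 / real n}. (K r)\<^sup>2)"

text \<open>The normal law with mean \<open>m\<close> and (possibly singular) covariance matrix \<open>A\<close>.\<close>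

definition multivariate_normal ::
    "real ^ 'n \<Rightarrow> real ^ 'n ^ 'n \<Rightarrow> (real ^ 'n) measure \<Rightarrow> bool" where
  "multivariate_normal m A \<nu> \<longleftrightarrow> prob_space \<nu> \<and> sets \<nu> = sets borel \<and>
     (\<forall>u. (CLINT x|\<nu>. iexp (u \<bullet> x)) = exp (\<i> * of_real (u \<bullet> m) - of_real (u \<bullet> (A *v u) / 2)))"

definition converges_in_distribution ::
    "'a measure \<Rightarrow> (nat \<Rightarrow> 'a \<Rightarrow> 'b::topological_space) \<Rightarrow> 'b measure \<Rightarrow> bool" where
  "converges_in_distribution M Z \<nu> \<longleftrightarrow>
     (\<forall>f::'b \<Rightarrow> real. continuous_on UNIV f \<and> bounded (range f) \<longrightarrow>
        (\<lambda>n. \<integral>\<omega>. f (Z n \<omega>) \<partial>M) \<longlonglongrightarrow> (\<integral>x. f x \<partial>\<nu>))"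

end

theory Submission
  imports Defs "HOL-Real_Asymp.Real_Asymp"
begin

text \<open>
  Over the short interval \<open>[0, t\<^sub>j / n]\<close> the process \<open>X\<close> stays close to its initial value \<open>g(0)\<close>, and on
  the diagonal the covariance condition says that \<open>\<lambda>\<^sub>j(n) \<integral> K\<^sub>j\<^sup>2\<close> over this interval converges. Two
  consequences determine the limit.

  The drift is negligible. Paths are bounded on compact intervals, and by the Cauchy-Schwarz
  inequality the scaled drift is at most a path dependent constant times
  \<open>(t\<^sub>j / n \<cdot> \<lambda>\<^sub>j(n) \<integral> K\<^sub>j\<^sup>2)\<^sup>1\<^sup>/\<^sup>2\<close>, which tends to \<open>0\<close>.

  The coefficient \<open>\<sigma>(X\<^sub>s)\<close> may be replaced by the constant \<open>\<sigma>(g(0))\<close>. The scaled square integral of the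
  error is at most the supremum of \<open>(\<sigma>(X\<^sub>s) - \<sigma>(g(0)))\<^sup>2\<close> over the interval times a bounded quantity, so
  it tends to \<open>0\<close> almost surely, and Lenglart's inequality turns this into convergence in
  probability of the stochastic integrals (\<open>stochastic_term_localises\<close>, \<open>volterra_small_time_expansion\<close>).

  What remains is \<open>\<sigma>(g(0))\<close> times a vector of Wiener integrals of deterministic functions. The kernels
  are approximated in \<open>L\<^sup>2\<close> by step functions, so that only elementary integrals occur; these are
  jointly normal (\<open>wiener_step_vector_char\<close>), and after the substitution \<open>r = t\<^sub>i / n - s\<close> their covariances
  are the integrals in the covariance condition, up to the approximation error
  (\<open>profile_product_integral\<close>, \<open>quadratic_form_tendsto\<close>). Hence the characteristic functions converge to that
  of the normal law, and Levy's continuity theorem (\<open>converges_in_distribution_if_char_converges\<close>) concludes.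
\<close>

section \<open>Gaussian laws and the continuity theorem in several dimensions\<close>

text \<open>
  Cholesky elimination for a self-adjoint map: a basis vector \<open>e\<close> is eliminated by subtracting the
  normalised square of the functional \<open>x \<mapsto> e \<bullet> A x\<close>. If \<open>e \<bullet> A e = 0\<close>, positivity forces this
  functional to vanish, so that nothing has to be subtracted.
\<close>

lemma psd_form_sum_of_squares:
  fixes A :: "'a::euclidean_space \<Rightarrow> 'a"
  assumes "finite S" and "S \<subseteq> Basis" and "linear A"
    and "\<And>x y. x \<bullet> A y = A x \<bullet> y" and "\<And>x. 0 \<le> x \<bullet> A x"
    and "\<And>e. e \<in> Basis - S \<Longrightarrow> A e = 0"
  shows "\<exists>v::'a \<Rightarrow> 'a. \<forall>x. x \<bullet> A x = (\<Sum>e\<in>S. (v e \<bullet> x)\<^sup>2)"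
  using assms
proof (induction S arbitrary: A rule: finite_induct)
  case empty
  have "A x = 0" for x
    using empty linear_eq_0_on_span[of A Basis x] by (simp add: span_Basis)
  then show ?case by simp
next
  case (insert e S)
  interpret linear A by fact
  define c where "c = A e"
  define a where "a = c \<bullet> e"
  have cx: "e \<bullet> A x = c \<bullet> x" for x
    using insert.prems(3)[of e x] by (simp add: c_def)
  have shift: "(x + s *\<^sub>R e) \<bullet> A (x + s *\<^sub>R e) = x \<bullet> A x + 2 * s * (c \<bullet> x) + s\<^sup>2 * a" for x s
    using cx[of x] by (simp add: add scale inner_simps c_def a_def inner_commute power2_eq_square algebra_simps)
  show ?case
  proof (cases "a = 0")
    case True
    have "c \<bullet> x = 0" for x
    proof (rule ccontr)
      assume nz: "c \<bullet> x \<noteq> 0"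
      \<comment> \<open>A shift along \<open>e\<close> changes the form by an affine function of the shift; \<open>s\<close> makes it \<open>-1\<close>.\<close>
      define s where "s = - (x \<bullet> A x + 1) / (2 * (c \<bullet> x))"
      have "x \<bullet> A x + 2 * s * (c \<bullet> x) = -1"
        using nz by (simp add: s_def field_simps)
      then show False
        using insert.prems(4)[of "x + s *\<^sub>R e"] True by (simp add: shift)
    qed
    then have "c = 0" by (metis inner_eq_zero_iff)
    then have "\<And>e'. e' \<in> Basis - S \<Longrightarrow> A e' = 0"
      using insert.prems(5) unfolding c_def by blast
    with insert.IH[of A] insert.prems obtain v where v: "\<And>x. x \<bullet> A x = (\<Sum>e\<in>S. (v e \<bullet> x)\<^sup>2)"
      by auto
    have "x \<bullet> A x = (\<Sum>e'\<in>insert e S. ((v(e := 0)) e' \<bullet> x)\<^sup>2)" for x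
    proof -
      have "(\<Sum>e'\<in>S. ((v(e := 0)) e' \<bullet> x)\<^sup>2) = (\<Sum>e\<in>S. (v e \<bullet> x)\<^sup>2)"
        using insert.hyps by (intro sum.cong) auto
      then show ?thesis using insert.hyps v[of x] by simp
    qed
    then show ?thesis by blast
  next
    case False
    then have a: "0 < a"
      using insert.prems(4)[of e] by (simp add: a_def c_def inner_commute less_le)
    define A' where "A' = (\<lambda>x. A x - ((c \<bullet> x) / a) *\<^sub>R c)"
    have form: "x \<bullet> A' x = x \<bullet> A x - (c \<bullet> x)\<^sup>2 / a" for x
      by (simp add: A'_def inner_simps inner_commute power2_eq_square)
    have "\<exists>v. \<forall>x. x \<bullet> A' x = (\<Sum>e\<in>S. (v e \<bullet> x)\<^sup>2)"
    proof (rule insert.IH)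
      show "linear A'"
        by (rule linearI) (simp_all add: A'_def add scale inner_simps algebra_simps add_divide_distrib)
      show "x \<bullet> A' y = A' x \<bullet> y" for x y
        using insert.prems(3)[of x y] by (simp add: A'_def inner_simps inner_commute)
      \<comment> \<open>Completing the square: the value of the reduced form is the minimum of the original
        form along the direction of the eliminated basis vector.\<close>
      show "0 \<le> x \<bullet> A' x" for x
        using insert.prems(4)[of "x + (- (c \<bullet> x) / a) *\<^sub>R e"] a
        unfolding form shift by (simp add: power2_eq_square field_simps)
      show "A' e' = 0" if "e' \<in> Basis - S" for e'
      proof (cases "e' = e")
        case True
        then show ?thesis using a by (simp add: A'_def a_def c_def)
      next
        case False
        then have "A e' = 0" using that insert.prems(5) by auto
        moreover have "c \<bullet> e' = 0" using cx[of e'] \<open>A e' = 0\<close> by simp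
        ultimately show ?thesis by (simp add: A'_def)
      qed
    qed (use insert.prems in auto)
    then obtain v where v: "\<And>x. x \<bullet> A' x = (\<Sum>e\<in>S. (v e \<bullet> x)\<^sup>2)" by blast
    define v' where "v' = v(e := (1 / sqrt a) *\<^sub>R c)"
    have "x \<bullet> A x = (\<Sum>e'\<in>insert e S. (v' e' \<bullet> x)\<^sup>2)" for x
    proof -
      have "(\<Sum>e'\<in>S. (v' e' \<bullet> x)\<^sup>2) = (\<Sum>e\<in>S. (v e \<bullet> x)\<^sup>2)"
        using insert.hyps by (intro sum.cong) (auto simp: v'_def)
      moreover have "(v' e \<bullet> x)\<^sup>2 = (c \<bullet> x)\<^sup>2 / a"
        using a by (simp add: v'_def power_divide)
      ultimately show ?thesis using insert.hyps v[of x] form[of x] by simp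
    qed
    then show ?thesis by blast
  qed
qed

text \<open>
  The law of \<open>\<Sum>e\<in>S. z e *\<^sub>R v e\<close> with independent standard normal \<open>z e\<close>.
\<close>

lemma gaussian_law_exists:
  fixes v :: "'i \<Rightarrow> 'a::euclidean_space"
  assumes S: "finite S"
  shows "\<exists>N::'a measure. prob_space N \<and> sets N = sets borel \<and>
    (\<forall>u. (CLINT x|N. iexp (u \<bullet> x)) = exp (- of_real ((\<Sum>e\<in>S. (v e \<bullet> u)\<^sup>2) / 2)))"
proof -
  interpret std: prob_space std_normal_distribution by (rule real_dist_normal_dist[THEN real_distribution.axioms(1)])
  interpret P: product_sigma_finite "\<lambda>_. std_normal_distribution"
    by standard
  interpret PP: product_prob_space "\<lambda>_. std_normal_distribution" S
    by standard
  let ?P = "Pi\<^sub>M S (\<lambda>_. std_normal_distribution)"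
  let ?T = "\<lambda>z. \<Sum>e\<in>S. z e *\<^sub>R v e"
  have T [measurable]: "?T \<in> borel_measurable ?P"
  proof (intro borel_measurable_sum borel_measurable_scaleR borel_measurable_const)
    fix e assume "e \<in> S"
    then have "(\<lambda>z. z e) \<in> measurable ?P std_normal_distribution"
      by (rule measurable_component_singleton)
    then show "(\<lambda>z. z e) \<in> borel_measurable ?P" by simp
  qed
  define N where "N = distr ?P borel ?T"
  have "prob_space N" unfolding N_def by (rule PP.prob_space_distr) measurable
  moreover have "(CLINT x|N. iexp (u \<bullet> x)) = exp (- of_real ((\<Sum>e\<in>S. (v e \<bullet> u)\<^sup>2) / 2))" for u
  proof -
    have "(CLINT x|N. iexp (u \<bullet> x)) = (CLINT z|?P. iexp (u \<bullet> ?T z))"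
      unfolding N_def by (rule integral_distr) measurable
    also have "\<dots> = (CLINT z|?P. (\<Prod>e\<in>S. iexp ((v e \<bullet> u) * z e)))"
      using S by (simp add: inner_sum_right exp_sum sum_distrib_left inner_commute mult.commute mult.left_commute)
    also have "\<dots> = (\<Prod>e\<in>S. CLINT z|std_normal_distribution. iexp ((v e \<bullet> u) * z))"
      by (rule P.product_integral_prod[OF S])
         (rule std.integrable_const_bound[where B=1], auto)
    also have "\<dots> = (\<Prod>e\<in>S. of_real (exp (- ((v e \<bullet> u)\<^sup>2) / 2)))"
      using char_std_normal_distribution by (simp add: char_def fun_eq_iff)
    also have "\<dots> = of_real (exp (\<Sum>e\<in>S. - ((v e \<bullet> u)\<^sup>2) / 2))"
      using S by (simp add: exp_sum)
    also have "(\<Sum>e\<in>S. - ((v e \<bullet> u)\<^sup>2) / 2) = - ((\<Sum>e\<in>S. (v e \<bullet> u)\<^sup>2) / 2)"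
      by (simp add: sum_negf sum_divide_distrib)
    finally show ?thesis by (simp only: exp_of_real[symmetric] of_real_minus)
  qed
  ultimately show ?thesis
    by (intro exI[of _ N]) (auto simp: N_def)
qed

lemma multivariate_normal_exists:
  fixes A :: "real ^ 'n ^ 'n"
  assumes "transpose A = A" "\<And>u. 0 \<le> u \<bullet> (A *v u)"
  shows "\<exists>N. multivariate_normal 0 A N"
proof -
  have "\<exists>v::real ^ 'n \<Rightarrow> real ^ 'n. \<forall>x. x \<bullet> (A *v x) = (\<Sum>e\<in>Basis. (v e \<bullet> x)\<^sup>2)"
  proof (rule psd_form_sum_of_squares)
    show "x \<bullet> (A *v y) = (A *v x) \<bullet> y" for x y
      using dot_lmul_matrix[of x A y] assms(1) by (metis transpose_matrix_vector)
  qed (use assms in auto)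
  then obtain v :: "real ^ 'n \<Rightarrow> real ^ 'n" where v: "\<And>x. x \<bullet> (A *v x) = (\<Sum>e\<in>Basis. (v e \<bullet> x)\<^sup>2)" by blast
  show ?thesis
    using gaussian_law_exists[of Basis v]
    unfolding multivariate_normal_def v by auto
qed

text \<open>
  Trigonometric polynomials; a phase in the cosine makes sines and constants special cases.
\<close>

inductive_set trig_poly :: "('a::euclidean_space \<Rightarrow> real) set" where
  wave: "(\<lambda>x. cos (u \<bullet> x + a)) \<in> trig_poly"
| add: "f \<in> trig_poly \<Longrightarrow> g \<in> trig_poly \<Longrightarrow> (\<lambda>x. f x + g x) \<in> trig_poly"
| scale: "f \<in> trig_poly \<Longrightarrow> (\<lambda>x. c * f x) \<in> trig_poly"

lemma trig_poly_const: "(\<lambda>_. c) \<in> trig_poly"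
  using trig_poly.scale[OF trig_poly.wave[of 0 0], of c] by simp

lemma trig_poly_mult:
  assumes "f \<in> trig_poly" "g \<in> trig_poly"
  shows "(\<lambda>x. f x * g x) \<in> trig_poly"
  using assms
proof (induction arbitrary: g)
  case (wave u a)
  from wave.prems show ?case
  proof (induction)
    case (wave u' a')
    have "(\<lambda>x. 1/2 * (cos ((u' - u) \<bullet> x + (a' - a)) + cos ((u + u') \<bullet> x + (a + a')))) \<in> trig_poly"
      by (intro trig_poly.intros)
    then show ?case
      by (simp add: mult.commute[of "cos (u \<bullet> _ + a)"] cos_times_cos inner_simps algebra_simps add_divide_distrib)
  next
    case (add f g)
    then show ?case using trig_poly.add[OF add.IH] by (simp add: algebra_simps)
  next
    case (scale f c)
    then show ?case using trig_poly.scale[OF scale.IH, of c] by (simp add: algebra_simps)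
  qed
next
  case (add f h)
  then show ?case using trig_poly.add[OF add.IH(1)[of g] add.IH(2)[of g]] by (simp add: algebra_simps)
next
  case (scale f c)
  then show ?case using trig_poly.scale[OF scale.IH[of g], of c] by (simp add: algebra_simps)
qed

lemma trig_poly_continuous: "f \<in> trig_poly \<Longrightarrow> continuous_on S f"
  by (induction rule: trig_poly.induct) (auto intro!: continuous_intros)

lemma trig_poly_measurable [measurable_dest]: "f \<in> trig_poly \<Longrightarrow> f \<in> borel_measurable borel"
  by (rule borel_measurable_continuous_onI[OF trig_poly_continuous])

lemma trig_poly_bounded: "f \<in> trig_poly \<Longrightarrow> \<exists>L. \<forall>x. \<bar>f x\<bar> \<le> L"
proof (induction rule: trig_poly.induct)
  case (add f g)
  then obtain L1 L2 where "\<forall>x. \<bar>f x\<bar> \<le> L1" "\<forall>x. \<bar>g x\<bar> \<le> L2" by blast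
  then have "\<bar>f x + g x\<bar> \<le> L1 + L2" for x
    by (meson abs_triangle_ineq add_mono order_trans)
  then show ?case by blast
next
  case (scale f c)
  then obtain L where "\<forall>x. \<bar>f x\<bar> \<le> L" by blast
  then have "\<bar>c * f x\<bar> \<le> \<bar>c\<bar> * L" for x
    by (simp add: abs_mult mult_left_mono)
  then show ?case by blast
qed (auto intro!: exI[of _ 1])

text \<open>
  The frequency points along \<open>x - y\<close> and is scaled such that the phases at \<open>x\<close> and \<open>y\<close> differ by \<open>\<pi>\<close>.
\<close>

lemma trig_poly_separates:
  assumes "x \<noteq> y"
  shows "\<exists>f\<in>trig_poly. f x \<noteq> f y"
proof -
  define u where "u = (pi / (norm (x - y))\<^sup>2) *\<^sub>R (x - y)"
  have "u \<bullet> (x - y) = pi"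
    using assms unfolding u_def by (simp only: inner_scaleR_left power2_norm_eq_inner[symmetric]) simp
  then have "u \<bullet> y + - (u \<bullet> x) = - pi" by (simp add: inner_diff_right)
  then have "cos (u \<bullet> x + - (u \<bullet> x)) \<noteq> cos (u \<bullet> y + - (u \<bullet> x))" by simp
  then show ?thesis
    by (intro bexI[OF _ trig_poly.wave[of u "- (u \<bullet> x)"]]) simp
qed

lemma trig_poly_polynomial:
  fixes p :: "real \<Rightarrow> real"
  assumes "real_polynomial_function p" "f \<in> trig_poly"
  shows "(\<lambda>x. p (f x)) \<in> trig_poly"
  using assms(1)
proof induction
  case (linear l)
  have "l y = l 1 * y" for y
    using linear.scaleR[OF bounded_linear.linear[OF linear], of y 1] by simp
  then have "(\<lambda>x. l (f x)) = (\<lambda>x. l 1 * f x)" by (intro ext)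
  then show ?case using trig_poly.scale[OF assms(2)] by simp
qed (auto intro: trig_poly_const trig_poly.add trig_poly_mult)

text \<open>
  The theorem of Stone and Weierstrass controls the approximation on \<open>S\<close> only. The bound on the whole
  space is what makes it usable for laws that charge the complement of \<open>S\<close>.
\<close>

lemma trig_poly_approx:
  fixes f :: "'a::euclidean_space \<Rightarrow> real"
  assumes S: "compact S" and f: "continuous_on S f" and b: "\<And>x. \<bar>f x\<bar> \<le> b" and e: "0 < e"
  shows "\<exists>q\<in>trig_poly. (\<forall>x\<in>S. \<bar>f x - q x\<bar> \<le> e) \<and> (\<forall>x. \<bar>q x\<bar> \<le> b + e)"
proof -
  interpret function_ring_on trig_poly S
    by standard (use S in \<open>auto intro: trig_poly_continuous trig_poly.add trig_poly_mult
       trig_poly_const trig_poly_separates\<close>)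
  obtain g where g: "g \<in> trig_poly" "\<And>x. x \<in> S \<Longrightarrow> \<bar>f x - g x\<bar> < e / 2"
    using Stone_Weierstrass_basic[OF f, of "e / 2"] e by auto
  obtain L where L: "\<And>x. \<bar>g x\<bar> \<le> L" using trig_poly_bounded[OF g(1)] by blast
  define clip where "clip y = max (- b) (min b y)" for y :: real
  have "continuous_on {-L..L} clip" unfolding clip_def by (intro continuous_intros)
  \<comment> \<open>Off \<open>S\<close> the approximation \<open>g\<close> may be large; composing with a polynomial that is close to
    the truncation at \<open>b\<close> on the range of \<open>g\<close> keeps it bounded everywhere.\<close>
  then obtain p where p: "real_polynomial_function p" "\<And>y. y \<in> {-L..L} \<Longrightarrow> \<bar>clip y - p y\<bar> < e / 2"
    using Stone_Weierstrass_real_polynomial_function[of "{-L..L}" clip "e / 2"] e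
    by (auto simp: compact_Icc)
  have pg: "\<bar>clip (g x) - p (g x)\<bar> < e / 2" for x
    using L[of x] by (intro p(2)) auto
  have "\<bar>f x - p (g x)\<bar> \<le> e" if "x \<in> S" for x
    using g(2)[OF that] pg[of x] b[of x] unfolding clip_def by linarith
  moreover have "\<bar>p (g x)\<bar> \<le> b + e" for x
    using pg[of x] b[of x] e unfolding clip_def by linarith
  ultimately show ?thesis
    using trig_poly_polynomial[OF p(1) g(1)] by (intro bexI[of _ "\<lambda>x. p (g x)"]) auto
qed

lemma (in prob_space) integrable_bounded:
  fixes f :: "'a \<Rightarrow> 'b::{banach, second_countable_topology}"
  assumes "f \<in> borel_measurable M" "\<And>x. norm (f x) \<le> c"
  shows "integrable M f"
  using assms by (intro integrable_const_bound[where B=c]) auto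

lemma trig_poly_expectation_tendsto:
  fixes Z :: "nat \<Rightarrow> 'a \<Rightarrow> 'b::euclidean_space"
  assumes M: "prob_space M" and Z [measurable]: "\<And>n. Z n \<in> borel_measurable M"
    and N: "prob_space N" and sets_N [measurable_cong]: "sets N = sets borel"
    and chars: "\<And>u. (\<lambda>n. CLINT \<omega>|M. iexp (u \<bullet> Z n \<omega>)) \<longlonglongrightarrow> (CLINT x|N. iexp (u \<bullet> x))"
    and q: "q \<in> trig_poly"
  shows "(\<lambda>n. \<integral>\<omega>. q (Z n \<omega>) \<partial>M) \<longlonglongrightarrow> (\<integral>x. q x \<partial>N)"
  using q
proof induction
  interpret M: prob_space M by fact
  interpret N: prob_space N by fact
  case (wave u a)
  have cos_Re: "cos (y + a) = Re (cis a * iexp y)" for y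
    by (simp only: cis_conv_exp[symmetric] cis_mult) (simp add: add.commute)
  have i1: "integrable M (\<lambda>\<omega>. cis a * iexp (u \<bullet> Z n \<omega>))" for n
    by (rule M.integrable_bounded[where c=1]) (auto simp: norm_mult)
  have i2: "integrable N (\<lambda>x. cis a * iexp (u \<bullet> x))"
    by (rule N.integrable_bounded[where c=1]) (auto simp: norm_mult)
  have "(\<lambda>n. Re (CLINT \<omega>|M. cis a * iexp (u \<bullet> Z n \<omega>))) \<longlonglongrightarrow> Re (CLINT x|N. cis a * iexp (u \<bullet> x))"
    using chars[of u] by (auto intro!: tendsto_intros)
  then show ?case
    unfolding cos_Re integral_Re[OF i1] integral_Re[OF i2] .
next
  interpret M: prob_space M by fact
  interpret N: prob_space N by fact
  have iM: "integrable M (\<lambda>\<omega>. h (Z n \<omega>))" and iN: "integrable N h" if h: "h \<in> trig_poly" for h n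
  proof -
    obtain L where L: "\<And>x. \<bar>h x\<bar> \<le> L" using trig_poly_bounded[OF h] by blast
    note [measurable] = trig_poly_measurable[OF h]
    show "integrable M (\<lambda>\<omega>. h (Z n \<omega>))" by (rule M.integrable_bounded[where c=L]) (use L in auto)
    show "integrable N h" by (rule N.integrable_bounded[where c=L]) (use L in auto)
  qed
  case (add f g)
  then show ?case by (simp add: iM iN tendsto_add)
next
  case (scale f c)
  then show ?case by (simp add: tendsto_mult_left)
qed

text \<open>
  Averaging a characteristic function over a Gaussian frequency of scale \<open>s\<close> gives, by Fubini, the
  expectation of a Gaussian function of \<open>Y\<close>, from which the tails of \<open>Y\<close> can be read off.
\<close>

lemma gaussian_average_of_char:
  fixes Y :: "'a \<Rightarrow> 'b::euclidean_space" and W :: "'b measure"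
  assumes M: "prob_space M" and Y [measurable]: "Y \<in> borel_measurable M"
    and W: "prob_space W" and sets_W [measurable_cong]: "sets W = sets borel"
    and char_W: "\<And>u. (CLINT w|W. iexp (u \<bullet> w)) = exp (- of_real ((norm u)\<^sup>2 / 2))"
  shows "(CLINT w|W. CLINT \<omega>|M. iexp ((s *\<^sub>R w) \<bullet> Y \<omega>)) =
         of_real (\<integral>\<omega>. exp (- (s\<^sup>2 * (norm (Y \<omega>))\<^sup>2 / 2)) \<partial>M)"
proof -
  interpret M: prob_space M by fact
  interpret W: prob_space W by fact
  interpret WM: pair_prob_space W M ..
  have "(CLINT w|W. CLINT \<omega>|M. iexp ((s *\<^sub>R w) \<bullet> Y \<omega>)) = (CLINT \<omega>|M. CLINT w|W. iexp ((s *\<^sub>R w) \<bullet> Y \<omega>))"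
    by (rule WM.Fubini_integral[symmetric], rule WM.P.integrable_const_bound[where B=1]) auto
  also have "\<dots> = (CLINT \<omega>|M. of_real (exp (- (s\<^sup>2 * (norm (Y \<omega>))\<^sup>2 / 2))))"
  proof (rule Bochner_Integration.integral_cong[OF refl])
    fix \<omega>
    have "(CLINT w|W. iexp ((s *\<^sub>R w) \<bullet> Y \<omega>)) = (CLINT w|W. iexp ((s *\<^sub>R Y \<omega>) \<bullet> w))"
      by (simp add: inner_commute)
    also have "\<dots> = exp (- of_real (s\<^sup>2 * (norm (Y \<omega>))\<^sup>2 / 2))"
      unfolding char_W by (simp add: power_mult_distrib)
    finally show "(CLINT w|W. iexp ((s *\<^sub>R w) \<bullet> Y \<omega>)) = of_real (exp (- (s\<^sup>2 * (norm (Y \<omega>))\<^sup>2 / 2)))"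
      by (simp only: exp_of_real[symmetric] of_real_minus)
  qed
  also have "\<dots> = of_real (\<integral>\<omega>. exp (- (s\<^sup>2 * (norm (Y \<omega>))\<^sup>2 / 2)) \<partial>M)"
    by (rule integral_complex_of_real)
  finally show ?thesis .
qed

text \<open>
  Where \<open>norm (Y \<omega>) > 1 / s\<close>, the averaged function is at most \<open>exp (- 1/2) \<le> 2/3\<close>.
\<close>

lemma (in prob_space) tail_le_gaussian_average:
  fixes Y :: "'a \<Rightarrow> 'b::euclidean_space"
  assumes Y [measurable]: "Y \<in> borel_measurable M" and s: "0 < s"
  shows "prob {\<omega>\<in>space M. 1 / s < norm (Y \<omega>)} \<le>
         3 * (1 - (\<integral>\<omega>. exp (- (s\<^sup>2 * (norm (Y \<omega>))\<^sup>2 / 2)) \<partial>M))"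
proof -
  let ?E = "\<lambda>\<omega>. exp (- (s\<^sup>2 * (norm (Y \<omega>))\<^sup>2 / 2))"
  have iE: "integrable M ?E"
    by (rule integrable_bounded[where c=1]) auto
  have "prob {\<omega>\<in>space M. 1 / s < norm (Y \<omega>)} = (\<integral>\<omega>. indicator {\<omega>\<in>space M. 1 / s < norm (Y \<omega>)} \<omega> \<partial>M)"
    by simp
  also have "\<dots> \<le> (\<integral>\<omega>. 3 * (1 - ?E \<omega>) \<partial>M)"
  proof (rule integral_mono)
    show "integrable M (\<lambda>\<omega>. indicat_real {\<omega>\<in>space M. 1 / s < norm (Y \<omega>)} \<omega>)"
      by (rule integrable_bounded[where c=1]) (auto simp: indicator_def)
    fix \<omega> assume "\<omega> \<in> space M"
    show "indicat_real {\<omega>\<in>space M. 1 / s < norm (Y \<omega>)} \<omega> \<le> 3 * (1 - ?E \<omega>)"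
    proof (cases "1 / s < norm (Y \<omega>)")
      case True
      then have "1 \<le> s * norm (Y \<omega>)" using s by (simp add: field_simps)
      then have "1 \<le> s\<^sup>2 * (norm (Y \<omega>))\<^sup>2"
        using power_mono[of 1 "s * norm (Y \<omega>)" 2] by (simp add: power_mult_distrib)
      then have "?E \<omega> \<le> exp (- (1/2))" by simp
      also have "\<dots> \<le> 2 / 3"
        using exp_ge_add_one_self[of "1/2"] by (simp add: exp_minus field_simps)
      finally show ?thesis using True by (simp add: indicator_def)
    qed (simp add: indicator_def)
  qed (use iE in auto)
  also have "\<dots> = 3 * (1 - (\<integral>\<omega>. ?E \<omega> \<partial>M))"
    using iE by (simp add: prob_space)
  finally show ?thesis .
qed

text \<open>
  For the limit law the Gaussian average tends to \<open>1\<close> as its scale tends to \<open>0\<close>. At a fixed scale it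
  is the limit of the averages of the sequence, by dominated convergence in the frequency.
\<close>

lemma tight_of_char_convergence:
  fixes Z :: "nat \<Rightarrow> 'a \<Rightarrow> 'b::euclidean_space"
  assumes M: "prob_space M" and Z [measurable]: "\<And>n. Z n \<in> borel_measurable M"
    and N: "prob_space N" and sets_N [measurable_cong]: "sets N = sets borel"
    and chars: "\<And>u. (\<lambda>n. CLINT \<omega>|M. iexp (u \<bullet> Z n \<omega>)) \<longlonglongrightarrow> (CLINT x|N. iexp (u \<bullet> x))"
    and e: "0 < e"
  shows "\<exists>R. (\<forall>\<^sub>F n in sequentially. measure M {\<omega>\<in>space M. R < norm (Z n \<omega>)} \<le> e) \<and>
             measure N {x\<in>space N. R < norm x} \<le> e"
proof -
  interpret M: prob_space M by fact
  interpret N: prob_space N by fact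
  obtain W :: "'b measure" where W: "prob_space W" and sets_W [measurable_cong]: "sets W = sets borel"
    and "\<And>u. (CLINT w|W. iexp (u \<bullet> w)) = exp (- of_real ((\<Sum>e\<in>Basis. (e \<bullet> u)\<^sup>2) / 2))"
    using gaussian_law_exists[of "Basis :: 'b set" "\<lambda>e. e"] by auto
  moreover have "(\<Sum>e\<in>Basis. (e \<bullet> u)\<^sup>2) = (norm u)\<^sup>2" for u :: 'b
    unfolding power2_norm_eq_inner by (subst euclidean_inner) (simp add: inner_commute power2_eq_square)
  ultimately have char_W: "\<And>u. (CLINT w|W. iexp (u \<bullet> w)) = exp (- of_real ((norm u)\<^sup>2 / 2))"
    by simp
  interpret W: prob_space W by fact
  let ?a = "\<lambda>m n. \<integral>\<omega>. exp (- ((1 / real (Suc m))\<^sup>2 * (norm (Z n \<omega>))\<^sup>2 / 2)) \<partial>M"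
  let ?b = "\<lambda>m. \<integral>x. exp (- ((1 / real (Suc m))\<^sup>2 * (norm x)\<^sup>2 / 2)) \<partial>N"
  have "?b \<longlonglongrightarrow> (\<integral>x. 1 \<partial>N)"
  proof (rule integral_dominated_convergence[where w="\<lambda>_. 1"])
    have "(\<lambda>m. exp (- ((1 / real (Suc m))\<^sup>2 * (norm x)\<^sup>2 / 2))) \<longlonglongrightarrow> exp (- (0\<^sup>2 * (norm x)\<^sup>2 / 2))" for x :: 'b
      by (intro tendsto_intros LIMSEQ_Suc[OF lim_1_over_n])  simp
    then show "AE x in N. (\<lambda>m. exp (- ((1 / real (Suc m))\<^sup>2 * (norm x)\<^sup>2 / 2))) \<longlonglongrightarrow> 1"
      by simp
  qed auto
  then have "?b \<longlonglongrightarrow> 1" by (simp add: N.prob_space)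
  then have "\<forall>\<^sub>F m in sequentially. 1 - e / 3 < ?b m"
    by (rule order_tendstoD) (use e in simp)
  then obtain m where m: "1 - e / 3 < ?b m"
    by (auto dest: eventually_happens)
  have "(\<lambda>n. CLINT w|W. CLINT \<omega>|M. iexp (((1 / real (Suc m)) *\<^sub>R w) \<bullet> Z n \<omega>)) \<longlonglongrightarrow>
        (CLINT w|W. CLINT x|N. iexp (((1 / real (Suc m)) *\<^sub>R w) \<bullet> x))"
  proof (rule integral_dominated_convergence[where w="\<lambda>_. 1"])
    show "AE w in W. norm (CLINT \<omega>|M. iexp (((1 / real (Suc m)) *\<^sub>R w) \<bullet> Z n \<omega>)) \<le> 1" for n
    proof (rule AE_I2)
      fix w
      have "norm (CLINT \<omega>|M. iexp (((1 / real (Suc m)) *\<^sub>R w) \<bullet> Z n \<omega>))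
         \<le> (\<integral>\<omega>. norm (iexp (((1 / real (Suc m)) *\<^sub>R w) \<bullet> Z n \<omega>)) \<partial>M)"
        by (rule integral_norm_bound)
      then show "norm (CLINT \<omega>|M. iexp (((1 / real (Suc m)) *\<^sub>R w) \<bullet> Z n \<omega>)) \<le> 1"
        by (simp add: M.prob_space)
    qed
    show "AE w in W. (\<lambda>n. CLINT \<omega>|M. iexp (((1 / real (Suc m)) *\<^sub>R w) \<bullet> Z n \<omega>)) \<longlonglongrightarrow>
        (CLINT x|N. iexp (((1 / real (Suc m)) *\<^sub>R w) \<bullet> x))"
      by (intro AE_I2 chars)
  qed auto
  then have "(\<lambda>n. complex_of_real (?a m n)) \<longlonglongrightarrow> complex_of_real (?b m)"
    unfolding gaussian_average_of_char[OF M Z W sets_W char_W]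
      gaussian_average_of_char[OF N measurable_ident_sets[OF sets_N] W sets_W char_W] .
  then have "(\<lambda>n. ?a m n) \<longlonglongrightarrow> ?b m"
    by (simp add: tendsto_of_real_iff)
  then have ev: "\<forall>\<^sub>F n in sequentially. 1 - e / 3 < ?a m n"
    by (rule order_tendstoD) (use m in simp)
  have "\<forall>\<^sub>F n in sequentially. measure M {\<omega>\<in>space M. real (Suc m) < norm (Z n \<omega>)} \<le> e"
    using ev
  proof eventually_elim
    case (elim n)
    then show ?case
      using M.tail_le_gaussian_average[OF Z[of n], of "1 / real (Suc m)"] by simp
  qed
  moreover have "measure N {x\<in>space N. real (Suc m) < norm x} \<le> e"
    using N.tail_le_gaussian_average[OF measurable_ident_sets[OF sets_N], of "1 / real (Suc m)"] m by simp
  ultimately show ?thesis by blast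
qed

text \<open>
  Levy's continuity theorem in several dimensions, for a limit that is known to be a characteristic
  function. Tightness confines the laws to a ball up to a small mass; on the ball a test function is
  close to a trigonometric polynomial, whose expectations converge by assumption.
\<close>

theorem converges_in_distribution_if_char_converges:
  fixes Z :: "nat \<Rightarrow> 'a \<Rightarrow> 'b::euclidean_space"
  assumes M: "prob_space M" and Z [measurable]: "\<And>n. Z n \<in> borel_measurable M"
    and N: "prob_space N" and sets_N [measurable_cong]: "sets N = sets borel"
    and chars: "\<And>u. (\<lambda>n. CLINT \<omega>|M. iexp (u \<bullet> Z n \<omega>)) \<longlonglongrightarrow> (CLINT x|N. iexp (u \<bullet> x))"
  shows "converges_in_distribution M Z N"
  unfolding converges_in_distribution_def
proof (intro allI impI, elim conjE)
  fix f :: "'b \<Rightarrow> real"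
  assume f: "continuous_on UNIV f" and "bounded (range f)"
  then obtain b where b: "\<And>x. \<bar>f x\<bar> \<le> b" and b0: "0 < b"
    by (auto simp: bounded_pos)
  have [measurable]: "f \<in> borel_measurable borel"
    using f by (rule borel_measurable_continuous_onI)
  \<comment> \<open>An approximation on a large ball costs the sup norm on the ball and the mass outside it.\<close>
  have approx: "\<bar>(\<integral>\<omega>. f (Y \<omega>) \<partial>P) - (\<integral>\<omega>. q (Y \<omega>) \<partial>P)\<bar> \<le> e + (2 * b + e) * e"
    if P: "prob_space P" and [measurable]: "Y \<in> borel_measurable P"
      and tail: "measure P {\<omega>\<in>space P. R < norm (Y \<omega>)} \<le> e" and e: "0 < e"
      and q: "q \<in> trig_poly" "\<And>x. x \<in> cball 0 R \<Longrightarrow> \<bar>f x - q x\<bar> \<le> e" "\<And>x. \<bar>q x\<bar> \<le> b + e"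
    for P :: "'c measure" and Y q R e
  proof -
    interpret P: prob_space P by fact
    note [measurable] = trig_poly_measurable[OF q(1)]
    let ?A = "{\<omega>\<in>space P. R < norm (Y \<omega>)}"
    have [measurable]: "?A \<in> sets P" by measurable
    have i: "integrable P (\<lambda>\<omega>. f (Y \<omega>))" "integrable P (\<lambda>\<omega>. q (Y \<omega>))"
      by (rule P.integrable_bounded[where c=b], use b in auto)
         (rule P.integrable_bounded[where c="b + e"], use q(3) in auto)
    have "\<bar>(\<integral>\<omega>. f (Y \<omega>) \<partial>P) - (\<integral>\<omega>. q (Y \<omega>) \<partial>P)\<bar> \<le> (\<integral>\<omega>. \<bar>f (Y \<omega>) - q (Y \<omega>)\<bar> \<partial>P)"
      using i by (simp add: Bochner_Integration.integral_diff[symmetric] integral_abs_bound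
         del: Bochner_Integration.integral_diff)
    also have "\<dots> \<le> (\<integral>\<omega>. e + (2 * b + e) * indicator ?A \<omega> \<partial>P)"
    proof (rule integral_mono)
      show "integrable P (\<lambda>\<omega>. e + (2 * b + e) * indicator ?A \<omega>)"
        by (rule P.integrable_bounded[where c="e + (2 * b + e)"]) (use b0 e in \<open>auto simp: indicator_def\<close>)
      fix \<omega> assume "\<omega> \<in> space P"
      then show "\<bar>f (Y \<omega>) - q (Y \<omega>)\<bar> \<le> e + (2 * b + e) * indicator ?A \<omega>"
        using q(2)[of "Y \<omega>"] q(3)[of "Y \<omega>"] b[of "Y \<omega>"] e
        by (cases "R < norm (Y \<omega>)") (auto simp: indicator_def)
    qed (use i in auto)
    also have "\<dots> = e + (2 * b + e) * P.prob ?A"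
    proof -
      have "integrable P (indicat_real ?A)"
        by (rule P.integrable_bounded[where c=1]) (auto simp: indicator_def)
      then show ?thesis by (simp add: P.prob_space)
    qed
    also have "\<dots> \<le> e + (2 * b + e) * e"
      using tail b0 e by (intro add_left_mono mult_left_mono) auto
    finally show ?thesis .
  qed
  show "(\<lambda>n. \<integral>\<omega>. f (Z n \<omega>) \<partial>M) \<longlonglongrightarrow> (\<integral>x. f x \<partial>N)"
  proof (rule LIMSEQ_I)
    fix r :: real assume r: "0 < r"
    \<comment> \<open>Small enough that the two approximation errors together are at most \<open>r / 2\<close>.\<close>
    define e where "e = min 1 (r / (4 * (2 * b + 2)))"
    have e: "0 < e" "e \<le> 1"
      using r b0 by (auto simp: e_def)
    have "e \<le> r / (4 * (2 * b + 2))" by (simp add: e_def)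
    then have "e * (4 * (2 * b + 2)) \<le> r"
      using b0 by (simp only: pos_le_divide_eq add_pos_pos mult_pos_pos zero_less_numeral)
    then have er: "2 * (e + (2 * b + e) * e) \<le> r / 2"
    proof -
      have "2 * (e + (2 * b + e) * e) \<le> 2 * (e + (2 * b + 1) * e)"
        using e by (intro mult_left_mono add_left_mono mult_right_mono) auto
      also have "2 * (e + (2 * b + 1) * e) = e * (4 * (2 * b + 2)) / 2"
        by (simp add: field_simps)
      also have "\<dots> \<le> r / 2"
        using \<open>e * (4 * (2 * b + 2)) \<le> r\<close> by (rule divide_right_mono) simp
      finally show ?thesis .
    qed
    define D where "D = e + (2 * b + e) * e"
    obtain R where R: "\<forall>\<^sub>F n in sequentially. measure M {\<omega>\<in>space M. R < norm (Z n \<omega>)} \<le> e"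
       "measure N {x\<in>space N. R < norm x} \<le> e"
      using tight_of_char_convergence[OF M Z N sets_N chars e(1)] by blast
    have "\<exists>q\<in>trig_poly. (\<forall>x\<in>cball 0 R. \<bar>f x - q x\<bar> \<le> e) \<and> (\<forall>x. \<bar>q x\<bar> \<le> b + e)"
      by (rule trig_poly_approx[OF compact_cball continuous_on_subset[OF f subset_UNIV] b e(1)])
    then obtain q where q: "q \<in> trig_poly"
        "\<And>x. x \<in> cball 0 R \<Longrightarrow> \<bar>f x - q x\<bar> \<le> e" "\<And>x. \<bar>q x\<bar> \<le> b + e"
      by (elim bexE conjE) simp
    have "(\<lambda>n. \<integral>\<omega>. q (Z n \<omega>) \<partial>M) \<longlonglongrightarrow> (\<integral>x. q x \<partial>N)"
      by (rule trig_poly_expectation_tendsto[OF M Z N sets_N chars q(1)])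
    then have "\<forall>\<^sub>F n in sequentially. dist (\<integral>\<omega>. q (Z n \<omega>) \<partial>M) (\<integral>x. q x \<partial>N) < r / 2"
      by (rule tendstoD) (use r in simp)
    with R(1) have "\<forall>\<^sub>F n in sequentially. norm ((\<integral>\<omega>. f (Z n \<omega>) \<partial>M) - (\<integral>x. f x \<partial>N)) < r"
    proof eventually_elim
      case (elim n)
      have "\<bar>(\<integral>\<omega>. f (Z n \<omega>) \<partial>M) - (\<integral>\<omega>. q (Z n \<omega>) \<partial>M)\<bar> \<le> D"
        unfolding D_def by (rule approx[OF M Z elim(1) e(1) q])
      moreover have "\<bar>(\<integral>x. f x \<partial>N) - (\<integral>x. q x \<partial>N)\<bar> \<le> D"
        unfolding D_def by (rule approx[OF N measurable_ident_sets[OF sets_N] R(2) e(1) q])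
      ultimately show ?case using elim(2) er[folded D_def] unfolding dist_real_def real_norm_def by linarith
    qed
    then show "\<exists>no. \<forall>n\<ge>no. norm ((\<integral>\<omega>. f (Z n \<omega>) \<partial>M) - (\<integral>x. f x \<partial>N)) < r"
      by (simp add: eventually_sequentially)
  qed
qed


section \<open>Elementary stochastic integrals\<close>

lemma partition_mono:
  fixes p :: "nat \<Rightarrow> real"
  assumes "\<And>l. l < k \<Longrightarrow> p l \<le> p (Suc l)" and "m \<le> l" "l \<le> k"
  shows "p m \<le> p l"
  using assms(2,3)
proof (induction l rule: dec_induct)
  case (step l)
  then show ?case using assms(1)[of l] by simp
qed simp

lemma indicator_eq_of_bool_diff:
  fixes a b s :: real
  assumes "a \<le> b"
  shows "indicator {a<..b} s = (of_bool (s \<le> b) - of_bool (s \<le> a) :: real)"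
  using assms by (auto simp: indicator_def)

text \<open>
  Finitely many intervals can be cut at the points of one common grid. The same weights serve for the
  increments of any function and for the indicators, so that a simple process and its stochastic
  integral are rewritten simultaneously.
\<close>

lemma common_partition:
  fixes a b :: "'i \<Rightarrow> real"
  assumes A: "finite A" and ab: "\<And>i. i \<in> A \<Longrightarrow> 0 \<le> a i \<and> a i \<le> b i"
  obtains k p where "0 \<le> p 0" "\<forall>l<k. p l < p (Suc l)"
    "\<forall>c f. (\<Sum>i\<in>A. c i * (f (b i) - f (a i))) =
        (\<Sum>l<k. (\<Sum>i\<in>A. c i * of_bool (a i \<le> p l \<and> p l < b i)) * (f (p (Suc l)) - f (p l) :: real))"
    "\<forall>c s. (\<Sum>i\<in>A. c i * indicator {a i<..b i} s) =
        (\<Sum>l<k. (\<Sum>i\<in>A. c i * of_bool (a i \<le> p l \<and> p l < b i)) * (indicator {p l<..p (Suc l)} s :: real))"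
proof -
  define P where "P = insert 0 (a ` A \<union> b ` A)"
  define xs where "xs = sorted_list_of_set P"
  define k where "k = length xs - 1"
  define p where "p l = xs ! l" for l
  have P: "finite P" "P \<noteq> {}" "\<And>x. x \<in> P \<Longrightarrow> 0 \<le> x"
    using A ab by (auto simp: P_def) (meson ab order_trans)
  have xs: "set xs = P" "sorted_wrt (<) xs"
    using P by (auto simp: xs_def)
  have "xs \<noteq> []" using xs(1) P(2) by auto
  then have len: "length xs = Suc k" by (simp add: k_def)
  have mono: "l < m \<Longrightarrow> m \<le> k \<Longrightarrow> p l < p m" for l m
    using xs(2) len by (auto simp: p_def sorted_wrt_iff_nth_less)
  have p0: "0 \<le> p 0" using P(3)[of "p 0"] xs(1) len by (auto simp: p_def)
  have idx: "\<exists>l\<le>k. p l = x" if "x \<in> P" for x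
    using that xs(1) len by (auto simp: in_set_conv_nth p_def less_Suc_eq_le)
  have eq: "f (b i) - f (a i) =
        (\<Sum>l<k. of_bool (a i \<le> p l \<and> p l < b i) * (f (p (Suc l)) - f (p l)))"
    if i: "i \<in> A" for i and f :: "real \<Rightarrow> real"
  proof -
    obtain l where l: "l \<le> k" "p l = a i" using idx[of "a i"] i by (auto simp: P_def)
    obtain m where m: "m \<le> k" "p m = b i" using idx[of "b i"] i by (auto simp: P_def)
    have lm: "l \<le> m" using ab[OF i] mono[of m l] l m by (cases "l \<le> m") auto
    have le_iff: "p x \<le> p y \<longleftrightarrow> x \<le> y" if "x \<le> k" "y \<le> k" for x y
      using mono[of x y] mono[of y x] that by (cases x y rule: linorder_cases) auto
    have "(\<Sum>q<k. of_bool (a i \<le> p q \<and> p q < b i) * (f (p (Suc q)) - f (p q))) =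
          (\<Sum>q\<in>{l..<m}. f (p (Suc q)) - f (p q))"
    proof (rule sum.mono_neutral_cong_right)
      show "\<forall>q\<in>{..<k} - {l..<m}. of_bool (a i \<le> p q \<and> p q < b i) * (f (p (Suc q)) - f (p q)) = 0"
        using le_iff l m by (auto simp flip: l(2) m(2) simp: not_le[symmetric])
      show "of_bool (a i \<le> p q \<and> p q < b i) * (f (p (Suc q)) - f (p q)) = f (p (Suc q)) - f (p q)"
        if "q \<in> {l..<m}" for q
        using le_iff l m that by (auto simp flip: l(2) m(2) simp: not_le[symmetric])
    qed (use m in auto)
    also have "\<dots> = f (p m) - f (p l)"
      using sum_Suc_diff'[OF lm, of "\<lambda>q. f (p q)"] by simp
    finally show ?thesis using l m by simp
  qed
  have eq': "(\<Sum>i\<in>A. c i * (f (b i) - f (a i))) =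
      (\<Sum>l<k. (\<Sum>i\<in>A. c i * of_bool (a i \<le> p l \<and> p l < b i)) * (f (p (Suc l)) - f (p l)))"
    for c and f :: "real \<Rightarrow> real"
  proof -
    have "(\<Sum>i\<in>A. c i * (f (b i) - f (a i))) =
       (\<Sum>i\<in>A. \<Sum>l<k. c i * (of_bool (a i \<le> p l \<and> p l < b i) * (f (p (Suc l)) - f (p l))))"
      by (rule sum.cong[OF refl]) (simp only: eq[of _ f] sum_distrib_left)
    also have "\<dots> = (\<Sum>l<k. (\<Sum>i\<in>A. c i * of_bool (a i \<le> p l \<and> p l < b i)) * (f (p (Suc l)) - f (p l)))"
      by (subst sum.swap) (simp only: sum_distrib_right mult.assoc)
    finally show ?thesis .
  qed
  have p_less: "p l < p (Suc l)" if "l < k" for l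
    using that by (intro mono) auto
  \<comment> \<open>The indicator of \<open>(a, b]\<close> at \<open>s\<close> is an increment of the function \<open>x \<mapsto> [s \<le> x]\<close>.\<close>
  have "(\<Sum>i\<in>A. c i * indicator {a i<..b i} s) =
      (\<Sum>l<k. (\<Sum>i\<in>A. c i * of_bool (a i \<le> p l \<and> p l < b i)) * (indicator {p l<..p (Suc l)} s :: real))"
    for c and s
  proof -
    have "(\<Sum>i\<in>A. c i * indicator {a i<..b i} s) =
        (\<Sum>i\<in>A. c i * (of_bool (s \<le> b i) - of_bool (s \<le> a i)))"
      using ab by (intro sum.cong refl arg_cong2[where f="(*)"] indicator_eq_of_bool_diff) auto
    also have "\<dots> = (\<Sum>l<k. (\<Sum>i\<in>A. c i * of_bool (a i \<le> p l \<and> p l < b i)) *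
        (of_bool (s \<le> p (Suc l)) - of_bool (s \<le> p l)))"
      by (rule eq'[where f="\<lambda>x. of_bool (s \<le> x)"])
    also have "\<dots> = (\<Sum>l<k. (\<Sum>i\<in>A. c i * of_bool (a i \<le> p l \<and> p l < b i)) *
        indicator {p l<..p (Suc l)} s)"
      by (intro sum.cong refl arg_cong2[where f="(*)"] indicator_eq_of_bool_diff[symmetric])
        (auto intro: less_imp_le p_less)
    finally show ?thesis .
  qed
  then show ?thesis using p0 p_less eq' by (intro that[of p k]) auto
qed

lemma partition_sum_square:
  fixes p z :: "nat \<Rightarrow> real"
  assumes p: "\<And>l. l < k \<Longrightarrow> p l < p (Suc l)"
  shows "(\<Sum>l<k. z l * indicator {p l<..p (Suc l)} s)\<^sup>2 = (\<Sum>l<k. (z l)\<^sup>2 * indicator {p l<..p (Suc l)} s)"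
  using p
proof (induction k)
  case (Suc k)
  have mono: "p (Suc l) \<le> p k" if "l < k" for l
    by (rule partition_mono[of "Suc k"]) (use that Suc.prems in \<open>simp_all add: less_imp_le\<close>)
  have "(\<Sum>l<k. z l * indicator {p l<..p (Suc l)} s) * (z k * indicator {p k<..p (Suc k)} s) = 0"
  proof (cases "p k < s")
    case True
    then have "(\<Sum>l<k. z l * indicator {p l<..p (Suc l)} s) = 0"
      using mono by (intro sum.neutral) (force simp: indicator_def)
    then show ?thesis by simp
  qed (simp add: indicator_def)
  moreover have "(z k * indicator {p k<..p (Suc k)} s)\<^sup>2 = (z k)\<^sup>2 * indicator {p k<..p (Suc k)} s"
    by (simp add: indicator_def)
  ultimately show ?case
    using Suc unfolding sum.lessThan_Suc power2_sum by simp
qed simp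

lemma partition_square_integral:
  fixes p z :: "nat \<Rightarrow> real"
  assumes p: "\<And>l. l < k \<Longrightarrow> p l < p (Suc l)"
  shows "has_bochner_integral lborel (\<lambda>s. (\<Sum>l<k. z l * indicator {p l<..p (Suc l)} s)\<^sup>2)
           (\<Sum>l<k. (z l)\<^sup>2 * (p (Suc l) - p l))"
proof -
  have eq: "(\<Sum>l<k. z l * indicator {p l<..p (Suc l)} s)\<^sup>2 =
      (\<Sum>l<k. (z l)\<^sup>2 * indicator {p l<..p (Suc l)} s)" for s
    by (rule partition_sum_square) (rule p)
  show ?thesis
    unfolding eq
  proof (rule has_bochner_integral_sum, rule has_bochner_integral_mult_right)
    fix l assume "l \<in> {..<k}"
    then have "p l < p (Suc l)" using p by simp
    then show "has_bochner_integral lborel (indicat_real {p l<..p (Suc l)}) (p (Suc l) - p l)"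
      using has_bochner_integral_real_indicator[of "{p l<..p (Suc l)}" lborel] by simp
  qed
qed

text \<open>
  This bounds the square integral of a process that is stopped before its accumulated square exceeds
  \<open>d\<close>.
\<close>

lemma sum_until_exceeds_le:
  fixes x :: "nat \<Rightarrow> real"
  assumes "0 \<le> d" "\<And>l. l < k \<Longrightarrow> 0 \<le> x l"
  shows "(\<Sum>l<k. if (\<Sum>m\<le>l. x m) \<le> d then x l else 0) \<le> d"
  using assms(2)
proof (induction k)
  case (Suc k)
  show ?case
  proof (cases "(\<Sum>m\<le>k. x m) \<le> d")
    case True
    have "(\<Sum>l<Suc k. if (\<Sum>m\<le>l. x m) \<le> d then x l else 0) \<le> (\<Sum>l<Suc k. x l)"
      using Suc.prems by (intro sum_mono) auto
    also have "\<dots> \<le> d" using True by (simp add: lessThan_Suc_atMost)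
    finally show ?thesis .
  next
    case False
    then show ?thesis using Suc by simp
  qed
qed (use assms(1) in simp)

locale brownian = prob_space M for M :: "'a measure" +
  fixes F :: "real \<Rightarrow> 'a measure" and B :: "real \<Rightarrow> 'a \<Rightarrow> real"
  assumes filtered: "filtered_prob_space M F" and brownian: "brownian_motion M F B"
begin

lemma space_F: "space (F t) = space M"
  and sets_F_mono: "s \<le> t \<Longrightarrow> sets (F s) \<subseteq> sets (F t)"
  and sets_F_le: "sets (F t) \<subseteq> sets M"
  using filtered filtration.space_F[of "space M" F] filtration.sets_F_mono[of "space M" F]
  unfolding filtered_prob_space_def subalgebra_def by auto

lemma F_measurable_mono: "s \<le> t \<Longrightarrow> f \<in> measurable (F s) N \<Longrightarrow> f \<in> measurable (F t) N"
  using sets_F_mono[of s t] by (auto simp: measurable_def space_F)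

lemma F_measurable: "f \<in> measurable (F s) N \<Longrightarrow> f \<in> measurable M N"
  using sets_F_le[of s] by (auto simp: measurable_def space_F)

lemma B_adapted: "0 \<le> t \<Longrightarrow> B t \<in> borel_measurable (F t)"
  using brownian by (auto simp: brownian_motion_def adapted_def)

lemma B_measurable: "0 \<le> t \<Longrightarrow> B t \<in> borel_measurable M"
  using F_measurable[OF B_adapted] .

lemma indep_increment:
  assumes st: "0 \<le> s" "s < t" and Y: "Y \<in> measurable (F s) N"
  shows "indep_var N Y borel (\<lambda>\<omega>. B t \<omega> - B s \<omega>)"
proof -
  let ?D = "\<lambda>\<omega>. B t \<omega> - B s \<omega>"
  let ?P = "{?D -` A \<inter> space M | A. A \<in> sets borel}"
  have "indep_set (sets (F s)) ?P"
    using brownian st by (auto simp: brownian_motion_def)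
  moreover have "Int_stable (sets (F s))" by (rule sets.Int_stable)
  moreover have "Int_stable ?P"
    unfolding Int_stable_def by (fastforce intro: exI[of _ "_ \<inter> _"])
  ultimately have "indep_set (sigma_sets (space M) (sets (F s))) (sigma_sets (space M) ?P)"
    by (rule indep_set_sigma_sets)
  moreover have "sigma_sets (space M) {Y -` A \<inter> space M | A. A \<in> sets N} \<subseteq> sigma_sets (space M) (sets (F s))"
    using measurable_sets[OF Y] by (intro sigma_sets_mono') (auto simp: space_F)
  ultimately have "indep_set (sigma_sets (space M) {Y -` A \<inter> space M | A. A \<in> sets N}) (sigma_sets (space M) ?P)"
    unfolding indep_sets2_eq by blast
  then show ?thesis
    unfolding indep_var_eq using F_measurable[OF Y] st
    by (auto intro!: borel_measurable_diff B_measurable)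
qed

lemma increment_normal:
  assumes "0 \<le> s" "s < t"
  shows "distributed M lborel (\<lambda>\<omega>. B t \<omega> - B s \<omega>) (normal_density 0 (sqrt (t - s)))"
  using brownian assms by (auto simp: brownian_motion_def)

lemma increment_moments:
  assumes st: "0 \<le> s" "s < t"
  defines "D \<equiv> (\<lambda>\<omega>. B t \<omega> - B s \<omega>)"
  shows "integrable M D" "expectation D = 0"
    "integrable M (\<lambda>\<omega>. (D \<omega>)\<^sup>2)" "expectation (\<lambda>\<omega>. (D \<omega>)\<^sup>2) = t - s"
proof -
  note N = increment_normal[OF st, folded D_def]
  have pos: "0 < sqrt (t - s)" using st by simp
  show "expectation D = 0" by (rule normal_distributed_expectation[OF pos N])
  then show "expectation (\<lambda>\<omega>. (D \<omega>)\<^sup>2) = t - s"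
    using normal_distributed_variance[OF pos N] st by simp
  show "integrable M D"
    using iffD1[OF distributed_integrable[OF N, of "\<lambda>x. x"] integrable_normal_moment_nz_1[OF pos]] by simp
  show "integrable M (\<lambda>\<omega>. (D \<omega>)\<^sup>2)"
    using iffD1[OF distributed_integrable[OF N, of "\<lambda>x. (x - 0)\<^sup>2"] integrable_normal_moment[OF pos]] by simp
qed

lemma increment_char:
  assumes st: "0 \<le> s" "s < t"
  shows "expectation (\<lambda>\<omega>. iexp (u * (B t \<omega> - B s \<omega>))) = of_real (exp (- (u\<^sup>2 * (t - s) / 2)))"
proof -
  let ?r = "sqrt (t - s)"
  let ?Y = "\<lambda>\<omega>. (B t \<omega> - B s \<omega>) / ?r"
  have pos: "0 < ?r" using st by simp
  have "distributed M lborel ?Y std_normal_density"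
    using increment_normal[OF st] normal_standard_normal_convert[OF pos, of "\<lambda>\<omega>. B t \<omega> - B s \<omega>" 0] by simp
  then have Y: "distr M lborel ?Y = std_normal_distribution"
    by (rule distributed_distr_eq_density)
  have [measurable]: "?Y \<in> borel_measurable M"
    using st by (intro borel_measurable_divide borel_measurable_diff B_measurable borel_measurable_const) auto
  have "expectation (\<lambda>\<omega>. iexp (u * (B t \<omega> - B s \<omega>))) = expectation (\<lambda>\<omega>. iexp ((u * ?r) * ?Y \<omega>))"
  proof -
    have "u * (B t \<omega> - B s \<omega>) = (u * ?r) * ?Y \<omega>" for \<omega> using st by simp
    then show ?thesis by (simp only:)
  qed
  also have "\<dots> = (CLINT x|distr M lborel ?Y. iexp ((u * ?r) * x))"
    by (rule integral_distr[symmetric]) auto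
  also have "\<dots> = of_real (exp (- ((u * ?r)\<^sup>2) / 2))"
    unfolding Y using fun_cong[OF char_std_normal_distribution, of "u * ?r"] by (simp only: char_def)
  also have "(u * ?r)\<^sup>2 = u\<^sup>2 * (t - s)" using st by (simp add: power_mult_distrib)
  finally show ?thesis by simp
qed

context
  fixes p :: "nat \<Rightarrow> real" and k :: nat
  assumes p0: "0 \<le> p 0" and p_less: "\<And>l. l < k \<Longrightarrow> p l < p (Suc l)"
begin

lemma partition_nonneg: "l \<le> k \<Longrightarrow> 0 \<le> p l"
proof (induction l)
  case (Suc l)
  then show ?case using p_less[of l] by simp
qed (rule p0)

lemma partition_integral_measurable:
  assumes "\<And>l. l < k \<Longrightarrow> \<xi> l \<in> borel_measurable (F (p l))" and "m \<le> k"
  shows "(\<lambda>\<omega>. \<Sum>l<m. \<xi> l \<omega> * (B (p (Suc l)) \<omega> - B (p l) \<omega>)) \<in> borel_measurable (F (p m))"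
  using assms(2)
proof (induction m)
  case (Suc m)
  then have "p m < p (Suc m)" and "0 \<le> p m" "0 \<le> p (Suc m)"
    using p_less partition_nonneg by auto
  note mono = F_measurable_mono[OF less_imp_le[OF \<open>p m < p (Suc m)\<close>]]
  have [measurable]: "B (p (Suc m)) \<in> borel_measurable (F (p (Suc m)))"
    "B (p m) \<in> borel_measurable (F (p (Suc m)))" "\<xi> m \<in> borel_measurable (F (p (Suc m)))"
    "(\<lambda>\<omega>. \<Sum>l<m. \<xi> l \<omega> * (B (p (Suc l)) \<omega> - B (p l) \<omega>)) \<in> borel_measurable (F (p (Suc m)))"
    using Suc \<open>0 \<le> p m\<close> \<open>0 \<le> p (Suc m)\<close> assms(1)[of m]
    by (auto intro: mono B_adapted)
  show ?case unfolding sum.lessThan_Suc by measurable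
qed simp

text \<open>
  Induction on the number of steps: the cross term vanishes because the new increment is centred and
  independent of the past. Square integrability is carried along as it makes the products integrable.
\<close>

lemma partition_ito_isometry:
  assumes \<xi>: "\<And>l. l < k \<Longrightarrow> \<xi> l \<in> borel_measurable (F (p l))"
    and c: "\<And>l \<omega>. l < k \<Longrightarrow> \<omega> \<in> space M \<Longrightarrow> \<bar>\<xi> l \<omega>\<bar> \<le> c l" and "m \<le> k"
  defines "S \<equiv> (\<lambda>m \<omega>. \<Sum>l<m. \<xi> l \<omega> * (B (p (Suc l)) \<omega> - B (p l) \<omega>))"
  shows "integrable M (\<lambda>\<omega>. (S m \<omega>)\<^sup>2) \<and>
    expectation (\<lambda>\<omega>. (S m \<omega>)\<^sup>2) = (\<Sum>l<m. expectation (\<lambda>\<omega>. (\<xi> l \<omega>)\<^sup>2) * (p (Suc l) - p l))"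
  using assms(3)
proof (induction m)
  case 0
  then show ?case by (simp add: S_def)
next
  case (Suc m)
  let ?D = "\<lambda>\<omega>. B (p (Suc m)) \<omega> - B (p m) \<omega>"
  have mk: "m < k" and pm: "0 \<le> p m" "p m < p (Suc m)"
    using Suc.prems p_less partition_nonneg by auto
  note D = increment_moments[OF pm]
  have SF: "S m \<in> borel_measurable (F (p m))"
    unfolding S_def using \<xi> mk by (intro partition_integral_measurable) auto
  note xF = \<xi>[OF mk]
  have [measurable]: "S m \<in> borel_measurable M" "\<xi> m \<in> borel_measurable M"
    by (fact F_measurable[OF SF] F_measurable[OF xF])+
  have iS2: "integrable M (\<lambda>\<omega>. (S m \<omega>)\<^sup>2)" using Suc by simp
  then have iS: "integrable M (S m)" by (rule square_integrable_imp_integrable[rotated]) simp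
  have iSx: "integrable M (\<lambda>\<omega>. S m \<omega> * \<xi> m \<omega>)"
  proof (rule Bochner_Integration.integrable_bound)
    show "integrable M (\<lambda>\<omega>. \<bar>c m\<bar> * S m \<omega>)" using iS by simp
    show "AE \<omega> in M. norm (S m \<omega> * \<xi> m \<omega>) \<le> norm (\<bar>c m\<bar> * S m \<omega>)"
    proof (rule AE_I2)
      fix \<omega> assume "\<omega> \<in> space M"
      then have "\<bar>\<xi> m \<omega>\<bar> \<le> \<bar>c m\<bar>" using c[OF mk, of \<omega>] by linarith
      then have "\<bar>S m \<omega>\<bar> * \<bar>\<xi> m \<omega>\<bar> \<le> \<bar>S m \<omega>\<bar> * \<bar>c m\<bar>" by (rule mult_left_mono) simp
      then show "norm (S m \<omega> * \<xi> m \<omega>) \<le> norm (\<bar>c m\<bar> * S m \<omega>)"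
        by (simp add: abs_mult mult.commute)
    qed
  qed simp
  have ix2: "integrable M (\<lambda>\<omega>. (\<xi> m \<omega>)\<^sup>2)"
  proof (rule integrable_const_bound[where B="(c m)\<^sup>2"])
    show "AE \<omega> in M. norm ((\<xi> m \<omega>)\<^sup>2) \<le> (c m)\<^sup>2"
    proof (rule AE_I2)
      fix \<omega> assume "\<omega> \<in> space M"
      then have "\<bar>\<xi> m \<omega>\<bar> \<le> \<bar>c m\<bar>" using c[OF mk, of \<omega>] by linarith
      then show "norm ((\<xi> m \<omega>)\<^sup>2) \<le> (c m)\<^sup>2" by (simp add: abs_le_square_iff)
    qed
  qed simp
  have "(\<lambda>\<omega>. S m \<omega> * \<xi> m \<omega>) \<in> borel_measurable (F (p m))" using SF xF by simp
  from indep_increment[OF pm this] have indep1: "indep_var borel (\<lambda>\<omega>. S m \<omega> * \<xi> m \<omega>) borel ?D" .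
  have cross: "integrable M (\<lambda>\<omega>. S m \<omega> * \<xi> m \<omega> * ?D \<omega>)" "expectation (\<lambda>\<omega>. S m \<omega> * \<xi> m \<omega> * ?D \<omega>) = 0"
    using indep_var_integrable[OF indep1 iSx D(1)] indep_var_lebesgue_integral[OF indep1 iSx D(1)] D(2) by auto
  have indep2: "indep_var borel (\<lambda>\<omega>. (\<xi> m \<omega>)\<^sup>2) borel (\<lambda>\<omega>. (?D \<omega>)\<^sup>2)"
    using indep_var_compose[OF indep_increment[OF pm xF], of "\<lambda>x. x\<^sup>2" borel "\<lambda>x. x\<^sup>2" borel]
    by (simp add: o_def)
  have sq: "integrable M (\<lambda>\<omega>. (\<xi> m \<omega>)\<^sup>2 * (?D \<omega>)\<^sup>2)"
     "expectation (\<lambda>\<omega>. (\<xi> m \<omega>)\<^sup>2 * (?D \<omega>)\<^sup>2) = expectation (\<lambda>\<omega>. (\<xi> m \<omega>)\<^sup>2) * (p (Suc m) - p m)"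
    using indep_var_integrable[OF indep2 ix2 D(3)] indep_var_lebesgue_integral[OF indep2 ix2 D(3)] D(4) by auto
  have "(S (Suc m) \<omega>)\<^sup>2 = (S m \<omega>)\<^sup>2 + 2 * (S m \<omega> * \<xi> m \<omega> * ?D \<omega>) + (\<xi> m \<omega>)\<^sup>2 * (?D \<omega>)\<^sup>2" for \<omega>
    by (simp add: S_def power2_sum power_mult_distrib)
  then show ?case using iS2 cross sq Suc by simp
qed

text \<open>
  Lenglart's inequality: the integrand is set to \<open>0\<close> from the step on at which its accumulated square
  would exceed \<open>\<delta>\<close>. The square of the current step is known when the step begins, so the stopped
  integrand is still adapted; the isometry and Chebyshev's inequality apply to it, and it agrees with
  the original one unless the total square exceeds \<open>\<delta>\<close>.
\<close>

lemma partition_lenglart: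
  assumes \<xi>: "\<And>l. l < k \<Longrightarrow> \<xi> l \<in> borel_measurable (F (p l))"
    and c: "\<And>l \<omega>. l < k \<Longrightarrow> \<omega> \<in> space M \<Longrightarrow> \<bar>\<xi> l \<omega>\<bar> \<le> c l" and e: "0 < \<epsilon>" and d: "0 \<le> \<delta>"
  shows "prob {\<omega>\<in>space M. \<epsilon> < \<bar>\<Sum>l<k. \<xi> l \<omega> * (B (p (Suc l)) \<omega> - B (p l) \<omega>)\<bar>}
    \<le> \<delta> / \<epsilon>\<^sup>2 + prob {\<omega>\<in>space M. \<delta> < (\<Sum>l<k. (\<xi> l \<omega>)\<^sup>2 * (p (Suc l) - p l))}"
proof -
  define x where "x l \<omega> = (\<xi> l \<omega>)\<^sup>2 * (p (Suc l) - p l)" for l \<omega>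
  define \<zeta> where "\<zeta> l \<omega> = (if (\<Sum>m\<le>l. x m \<omega>) \<le> \<delta> then \<xi> l \<omega> else 0)" for l \<omega>
  define S where "S \<omega> = (\<Sum>l<k. \<xi> l \<omega> * (B (p (Suc l)) \<omega> - B (p l) \<omega>))" for \<omega>
  define T where "T \<omega> = (\<Sum>l<k. \<zeta> l \<omega> * (B (p (Suc l)) \<omega> - B (p l) \<omega>))" for \<omega>
  have p_mono: "p m \<le> p l" if "m \<le> l" "l < k" for l m
    using partition_mono[of k p m l] p_less that by (simp add: less_imp_le)
  have x_meas: "(\<lambda>\<omega>. \<Sum>m\<le>l. x m \<omega>) \<in> borel_measurable (F (p l))" if "l < k" for l
  proof -
    have "\<xi> m \<in> borel_measurable (F (p l))" if "m \<le> l" for m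
      using that \<open>l < k\<close> by (intro F_measurable_mono[OF p_mono \<xi>]) auto
    then show ?thesis
      unfolding x_def by (intro borel_measurable_sum borel_measurable_times borel_measurable_power) auto
  qed
  have \<zeta>_meas: "\<zeta> l \<in> borel_measurable (F (p l))" if "l < k" for l
    unfolding \<zeta>_def using x_meas[OF that] \<xi>[OF that] by measurable
  have x_M: "x l \<in> borel_measurable M" if "l < k" for l
    unfolding x_def using F_measurable[OF \<xi>[OF that]] by simp
  have [measurable]: "S \<in> borel_measurable M" "T \<in> borel_measurable M" "(\<lambda>\<omega>. \<Sum>l<k. x l \<omega>) \<in> borel_measurable M"
    using partition_integral_measurable[OF \<xi>, of k] partition_integral_measurable[OF \<zeta>_meas, of k] x_M
    unfolding S_def T_def by (auto intro: F_measurable)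
  have \<zeta>_bound: "\<bar>\<zeta> l \<omega>\<bar> \<le> \<bar>c l\<bar>" if "l < k" "\<omega> \<in> space M" for l \<omega>
    using c[OF that] by (auto simp: \<zeta>_def)
  have x_pos: "0 \<le> x l \<omega>" if "l < k" for l \<omega>
    using p_less[OF that] by (simp add: x_def)
  have iso: "integrable M (\<lambda>\<omega>. (T \<omega>)\<^sup>2) \<and>
    expectation (\<lambda>\<omega>. (T \<omega>)\<^sup>2) = (\<Sum>l<k. expectation (\<lambda>\<omega>. (\<zeta> l \<omega>)\<^sup>2) * (p (Suc l) - p l))"
    unfolding T_def by (rule partition_ito_isometry[OF \<zeta>_meas \<zeta>_bound order_refl])
  have i\<zeta>: "integrable M (\<lambda>\<omega>. (\<zeta> l \<omega>)\<^sup>2)" if "l < k" for l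
  proof (rule integrable_const_bound[where B="(c l)\<^sup>2"])
    show "AE \<omega> in M. norm ((\<zeta> l \<omega>)\<^sup>2) \<le> (c l)\<^sup>2"
      using \<zeta>_bound[OF that] by (intro AE_I2) (simp add: abs_le_square_iff)
  qed (use F_measurable[OF \<zeta>_meas[OF that]] in simp)
  have "(\<Sum>l<k. expectation (\<lambda>\<omega>. (\<zeta> l \<omega>)\<^sup>2) * (p (Suc l) - p l)) =
      expectation (\<lambda>\<omega>. \<Sum>l<k. (\<zeta> l \<omega>)\<^sup>2 * (p (Suc l) - p l))"
    using i\<zeta> by (subst Bochner_Integration.integral_sum) auto
  also have "\<dots> \<le> expectation (\<lambda>\<omega>. \<delta>)"
  proof (rule integral_mono)
    show "(\<Sum>l<k. (\<zeta> l \<omega>)\<^sup>2 * (p (Suc l) - p l)) \<le> \<delta>" for \<omega>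
    proof -
      have "(\<Sum>l<k. (\<zeta> l \<omega>)\<^sup>2 * (p (Suc l) - p l)) = (\<Sum>l<k. if (\<Sum>m\<le>l. x m \<omega>) \<le> \<delta> then x l \<omega> else 0)"
        by (rule sum.cong) (auto simp: \<zeta>_def x_def)
      also have "\<dots> \<le> \<delta>" using d x_pos by (rule sum_until_exceeds_le)
      finally show ?thesis .
    qed
  qed (use i\<zeta> in \<open>auto intro!: Bochner_Integration.integrable_sum\<close>)
  finally have ET: "expectation (\<lambda>\<omega>. (T \<omega>)\<^sup>2) \<le> \<delta>"
    using iso by (simp add: prob_space)
  have "prob {\<omega>\<in>space M. \<epsilon> \<le> \<bar>T \<omega>\<bar>} \<le> expectation (\<lambda>\<omega>. (T \<omega>)\<^sup>2) / \<epsilon>\<^sup>2"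
    using iso e by (intro second_moment_method) auto
  also have "\<dots> \<le> \<delta> / \<epsilon>\<^sup>2" using ET by (rule divide_right_mono) simp
  finally have PT: "prob {\<omega>\<in>space M. \<epsilon> \<le> \<bar>T \<omega>\<bar>} \<le> \<delta> / \<epsilon>\<^sup>2" .
  have ST: "S \<omega> = T \<omega>" if "(\<Sum>l<k. x l \<omega>) \<le> \<delta>" for \<omega>
    unfolding S_def T_def
  proof (rule sum.cong[OF refl])
    fix l assume l: "l \<in> {..<k}"
    have "(\<Sum>m\<le>l. x m \<omega>) \<le> (\<Sum>l<k. x l \<omega>)"
      using l x_pos by (intro sum_mono2) auto
    then show "\<xi> l \<omega> * (B (p (Suc l)) \<omega> - B (p l) \<omega>) = \<zeta> l \<omega> * (B (p (Suc l)) \<omega> - B (p l) \<omega>)"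
      using that by (simp add: \<zeta>_def)
  qed
  have "prob {\<omega>\<in>space M. \<epsilon> < \<bar>S \<omega>\<bar>} \<le>
      prob ({\<omega>\<in>space M. \<epsilon> \<le> \<bar>T \<omega>\<bar>} \<union> {\<omega>\<in>space M. \<delta> < (\<Sum>l<k. x l \<omega>)})"
    using ST by (intro finite_measure_mono) (auto simp: not_less[symmetric])
  also have "\<dots> \<le> prob {\<omega>\<in>space M. \<epsilon> \<le> \<bar>T \<omega>\<bar>} + prob {\<omega>\<in>space M. \<delta> < (\<Sum>l<k. x l \<omega>)}"
    by (intro measure_Un_le) measurable
  finally show ?thesis using PT unfolding S_def x_def by simp
qed

lemma partition_wiener_char:
  assumes "m \<le> k"
  shows "expectation (\<lambda>\<omega>. iexp (\<Sum>l<m. z l * (B (p (Suc l)) \<omega> - B (p l) \<omega>))) =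
    of_real (exp (- ((\<Sum>l<m. (z l)\<^sup>2 * (p (Suc l) - p l)) / 2)))"
  using assms
proof (induction m)
  case 0
  then show ?case by (simp add: prob_space)
next
  case (Suc m)
  let ?D = "\<lambda>\<omega>. B (p (Suc m)) \<omega> - B (p m) \<omega>"
  let ?S = "\<lambda>\<omega>. \<Sum>l<m. z l * (B (p (Suc l)) \<omega> - B (p l) \<omega>)"
  have pm: "0 \<le> p m" "p m < p (Suc m)"
    using Suc.prems p_less partition_nonneg by auto
  have SF: "?S \<in> borel_measurable (F (p m))"
    using Suc.prems by (intro partition_integral_measurable) auto
  have indep: "indep_var borel (\<lambda>\<omega>. iexp (?S \<omega>)) borel (\<lambda>\<omega>. iexp (z m * ?D \<omega>))"
    using indep_var_compose[OF indep_increment[OF pm SF], of iexp borel "\<lambda>x. iexp (z m * x)" borel]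
    by (simp add: o_def)
  have i: "integrable M (\<lambda>\<omega>. iexp (?S \<omega>))" "integrable M (\<lambda>\<omega>. iexp (z m * ?D \<omega>))"
    using indep_var_rv1[OF indep] indep_var_rv2[OF indep]
    by (auto intro!: integrable_const_bound[where B=1])
  have "expectation (\<lambda>\<omega>. iexp (\<Sum>l<Suc m. z l * (B (p (Suc l)) \<omega> - B (p l) \<omega>))) =
      expectation (\<lambda>\<omega>. iexp (?S \<omega>) * iexp (z m * ?D \<omega>))"
    by (simp add: exp_add[symmetric] distrib_left)
  also have "\<dots> = expectation (\<lambda>\<omega>. iexp (?S \<omega>)) * expectation (\<lambda>\<omega>. iexp (z m * ?D \<omega>))"
    by (rule indep_var_lebesgue_integral[OF indep i])
  also have "\<dots> = of_real (exp (- ((\<Sum>l<m. (z l)\<^sup>2 * (p (Suc l) - p l)) / 2))) *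
      of_real (exp (- ((z m)\<^sup>2 * (p (Suc m) - p m) / 2)))"
    using Suc.IH Suc.prems increment_char[OF pm, of "z m"] by simp
  also have "\<dots> = of_real (exp (- ((\<Sum>l<m. (z l)\<^sup>2 * (p (Suc l) - p l)) / 2) - (z m)\<^sup>2 * (p (Suc m) - p m) / 2))"
    by (simp only: of_real_mult[symmetric] exp_add[symmetric]) simp
  also have "- ((\<Sum>l<m. (z l)\<^sup>2 * (p (Suc l) - p l)) / 2) - (z m)\<^sup>2 * (p (Suc m) - p m) / 2 =
      - ((\<Sum>l<Suc m. (z l)\<^sup>2 * (p (Suc l) - p l)) / 2)"
    by (simp add: add_divide_distrib)
  finally show ?case .
qed

end

text \<open>
  The intervals may overlap, so the inequality applies to the difference of two simple processes on
  unrelated grids.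
\<close>

lemma elementary_lenglart:
  fixes \<xi> :: "'i \<Rightarrow> 'a \<Rightarrow> real" and a b :: "'i \<Rightarrow> real"
  assumes A: "finite A" and ab: "\<And>i. i \<in> A \<Longrightarrow> 0 \<le> a i \<and> a i \<le> b i"
    and \<xi>: "\<And>i. i \<in> A \<Longrightarrow> \<xi> i \<in> borel_measurable (F (a i))"
    and c: "\<And>i \<omega>. i \<in> A \<Longrightarrow> \<omega> \<in> space M \<Longrightarrow> \<bar>\<xi> i \<omega>\<bar> \<le> c i"
    and e: "0 < \<epsilon>" and d: "0 \<le> \<delta>"
  shows "prob {\<omega>\<in>space M. \<epsilon> < \<bar>\<Sum>i\<in>A. \<xi> i \<omega> * (B (b i) \<omega> - B (a i) \<omega>)\<bar>}
    \<le> \<delta> / \<epsilon>\<^sup>2 + prob {\<omega>\<in>space M. ennreal \<delta> <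
          (\<integral>\<^sup>+s. ennreal ((\<Sum>i\<in>A. \<xi> i \<omega> * indicator {a i<..b i} s)\<^sup>2) \<partial>lborel)}"
proof -
  obtain k p where p0: "0 \<le> p 0" and p_less: "\<forall>l<k. p l < p (Suc l)"
    and eq: "\<forall>c f. (\<Sum>i\<in>A. c i * (f (b i) - f (a i))) =
        (\<Sum>l<k. (\<Sum>i\<in>A. c i * of_bool (a i \<le> p l \<and> p l < b i)) * (f (p (Suc l)) - f (p l) :: real))"
    and ind: "\<forall>c s. (\<Sum>i\<in>A. c i * indicator {a i<..b i} s) =
        (\<Sum>l<k. (\<Sum>i\<in>A. c i * of_bool (a i \<le> p l \<and> p l < b i)) * (indicator {p l<..p (Suc l)} s :: real))"
    by (rule common_partition[OF A ab])
  note p = p0 p_less[rule_format] and eq = eq[rule_format] and ind = ind[rule_format]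
  define \<zeta> where "\<zeta> l \<omega> = (\<Sum>i\<in>A. \<xi> i \<omega> * of_bool (a i \<le> p l \<and> p l < b i))" for l \<omega>
  have \<zeta>_meas: "\<zeta> l \<in> borel_measurable (F (p l))" for l
    unfolding \<zeta>_def
  proof (rule borel_measurable_sum)
    fix i assume i: "i \<in> A"
    show "(\<lambda>\<omega>. \<xi> i \<omega> * of_bool (a i \<le> p l \<and> p l < b i)) \<in> borel_measurable (F (p l))"
    proof (cases "a i \<le> p l")
      case True
      then show ?thesis using F_measurable_mono[OF True \<xi>[OF i]] by simp
    qed simp
  qed
  have \<zeta>_bound: "\<bar>\<zeta> l \<omega>\<bar> \<le> (\<Sum>i\<in>A. c i)" if "\<omega> \<in> space M" for l \<omega>
    unfolding \<zeta>_def
  proof (rule order_trans[OF sum_abs sum_mono])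
    fix i assume i: "i \<in> A"
    show "\<bar>\<xi> i \<omega> * of_bool (a i \<le> p l \<and> p l < b i)\<bar> \<le> c i"
      using c[OF i that] by (cases "a i \<le> p l \<and> p l < b i") auto
  qed
  have int: "(\<integral>\<^sup>+s. ennreal ((\<Sum>i\<in>A. \<xi> i \<omega> * indicator {a i<..b i} s)\<^sup>2) \<partial>lborel) =
      ennreal (\<Sum>l<k. (\<zeta> l \<omega>)\<^sup>2 * (p (Suc l) - p l))" for \<omega>
  proof -
    have "has_bochner_integral lborel (\<lambda>s. (\<Sum>l<k. \<zeta> l \<omega> * indicator {p l<..p (Suc l)} s)\<^sup>2)
           (\<Sum>l<k. (\<zeta> l \<omega>)\<^sup>2 * (p (Suc l) - p l))"
      by (rule partition_square_integral) (rule p(2))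
    then show ?thesis
      unfolding ind \<zeta>_def[symmetric] by (simp add: has_bochner_integral_iff nn_integral_eq_integral)
  qed
  show ?thesis
    unfolding int eq[where f="\<lambda>x. B x _"] ennreal_less_iff[OF d] \<zeta>_def[symmetric]
    by (rule partition_lenglart[where c="\<lambda>_. \<Sum>i\<in>A. c i"]) (use p \<zeta>_meas \<zeta>_bound e d in auto)
qed

lemma wiener_char:
  fixes c a b :: "'i \<Rightarrow> real"
  assumes A: "finite A" and ab: "\<And>i. i \<in> A \<Longrightarrow> 0 \<le> a i \<and> a i \<le> b i"
  shows "expectation (\<lambda>\<omega>. iexp (\<Sum>i\<in>A. c i * (B (b i) \<omega> - B (a i) \<omega>))) =
    of_real (exp (- ((\<integral>s. (\<Sum>i\<in>A. c i * indicator {a i<..b i} s)\<^sup>2 \<partial>lborel) / 2)))"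
proof -
  obtain k p where p0: "0 \<le> p 0" and p_less: "\<forall>l<k. p l < p (Suc l)"
    and eq: "\<forall>c f. (\<Sum>i\<in>A. c i * (f (b i) - f (a i))) =
        (\<Sum>l<k. (\<Sum>i\<in>A. c i * of_bool (a i \<le> p l \<and> p l < b i)) * (f (p (Suc l)) - f (p l) :: real))"
    and ind: "\<forall>c s. (\<Sum>i\<in>A. c i * indicator {a i<..b i} s) =
        (\<Sum>l<k. (\<Sum>i\<in>A. c i * of_bool (a i \<le> p l \<and> p l < b i)) * (indicator {p l<..p (Suc l)} s :: real))"
    by (rule common_partition[OF A ab])
  note p = p0 p_less[rule_format] and eq = eq[rule_format] and ind = ind[rule_format]
  define z where "z l = (\<Sum>i\<in>A. c i * of_bool (a i \<le> p l \<and> p l < b i))" for l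
  have "has_bochner_integral lborel (\<lambda>s. (\<Sum>l<k. z l * indicator {p l<..p (Suc l)} s)\<^sup>2)
         (\<Sum>l<k. (z l)\<^sup>2 * (p (Suc l) - p l))"
    by (rule partition_square_integral) (rule p(2))
  then have int: "(\<integral>s. (\<Sum>i\<in>A. c i * indicator {a i<..b i} s)\<^sup>2 \<partial>lborel) =
      (\<Sum>l<k. (z l)\<^sup>2 * (p (Suc l) - p l))"
    unfolding ind z_def[symmetric] by (simp add: has_bochner_integral_iff)
  show ?thesis
    unfolding int eq[where f="\<lambda>x. B x _"] z_def[symmetric]
    by (rule partition_wiener_char[where k=k]) (use p in auto)
qed

lemma square_integral_measurable:
  assumes "(\<lambda>(\<omega>, s). G s \<omega>) \<in> borel_measurable (M \<Otimes>\<^sub>M restrict_space lborel {0..T::real})"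
  shows "(\<lambda>\<omega>. \<integral>\<^sup>+s\<in>{0..T}. ennreal ((G s \<omega> :: real)\<^sup>2) \<partial>lborel) \<in> borel_measurable M"
proof -
  interpret sigma_finite_measure "restrict_space lborel {0..T::real}"
    by (rule sigma_finite_measure_restrict_space[OF sigma_finite_lborel]) simp
  have "(\<lambda>(\<omega>, s). ennreal ((G s \<omega>)\<^sup>2)) \<in> borel_measurable (M \<Otimes>\<^sub>M restrict_space lborel {0..T})"
    using measurable_compose[OF assms, of "\<lambda>x. ennreal (x\<^sup>2)" borel] by (simp add: split_def)
  from borel_measurable_nn_integral[OF this] show ?thesis
    by (simp add: nn_integral_restrict_space)
qed

lemma progressive_measurable:
  assumes "progressive F T H" "0 \<le> T"
  shows "(\<lambda>(\<omega>, s). H s \<omega>) \<in> borel_measurable (M \<Otimes>\<^sub>M restrict_space lborel {0..T})"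
proof -
  have H: "(\<lambda>(s, \<omega>). H s \<omega>) \<in> borel_measurable (restrict_space borel {0..T} \<Otimes>\<^sub>M F T)"
    using assms by (auto simp: progressive_def)
  have id: "(\<lambda>\<omega>. \<omega>) \<in> measurable M (F T)"
    using sets_F_le[of T] by (auto simp: measurable_def space_F intro: sets.sets_into_space[THEN Int_absorb2, THEN ssubst])
  have "(\<lambda>x. (snd x, fst x)) \<in> measurable (M \<Otimes>\<^sub>M restrict_space lborel {0..T}) (restrict_space borel {0..T} \<Otimes>\<^sub>M F T)"
  proof (rule measurable_Pair)
    show "snd \<in> measurable (M \<Otimes>\<^sub>M restrict_space lborel {0..T}) (restrict_space borel {0..T})"
      using measurable_snd[of M "restrict_space lborel {0..T}"]
      by (simp add: measurable_cong_sets[OF refl sets_restrict_space_cong[OF sets_lborel]])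
    show "fst \<in> measurable (M \<Otimes>\<^sub>M restrict_space lborel {0..T}) (F T)"
      by (rule measurable_compose[OF measurable_fst id, unfolded])
  qed
  from measurable_compose[OF this H] show ?thesis by (simp add: split_def)
qed

lemma integrand_error_measurable:
  assumes H: "progressive F T H" "0 \<le> T" and \<phi>: "\<phi> \<in> borel_measurable borel"
  shows "(\<lambda>\<omega>. \<integral>\<^sup>+s\<in>{0..T}. ennreal ((H s \<omega> - \<phi> s)\<^sup>2) \<partial>lborel) \<in> borel_measurable M"
proof -
  let ?R = "restrict_space lborel {0..T}"
  have "\<phi> \<in> borel_measurable ?R" using \<phi> by (intro measurable_restrict_space1) simp
  then have "(\<lambda>x. \<phi> (snd x)) \<in> borel_measurable (M \<Otimes>\<^sub>M ?R)"
    by (rule measurable_compose[OF measurable_snd])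
  from borel_measurable_diff[OF progressive_measurable[OF H] this] show ?thesis
    by (intro square_integral_measurable) (simp add: split_def)
qed

text \<open>
  Lenglart's inequality for the difference of an Ito integral and a Wiener integral of a step function,
  obtained along the simple processes that define the Ito integral. One factor \<open>2\<close> is spent on
  the threshold and a factor \<open>4\<close> on the square, through \<open>(x - y)\<^sup>2 \<le> 2 (x - h)\<^sup>2 + 2 (h - y)\<^sup>2\<close>.
\<close>

lemma ito_integral_error:
  fixes c a b :: "'i \<Rightarrow> real"
  assumes I: "has_ito_integral M F B T H I" and T: "0 \<le> T"
    and A: "finite A" and ab: "\<And>i. i \<in> A \<Longrightarrow> 0 \<le> a i \<and> a i \<le> b i \<and> b i \<le> T"
    and e: "0 < \<epsilon>" and d: "0 < \<delta>"
  shows "prob {\<omega>\<in>space M. 2 * \<epsilon> < \<bar>I \<omega> - (\<Sum>i\<in>A. c i * (B (b i) \<omega> - B (a i) \<omega>))\<bar>} \<le> 4 * \<delta> / \<epsilon>\<^sup>2 +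
    prob {\<omega>\<in>space M. ennreal \<delta> <
      (\<integral>\<^sup>+s\<in>{0..T}. ennreal ((H s \<omega> - (\<Sum>i\<in>A. c i * indicator {a i<..b i} s))\<^sup>2) \<partial>lborel)}"
proof -
  let ?R = "restrict_space lborel {0..T}"
  define J where "J \<omega> = (\<Sum>i\<in>A. c i * (B (b i) \<omega> - B (a i) \<omega>))" for \<omega>
  define \<phi> where "\<phi> s = (\<Sum>i\<in>A. c i * indicator {a i<..b i} s)" for s :: real
  have prog: "progressive F T H" and I_meas [measurable]: "I \<in> borel_measurable M"
    using I by (auto simp: has_ito_integral_def)
  note H [measurable] = progressive_measurable[OF prog T]
  have J_meas [measurable]: "J \<in> borel_measurable M"
    unfolding J_def using ab
    by (intro borel_measurable_sum borel_measurable_times borel_measurable_diff B_measurable) (auto intro: order_trans)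
  have \<phi>_meas [measurable]: "\<phi> \<in> borel_measurable borel"
    unfolding \<phi>_def by measurable
  obtain k \<tau> \<xi> where simple: "\<And>m. simple_integrand M F T (k m) (\<tau> m) (\<xi> m)"
    and conv1: "(\<lambda>m. measure M {\<omega>\<in>space M. ennreal \<delta> <
           (\<integral>\<^sup>+s\<in>{0..T}. ennreal ((simple_process (k m) (\<tau> m) (\<xi> m) s \<omega> - H s \<omega>)\<^sup>2) \<partial>lborel)})
         \<longlonglongrightarrow> 0"
    and conv2: "(\<lambda>m. measure M {\<omega>\<in>space M.
           \<epsilon> < \<bar>simple_integral B (k m) (\<tau> m) (\<xi> m) \<omega> - I \<omega>\<bar>}) \<longlonglongrightarrow> 0"
    using I e d unfolding has_ito_integral_def by blast
  define Q where "Q \<omega> = (\<integral>\<^sup>+s\<in>{0..T}. ennreal ((H s \<omega> - \<phi> s)\<^sup>2) \<partial>lborel)" for \<omega>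
  define P where "P m \<omega> = (\<integral>\<^sup>+s\<in>{0..T}. ennreal ((simple_process (k m) (\<tau> m) (\<xi> m) s \<omega> - H s \<omega>)\<^sup>2) \<partial>lborel)" for m \<omega>
  have Q_meas [measurable]: "Q \<in> borel_measurable M"
    unfolding Q_def by (rule integrand_error_measurable[OF prog T \<phi>_meas])
  have bound: "prob {\<omega>\<in>space M. 2 * \<epsilon> < \<bar>I \<omega> - J \<omega>\<bar>} \<le>
      prob {\<omega>\<in>space M. \<epsilon> < \<bar>simple_integral B (k m) (\<tau> m) (\<xi> m) \<omega> - I \<omega>\<bar>} +
      (4 * \<delta> / \<epsilon>\<^sup>2 + (prob {\<omega>\<in>space M. ennreal \<delta> < P m \<omega>} + prob {\<omega>\<in>space M. ennreal \<delta> < Q \<omega>}))"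
    for m
  proof -
    define S where "S = simple_integral B (k m) (\<tau> m) (\<xi> m)"
    define G where "G = simple_process (k m) (\<tau> m) (\<xi> m)"
    have \<tau>: "\<tau> m 0 = 0" "\<tau> m (k m) = T" "\<And>i. i < k m \<Longrightarrow> \<tau> m i \<le> \<tau> m (Suc i)"
      and \<xi>: "\<And>i. i < k m \<Longrightarrow> \<xi> m i \<in> borel_measurable (F (\<tau> m i))"
      using simple[of m] by (auto simp: simple_integrand_def)
    have "\<forall>i<k m. \<exists>c. \<forall>\<omega>\<in>space M. \<bar>\<xi> m i \<omega>\<bar> \<le> c"
      using simple[of m] by (auto simp: simple_integrand_def)
    then obtain C where C: "\<And>i \<omega>. i < k m \<Longrightarrow> \<omega> \<in> space M \<Longrightarrow> \<bar>\<xi> m i \<omega>\<bar> \<le> C i"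
      by metis
    have \<tau>_pos: "0 \<le> \<tau> m i" and \<tau>_le: "\<tau> m i \<le> T" if "i \<le> k m" for i
      using partition_mono[of "k m" "\<tau> m" 0 i] partition_mono[of "k m" "\<tau> m" i "k m"] \<tau> that by auto
    have \<xi>_M [measurable]: "i < k m \<Longrightarrow> \<xi> m i \<in> borel_measurable M" for i
      using F_measurable[OF \<xi>] by blast
    have S_meas [measurable]: "S \<in> borel_measurable M"
      unfolding S_def simple_integral_def[abs_def]
      by (intro borel_measurable_sum borel_measurable_times borel_measurable_diff B_measurable \<xi>_M \<tau>_pos) auto
    have G_meas [measurable]: "(\<lambda>(\<omega>, s). G s \<omega>) \<in> borel_measurable (M \<Otimes>\<^sub>M ?R)"
    proof -
      have "(\<lambda>x. \<Sum>i<k m. \<xi> m i (fst x) * indicator {\<tau> m i<..\<tau> m (Suc i)} (snd x)) \<in> borel_measurable (M \<Otimes>\<^sub>M ?R)"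
      proof (intro borel_measurable_sum borel_measurable_times)
        fix i assume "i \<in> {..<k m}"
        then show "(\<lambda>x. \<xi> m i (fst x)) \<in> borel_measurable (M \<Otimes>\<^sub>M ?R)"
          by (intro measurable_compose[OF measurable_fst \<xi>_M]) simp
        have "indicat_real {\<tau> m i<..\<tau> m (Suc i)} \<in> borel_measurable ?R"
          by (intro measurable_restrict_space1) simp
        then show "(\<lambda>x. indicat_real {\<tau> m i<..\<tau> m (Suc i)} (snd x)) \<in> borel_measurable (M \<Otimes>\<^sub>M ?R)"
          by (rule measurable_compose[OF measurable_snd])
      qed
      then show ?thesis by (simp add: G_def simple_process_def split_def)
    qed
    have P_meas [measurable]: "P m \<in> borel_measurable M"
      unfolding P_def G_def[symmetric] by (rule square_integral_measurable) measurable
    let ?A = "{..<k m} <+> A"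
    let ?\<xi> = "case_sum (\<xi> m) (\<lambda>i \<omega>. - c i)"
    let ?a = "case_sum (\<tau> m) a" and ?b = "case_sum (\<lambda>i. \<tau> m (Suc i)) b"
    have int: "(\<Sum>i\<in>?A. ?\<xi> i \<omega> * (B (?b i) \<omega> - B (?a i) \<omega>)) = S \<omega> - J \<omega>" for \<omega>
      by (simp add: sum.Plus A S_def J_def simple_integral_def sum_negf)
    have proc: "(\<Sum>i\<in>?A. ?\<xi> i \<omega> * indicator {?a i<..?b i} s) = G s \<omega> - \<phi> s" for \<omega> s
      unfolding G_def \<phi>_def simple_process_def
      by (subst sum.Plus) (simp_all only: A finite_lessThan o_def sum.case mult_minus_left sum_negf diff_conv_add_uminus)
    have "prob {\<omega>\<in>space M. \<epsilon> < \<bar>S \<omega> - J \<omega>\<bar>} \<le> (4 * \<delta>) / \<epsilon>\<^sup>2 +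
        prob {\<omega>\<in>space M. ennreal (4 * \<delta>) < (\<integral>\<^sup>+s. ennreal ((G s \<omega> - \<phi> s)\<^sup>2) \<partial>lborel)}"
      unfolding int[symmetric] proc[symmetric]
    proof (rule elementary_lenglart[where c="case_sum C (\<lambda>i. \<bar>c i\<bar>)"])
      show "0 \<le> ?a i \<and> ?a i \<le> ?b i" if "i \<in> ?A" for i
        using that \<tau>(3) \<tau>_pos ab by auto
      show "?\<xi> i \<in> borel_measurable (F (?a i))" if "i \<in> ?A" for i
        using that \<xi> by auto
      show "\<bar>?\<xi> i \<omega>\<bar> \<le> case_sum C (\<lambda>i. \<bar>c i\<bar>) i" if "i \<in> ?A" "\<omega> \<in> space M" for i \<omega>
        using that C by auto
    qed (use A e d in auto)
    also have "prob {\<omega>\<in>space M. ennreal (4 * \<delta>) < (\<integral>\<^sup>+s. ennreal ((G s \<omega> - \<phi> s)\<^sup>2) \<partial>lborel)} \<le>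
        prob ({\<omega>\<in>space M. ennreal \<delta> < P m \<omega>} \<union> {\<omega>\<in>space M. ennreal \<delta> < Q \<omega>})"
    proof (rule finite_measure_mono)
      show "{\<omega>\<in>space M. ennreal (4 * \<delta>) < (\<integral>\<^sup>+s. ennreal ((G s \<omega> - \<phi> s)\<^sup>2) \<partial>lborel)} \<subseteq>
        {\<omega>\<in>space M. ennreal \<delta> < P m \<omega>} \<union> {\<omega>\<in>space M. ennreal \<delta> < Q \<omega>}"
      proof (rule subsetI, rule ccontr)
        fix \<omega>
        assume "\<omega> \<in> {\<omega>\<in>space M. ennreal (4 * \<delta>) < (\<integral>\<^sup>+s. ennreal ((G s \<omega> - \<phi> s)\<^sup>2) \<partial>lborel)}"
          and "\<omega> \<notin> {\<omega>\<in>space M. ennreal \<delta> < P m \<omega>} \<union> {\<omega>\<in>space M. ennreal \<delta> < Q \<omega>}"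
        then have \<omega>: "\<omega> \<in> space M" and big: "ennreal (4 * \<delta>) < (\<integral>\<^sup>+s. ennreal ((G s \<omega> - \<phi> s)\<^sup>2) \<partial>lborel)"
          and small: "P m \<omega> \<le> ennreal \<delta>" "Q \<omega> \<le> ennreal \<delta>"
          by (auto simp: not_less)
        have [measurable]: "(\<lambda>s. H s \<omega>) \<in> borel_measurable ?R" "(\<lambda>s. G s \<omega>) \<in> borel_measurable ?R"
          using measurable_Pair2[OF H \<omega>] measurable_Pair2[OF G_meas \<omega>] by simp_all
        have [measurable]: "\<phi> \<in> borel_measurable ?R"
          by (intro measurable_restrict_space1) simp
        have "G s \<omega> - \<phi> s = 0" if "s \<notin> {0..T}" for s
        proof -
          have "?\<xi> i \<omega> * indicator {?a i<..?b i} s = 0" if "i \<in> ?A" for i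
            using that \<open>s \<notin> {0..T}\<close> \<tau>_pos \<tau>_le ab
            by (auto simp: indicator_def) (meson Suc_leI less_imp_le_nat less_le_not_le order_trans)+
          then show ?thesis unfolding proc[symmetric] by (intro sum.neutral) blast
        qed
        then have "(\<integral>\<^sup>+s. ennreal ((G s \<omega> - \<phi> s)\<^sup>2) \<partial>lborel) =
            (\<integral>\<^sup>+s\<in>{0..T}. ennreal ((G s \<omega> - \<phi> s)\<^sup>2) \<partial>lborel)"
          by (intro nn_integral_cong) (auto simp: indicator_def)
        also have "\<dots> = (\<integral>\<^sup>+s. ennreal ((G s \<omega> - \<phi> s)\<^sup>2) \<partial>?R)"
          by (simp add: nn_integral_restrict_space)
        also have "\<dots> \<le> (\<integral>\<^sup>+s. 2 * ennreal ((G s \<omega> - H s \<omega>)\<^sup>2) + 2 * ennreal ((H s \<omega> - \<phi> s)\<^sup>2) \<partial>?R)"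
        proof (rule nn_integral_mono)
          fix s
          have "(G s \<omega> - \<phi> s)\<^sup>2 \<le> 2 * (G s \<omega> - H s \<omega>)\<^sup>2 + 2 * (H s \<omega> - \<phi> s)\<^sup>2"
            using zero_le_power2[of "(G s \<omega> - H s \<omega>) - (H s \<omega> - \<phi> s)"]
            by (simp add: power2_eq_square algebra_simps)
          then have "ennreal ((G s \<omega> - \<phi> s)\<^sup>2) \<le> ennreal (2 * (G s \<omega> - H s \<omega>)\<^sup>2 + 2 * (H s \<omega> - \<phi> s)\<^sup>2)"
            by (rule ennreal_leI)
          then show "ennreal ((G s \<omega> - \<phi> s)\<^sup>2) \<le> 2 * ennreal ((G s \<omega> - H s \<omega>)\<^sup>2) + 2 * ennreal ((H s \<omega> - \<phi> s)\<^sup>2)"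
            by (simp add: ennreal_plus ennreal_mult')
        qed
        also have "\<dots> = 2 * P m \<omega> + 2 * Q \<omega>"
          by (subst nn_integral_add)
             (simp_all add: nn_integral_cmult P_def Q_def G_def[symmetric] nn_integral_restrict_space)
        also have "\<dots> \<le> 2 * ennreal \<delta> + 2 * ennreal \<delta>"
          using small by (intro add_mono mult_left_mono) auto
        also have "\<dots> = ennreal (4 * \<delta>)"
          using d by (simp add: ennreal_mult'[symmetric] ennreal_plus[symmetric] del: ennreal_plus flip: ennreal_numeral)
        finally show False using big by simp
      qed
    qed measurable
    also have "\<dots> \<le> prob {\<omega>\<in>space M. ennreal \<delta> < P m \<omega>} + prob {\<omega>\<in>space M. ennreal \<delta> < Q \<omega>}"
      by (intro measure_Un_le) measurable
    finally have SJ: "prob {\<omega>\<in>space M. \<epsilon> < \<bar>S \<omega> - J \<omega>\<bar>} \<le> 4 * \<delta> / \<epsilon>\<^sup>2 +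
        (prob {\<omega>\<in>space M. ennreal \<delta> < P m \<omega>} + prob {\<omega>\<in>space M. ennreal \<delta> < Q \<omega>})"
      by simp
    have "prob {\<omega>\<in>space M. 2 * \<epsilon> < \<bar>I \<omega> - J \<omega>\<bar>} \<le>
        prob ({\<omega>\<in>space M. \<epsilon> < \<bar>S \<omega> - I \<omega>\<bar>} \<union> {\<omega>\<in>space M. \<epsilon> < \<bar>S \<omega> - J \<omega>\<bar>})"
      by (rule finite_measure_mono) auto
    also have "\<dots> \<le> prob {\<omega>\<in>space M. \<epsilon> < \<bar>S \<omega> - I \<omega>\<bar>} + prob {\<omega>\<in>space M. \<epsilon> < \<bar>S \<omega> - J \<omega>\<bar>}"
      by (intro measure_Un_le) measurable
    finally show ?thesis using SJ unfolding S_def by linarith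
  qed
  have "(\<lambda>m. prob {\<omega>\<in>space M. \<epsilon> < \<bar>simple_integral B (k m) (\<tau> m) (\<xi> m) \<omega> - I \<omega>\<bar>} +
      (4 * \<delta> / \<epsilon>\<^sup>2 + (prob {\<omega>\<in>space M. ennreal \<delta> < P m \<omega>} + prob {\<omega>\<in>space M. ennreal \<delta> < Q \<omega>})))
      \<longlonglongrightarrow> 0 + (4 * \<delta> / \<epsilon>\<^sup>2 + (0 + prob {\<omega>\<in>space M. ennreal \<delta> < Q \<omega>}))"
    using conv1 conv2 unfolding P_def[symmetric] by (intro tendsto_intros)
  from LIMSEQ_le_const[OF this] bound
  have "prob {\<omega>\<in>space M. 2 * \<epsilon> < \<bar>I \<omega> - J \<omega>\<bar>} \<le> 0 + (4 * \<delta> / \<epsilon>\<^sup>2 + (0 + prob {\<omega>\<in>space M. ennreal \<delta> < Q \<omega>}))"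
    by blast
  then show ?thesis by (simp add: J_def Q_def \<phi>_def)
qed

text \<open>
  All grid points of a simple process on \<open>[0, 0]\<close> are \<open>0\<close>, so the approximating integrals vanish.
\<close>

lemma ito_integral_at_0:
  assumes "has_ito_integral M F B 0 H I"
  shows "AE \<omega> in M. I \<omega> = 0"
proof -
  have I_meas [measurable]: "I \<in> borel_measurable M"
    using assms by (auto simp: has_ito_integral_def)
  have "prob {\<omega>\<in>space M. e < \<bar>I \<omega>\<bar>} = 0" if e: "0 < e" for e
  proof -
    obtain k \<tau> \<xi> where simple: "\<And>m. simple_integrand M F 0 (k m) (\<tau> m) (\<xi> m)"
      and conv: "(\<lambda>m::nat. measure M {\<omega>\<in>space M.
           e < \<bar>simple_integral B (k m) (\<tau> m) (\<xi> m) \<omega> - I \<omega>\<bar>}) \<longlonglongrightarrow> 0"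
      using assms e unfolding has_ito_integral_def by blast
    have "simple_integral B (k m) (\<tau> m) (\<xi> m) \<omega> = 0" for m \<omega>
    proof -
      have \<tau>: "\<tau> m i = 0" if "i \<le> k m" for i
        using simple[of m] that partition_mono[of "k m" "\<tau> m" 0 i] partition_mono[of "k m" "\<tau> m" i "k m"]
        by (auto simp: simple_integrand_def)
      then show ?thesis
        unfolding simple_integral_def by (intro sum.neutral) (auto simp: \<tau> Suc_leI)
    qed
    with conv have "(\<lambda>m::nat. prob {\<omega>\<in>space M. e < \<bar>I \<omega>\<bar>}) \<longlonglongrightarrow> 0" by simp
    then show ?thesis by (simp add: LIMSEQ_const_iff)
  qed
  then have "AE \<omega> in M. \<not> inverse (real (Suc n)) < \<bar>I \<omega>\<bar>" for n
    by (intro AE_I[where N="{\<omega>\<in>space M. inverse (real (Suc n)) < \<bar>I \<omega>\<bar>}"]) (auto simp: emeasure_eq_measure)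
  then have "AE \<omega> in M. \<forall>n. \<not> inverse (real (Suc n)) < \<bar>I \<omega>\<bar>"
    by (simp add: AE_all_countable)
  then show ?thesis
  proof (rule AE_mp, intro AE_I2 impI)
    fix \<omega> assume *: "\<forall>n. \<not> inverse (real (Suc n)) < \<bar>I \<omega>\<bar>"
    show "I \<omega> = 0"
    proof (rule ccontr)
      assume "I \<omega> \<noteq> 0"
      then have "0 < \<bar>I \<omega>\<bar>" by simp
      from reals_Archimedean[OF this] * show False by blast
    qed
  qed
qed

end


section \<open>Square integrable monotone kernels\<close>

lemma holder_continuous:
  assumes "holder a f" "0 < a"
  shows "continuous_on UNIV f"
proof -
  obtain C where C: "\<And>x y. \<bar>f x - f y\<bar> \<le> C * \<bar>x - y\<bar> powr a"
    using assms(1) unfolding holder_def by blast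
  have "isCont f x" for x
  proof -
    have l: "((\<lambda>y. \<bar>y - x\<bar>) \<longlongrightarrow> 0) (at x)"
      by (rule tendsto_eq_rhs[OF tendsto_rabs[OF tendsto_diff[OF tendsto_ident_at tendsto_const]]]) simp
    have "((\<lambda>y. \<bar>y - x\<bar> powr a) \<longlongrightarrow> 0) (at x)"
      by (rule tendsto_zero_powrI[OF l tendsto_const _ assms(2)]) simp
    then have bound: "((\<lambda>y. C * \<bar>y - x\<bar> powr a) \<longlongrightarrow> 0) (at x)"
      by (rule tendsto_mult_right_zero)
    have "((\<lambda>y. f y - f x) \<longlongrightarrow> 0) (at x)"
      by (rule Lim_null_comparison[OF _ bound]) (simp add: C)
    then show ?thesis by (simp add: isCont_def LIM_zero_iff)
  qed
  then show ?thesis by (simp add: continuous_on_eq_continuous_at)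
qed

lemma completely_monotone_kernel:
  assumes "completely_monotone K"
  shows completely_monotone_nonneg: "0 < r \<Longrightarrow> 0 \<le> K r"
    and completely_monotone_antimono: "0 < r \<Longrightarrow> r \<le> s \<Longrightarrow> K s \<le> K r"
    and completely_monotone_isCont: "0 < r \<Longrightarrow> isCont K r"
proof -
  have d: "K differentiable (at r)" "0 \<le> K r" if "0 < r" for r
    using assms[unfolded completely_monotone_def, rule_format, of r 0] that by auto
  have d': "deriv K r \<le> 0" if "0 < r" for r
    using assms[unfolded completely_monotone_def, rule_format, of r 1] that by auto
  show "0 < r \<Longrightarrow> 0 \<le> K r" using d by blast
  show "0 < r \<Longrightarrow> isCont K r" using d(1) by (rule differentiable_imp_continuous_within)
  show "K s \<le> K r" if "0 < r" "r \<le> s"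
  proof (rule DERIV_nonpos_imp_nonincreasing[OF that(2)])
    fix x assume "r \<le> x"
    then have "0 < x" using that by simp
    then have "(K has_real_derivative deriv K x) (at x)"
      using d(1) DERIV_deriv_iff_real_differentiable by blast
    then show "\<exists>y. (K has_real_derivative y) (at x) \<and> y \<le> 0"
      using d' \<open>0 < x\<close> by blast
  qed
qed

lemma AE_lborel_neq: "AE r in lborel. r \<noteq> (c::real)"
  by (rule AE_lborel_singleton)

text \<open>Changing a function at one point affects neither its measurability nor its integral.\<close>

lemma lborel_integral_cong_except_point:
  fixes f g :: "real \<Rightarrow> real"
  assumes eq: "\<And>s. s \<noteq> c \<Longrightarrow> f s = g s"
  shows "(\<integral>s. f s \<partial>lborel) = (\<integral>s. g s \<partial>lborel)"
proof -
  have meas: "u \<in> borel_measurable borel" if [measurable]: "v \<in> borel_measurable borel"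
    and "\<And>s. s \<noteq> c \<Longrightarrow> u s = v s" for u v :: "real \<Rightarrow> real"
  proof -
    have "u = (\<lambda>s. if s = c then u c else v s)" using that(2) by auto
    also have "\<dots> \<in> borel_measurable borel" by measurable
    finally show ?thesis .
  qed
  show ?thesis
  proof (cases "g \<in> borel_measurable borel")
    case True
    then have "f \<in> borel_measurable borel" using meas eq by blast
    then show ?thesis
      using True AE_lborel_neq[of c] by (intro integral_cong_AE) (auto simp: eq elim!: AE_mp)
  next
    case False
    then have "f \<notin> borel_measurable borel" using meas[of f g] eq by metis
    then have "\<not> integrable lborel f" "\<not> integrable lborel g"
      using False by (auto dest: borel_measurable_integrable)
    then show ?thesis by (simp add: not_integrable_integral_eq)
  qed
qed

lemma integrable_indicator_Icc: "integrable lborel (indicat_real {a..b::real})"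
  by (rule integrable_real_indicator) (auto simp: emeasure_lborel_Icc_eq)

text \<open>
  The kernel may be singular at \<open>0\<close>, and its values at arguments \<open>\<le> 0\<close> are arbitrary.
\<close>

locale monotone_kernel =
  fixes K :: "real \<Rightarrow> real"
  assumes nonneg: "0 < r \<Longrightarrow> 0 \<le> K r"
    and antimono: "0 < r \<Longrightarrow> r \<le> s \<Longrightarrow> K s \<le> K r"
    and cont: "0 < r \<Longrightarrow> isCont K r"
    and square_integrable: "set_integrable lborel {0..1} (\<lambda>r. (K r)\<^sup>2)"
begin

text \<open>
  The integrand \<open>s \<mapsto> K (T - s)\<close> of a convolution on \<open>[0, T]\<close>. It is \<open>0\<close> at the end point \<open>T\<close>, where the
  kernel may be singular.
\<close>

definition profile :: "real \<Rightarrow> real \<Rightarrow> real" where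
  "profile T s = (if 0 \<le> s \<and> s < T then K (T - s) else 0)"

text \<open>
  The kernel is evaluated at the left end of each cell, where \<open>K (T - s)\<close> is smallest. Hence the step
  function lies below the profile, which dominates the approximation error.
\<close>

definition step :: "real \<Rightarrow> nat \<Rightarrow> real \<Rightarrow> real" where
  "step T m s = (\<Sum>i<m. K (T - real i * T / real m) * indicator {real i * T / real m<..real (Suc i) * T / real m} s)"

lemma kernel_measurable: "(\<lambda>r. if 0 < r then K r else 0) \<in> borel_measurable borel"
proof -
  have "continuous_on {0<..} K"
    using cont by (simp add: continuous_on_eq_continuous_at)
  then have "(\<lambda>r. indicator {0<..} r *\<^sub>R K r) \<in> borel_measurable borel"
    by (intro borel_measurable_continuous_on_indicator) auto
  moreover have "(\<lambda>r. indicator {0<..} r *\<^sub>R K r) = (\<lambda>r. if 0 < r then K r else 0)"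
    by (auto simp: indicator_def)
  ultimately show ?thesis by simp
qed

lemma profile_measurable [measurable]: "profile T \<in> borel_measurable borel"
proof -
  have "profile T = (\<lambda>s. indicator {0..} s * (\<lambda>r. if 0 < r then K r else 0) (T - s))"
    by (auto simp: profile_def indicator_def)
  then show ?thesis
    using measurable_compose[of "\<lambda>s. T - s" borel borel, OF _ kernel_measurable] by simp
qed

lemma step_measurable [measurable]: "step T m \<in> borel_measurable borel"
  unfolding step_def by measurable

lemma profile_nonneg: "0 \<le> profile T s"
  using nonneg by (simp add: profile_def)

lemma integrable_square_on: "integrable lborel (\<lambda>r. if 0 < r \<and> r \<le> T then (K r)\<^sup>2 else 0)"
proof -
  let ?L = "\<lambda>r. if 0 < r then K r else 0"
  have [measurable]: "?L \<in> borel_measurable borel" by (rule kernel_measurable)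
  have meas: "(\<lambda>r. if 0 < r \<and> r \<le> T then (K r)\<^sup>2 else 0) \<in> borel_measurable lborel"
  proof -
    have "(\<lambda>r. if 0 < r \<and> r \<le> T then (K r)\<^sup>2 else 0) = (\<lambda>r. (?L r)\<^sup>2 * indicator {..T} r)"
      by (auto simp: indicator_def)
    then show ?thesis by simp
  qed
  show ?thesis
  proof (rule Bochner_Integration.integrable_bound[OF _ meas])
    show "integrable lborel (\<lambda>r. indicator {0..1} r *\<^sub>R (K r)\<^sup>2 + (K 1)\<^sup>2 * indicator {0..T} r)"
      using square_integrable integrable_indicator_Icc unfolding set_integrable_def
      by (intro Bochner_Integration.integrable_add integrable_mult_right) auto
    show "AE r in lborel. norm (if 0 < r \<and> r \<le> T then (K r)\<^sup>2 else 0)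
        \<le> norm (indicator {0..1} r *\<^sub>R (K r)\<^sup>2 + (K 1)\<^sup>2 * indicator {0..T} r)"
    proof (rule AE_I2)
      fix r :: real
      consider "\<not> (0 < r \<and> r \<le> T)" | "0 < r" "r \<le> T" "r \<le> 1" | "1 < r" "r \<le> T" by linarith
      then show "norm (if 0 < r \<and> r \<le> T then (K r)\<^sup>2 else 0)
        \<le> norm (indicator {0..1} r *\<^sub>R (K r)\<^sup>2 + (K 1)\<^sup>2 * indicator {0..T} r)"
      proof cases
        case 3
        then have "(K r)\<^sup>2 \<le> (K 1)\<^sup>2" using antimono[of 1 r] nonneg[of r] by (intro power_mono) auto
        then show ?thesis using 3 by (simp add: indicator_def)
      qed (auto simp: indicator_def)
    qed
  qed
qed

text \<open>The reflection \<open>s \<mapsto> T - s\<close> turns integrals against profiles into integrals near \<open>0\<close>.\<close>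

lemma profile_square_integrable: "integrable lborel (\<lambda>s. (profile T s)\<^sup>2)"
  and profile_square_integral: "(\<integral>s. (profile T s)\<^sup>2 \<partial>lborel) = (LBINT r:{0..T}. (K r)\<^sup>2)"
proof -
  have eq: "(profile T (T + -1 * r))\<^sup>2 = (if 0 < r \<and> r \<le> T then (K r)\<^sup>2 else 0)" for r
    by (simp add: profile_def)
  have "integrable lborel (\<lambda>r. (profile T (T + -1 * r))\<^sup>2)"
    unfolding eq by (rule integrable_square_on)
  then show "integrable lborel (\<lambda>s. (profile T s)\<^sup>2)"
    using lborel_integrable_real_affine_iff[of "-1" "\<lambda>s. (profile T s)\<^sup>2" T] by simp
  have "(\<integral>s. (profile T s)\<^sup>2 \<partial>lborel) = (\<integral>r. (if 0 < r \<and> r \<le> T then (K r)\<^sup>2 else 0) \<partial>lborel)"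
    using lborel_integral_real_affine[of "-1" "\<lambda>s. (profile T s)\<^sup>2" T] unfolding eq by simp
  also have "\<dots> = (\<integral>r. indicator {0..T} r *\<^sub>R (K r)\<^sup>2 \<partial>lborel)"
    by (rule lborel_integral_cong_except_point[of 0]) (auto simp: indicator_def)
  finally show "(\<integral>s. (profile T s)\<^sup>2 \<partial>lborel) = (LBINT r:{0..T}. (K r)\<^sup>2)"
    by (simp add: set_lebesgue_integral_def)
qed

lemma profile_integrable: "integrable lborel (profile T)"
proof (rule Bochner_Integration.integrable_bound)
  show "integrable lborel (\<lambda>s. (profile T s)\<^sup>2 + indicator {0..T} s)"
    using profile_square_integrable integrable_indicator_Icc by (intro Bochner_Integration.integrable_add) auto
  show "AE s in lborel. norm (profile T s) \<le> norm ((profile T s)\<^sup>2 + indicator {0..T} s)"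
  proof (rule AE_I2)
    fix s
    have "\<bar>profile T s\<bar> \<le> (profile T s)\<^sup>2 + 1"
      using zero_le_power2[of "\<bar>profile T s\<bar> - 1"] by (simp add: power2_diff)
    then show "norm (profile T s) \<le> norm ((profile T s)\<^sup>2 + indicator {0..T} s)"
      by (auto simp: profile_def indicator_def)
  qed
qed simp

text \<open>
  The Cauchy-Schwarz inequality for the profile and the indicator of \<open>[0, T]\<close>.
\<close>

lemma profile_integral_le:
  assumes "0 \<le> T"
  shows "(\<integral>s. profile T s \<partial>lborel) \<le> sqrt (T * (\<integral>s. (profile T s)\<^sup>2 \<partial>lborel))"
proof -
  define I where "I = (\<integral>s. profile T s \<partial>lborel)"
  define J where "J = (\<integral>s. (profile T s)\<^sup>2 \<partial>lborel)"
  have "I\<^sup>2 \<le> T * J"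
  proof (cases "T = 0")
    case True
    then have "profile T = (\<lambda>_. 0)" by (auto simp: profile_def)
    then show ?thesis by (simp add: I_def True)
  next
    case False
    then have T: "0 < T" using assms by simp
    \<comment> \<open>The mean of the profile, for which the square integral of the difference is smallest.\<close>
    define c where "c = I / T"
    have "0 \<le> (\<integral>s. (profile T s - c * indicator {0..T} s)\<^sup>2 \<partial>lborel)"
      by (rule integral_nonneg_AE) simp
    also have "(\<lambda>s. (profile T s - c * indicator {0..T} s)\<^sup>2) =
        (\<lambda>s. (profile T s)\<^sup>2 - 2 * c * profile T s + c\<^sup>2 * indicator {0..T} s)"
      by (auto simp: profile_def indicator_def power2_eq_square algebra_simps)
    also have "(\<integral>s. (profile T s)\<^sup>2 - 2 * c * profile T s + c\<^sup>2 * indicator {0..T} s \<partial>lborel) =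
        J - 2 * c * I + c\<^sup>2 * T"
      using profile_square_integrable profile_integrable assms
      by (simp add: I_def J_def)
    finally have "0 \<le> J - 2 * c * I + c\<^sup>2 * T" .
    then have "0 \<le> J - I\<^sup>2 / T" using T by (simp add: c_def power2_eq_square)
    then show ?thesis using T by (simp add: field_simps)
  qed
  moreover have "0 \<le> I" unfolding I_def by (rule integral_nonneg_AE) (simp add: profile_nonneg)
  ultimately show ?thesis unfolding I_def[symmetric] J_def[symmetric] by (simp add: real_le_rsqrt)
qed

lemma drift_bound:
  assumes T: "0 \<le> T" and c: "\<And>s. 0 \<le> s \<Longrightarrow> s \<le> T \<Longrightarrow> \<bar>f s\<bar> \<le> c"
  shows "\<bar>LBINT s:{0..T}. K (T - s) * f s\<bar> \<le> c * sqrt (T * (\<integral>s. (profile T s)\<^sup>2 \<partial>lborel))"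
proof -
  have c0: "0 \<le> c" using c[of 0] T by simp
  have "(LBINT s:{0..T}. K (T - s) * f s) = (\<integral>s. profile T s * f s \<partial>lborel)"
    unfolding set_lebesgue_integral_def
    by (rule lborel_integral_cong_except_point[of T]) (auto simp: indicator_def profile_def)
  also have "\<bar>\<dots>\<bar> \<le> (\<integral>s. c * profile T s \<partial>lborel)"
  proof (cases "integrable lborel (\<lambda>s. profile T s * f s)")
    case True
    have "\<bar>\<integral>s. profile T s * f s \<partial>lborel\<bar> \<le> (\<integral>s. \<bar>profile T s * f s\<bar> \<partial>lborel)"
      by (rule integral_abs_bound)
    also have "\<dots> \<le> (\<integral>s. c * profile T s \<partial>lborel)"
    proof (rule integral_mono)
      show "\<bar>profile T s * f s\<bar> \<le> c * profile T s" for s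
        using c[of s] mult_left_mono[of "\<bar>f s\<bar>" c "profile T s"] profile_nonneg[of T s]
        by (cases "0 \<le> s \<and> s \<le> T") (auto simp: abs_mult mult.commute profile_def)
    qed (use True profile_integrable in auto)
    finally show ?thesis .
  next
    case False
    then show ?thesis
      using c0 by (auto simp: not_integrable_integral_eq intro!: mult_nonneg_nonneg integral_nonneg_AE profile_nonneg)
  qed
  also have "\<dots> \<le> c * sqrt (T * (\<integral>s. (profile T s)\<^sup>2 \<partial>lborel))"
    using profile_integral_le[OF T] c0 by (simp add: mult_left_mono)
  finally show ?thesis .
qed

lemma step_outside:
  assumes "0 \<le> T" "s \<le> 0 \<or> T < s"
  shows "step T m s = 0"
  unfolding step_def
proof (rule sum.neutral, rule ballI)
  fix i assume i: "i \<in> {..<m}"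
  have "real (Suc i) * T / real m \<le> T"
  proof -
    have "real (Suc i) * T \<le> real m * T" using i assms(1) by (intro mult_right_mono) auto
    then show ?thesis using i by (simp add: divide_le_eq mult.commute)
  qed
  moreover have "0 \<le> real i * T / real m" using assms(1) by simp
  ultimately show "K (T - real i * T / real m) * indicator {real i * T / real m<..real (Suc i) * T / real m} s = 0"
    using assms(2) by (auto simp: indicator_def)
qed

lemma step_inside:
  assumes T: "0 < s" "s < T" and m: "0 < m"
  shows "\<exists>i<m. real i * T / real m < s \<and> s \<le> real (Suc i) * T / real m \<and>
    step T m s = K (T - real i * T / real m)"
proof -
  define x where "x = s * real m / T"
  have x: "0 < x" "x < real m" using T m by (auto simp: x_def divide_less_eq)
  \<comment> \<open>The cells are open on the left, so \<open>s\<close> lies in the one whose right end is at \<open>\<lceil>x\<rceil>\<close>.\<close>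
  define i where "i = nat \<lceil>x\<rceil> - 1"
  have i: "real i < x" "x \<le> real (Suc i)"
    using x unfolding i_def by linarith+
  then have im: "i < m" using x by simp
  have conv: "real l * T / real m < s \<longleftrightarrow> real l < x" "s \<le> real l * T / real m \<longleftrightarrow> x \<le> real l" for l
    using T m by (auto simp: x_def field_simps)
  have "step T m s = (\<Sum>l<m. if l = i then K (T - real i * T / real m) else 0)"
    unfolding step_def
  proof (rule sum.cong[OF refl])
    fix l assume "l \<in> {..<m}"
    have "real l < x \<and> x \<le> real (Suc l) \<longleftrightarrow> l = i"
      using i by (auto simp del: of_nat_Suc)
    then show "K (T - real l * T / real m) * indicator {real l * T / real m<..real (Suc l) * T / real m} s =
        (if l = i then K (T - real i * T / real m) else 0)"
      using conv[of l] conv[of "Suc l"] by (auto simp: indicator_def simp del: of_nat_Suc)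
  qed
  then have "step T m s = K (T - real i * T / real m)" using im by simp
  then show ?thesis using im i conv[of i] conv[of "Suc i"] by blast
qed

lemma step_le_profile:
  assumes "0 < s" "s < T" "0 < m"
  shows "0 \<le> step T m s" "step T m s \<le> profile T s"
proof -
  obtain i where i: "real i * T / real m < s" "step T m s = K (T - real i * T / real m)"
    using step_inside[OF assms] by blast
  then show "0 \<le> step T m s" using nonneg[of "T - real i * T / real m"] assms by simp
  show "step T m s \<le> profile T s"
    using i antimono[of "T - s" "T - real i * T / real m"] assms by (simp add: profile_def)
qed

lemma step_tendsto_profile:
  assumes "0 < s" "s < T"
  shows "(\<lambda>m. step T (Suc m) s) \<longlonglongrightarrow> profile T s"
proof -
  have "\<exists>i. real i * T / real (Suc m) < s \<and> s \<le> real (Suc i) * T / real (Suc m) \<and>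
      step T (Suc m) s = K (T - real i * T / real (Suc m))" for m
    using step_inside[OF assms, of "Suc m"] by blast
  then obtain i where i: "\<And>m. real (i m) * T / real (Suc m) < s"
      "\<And>m. s \<le> real (Suc (i m)) * T / real (Suc m)"
      "\<And>m. step T (Suc m) s = K (T - real (i m) * T / real (Suc m))"
    by metis
  have "(\<lambda>m. real (i m) * T / real (Suc m)) \<longlonglongrightarrow> s"
  proof (rule tendsto_sandwich)
    show "(\<lambda>m. s - T * (1 / real (Suc m))) \<longlonglongrightarrow> s"
      using tendsto_diff[OF tendsto_const tendsto_mult[OF tendsto_const LIMSEQ_Suc[OF lim_1_over_n]], of s T] by simp
    show "\<forall>\<^sub>F m in sequentially. s - T * (1 / real (Suc m)) \<le> real (i m) * T / real (Suc m)"
    proof (intro always_eventually allI)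
      fix m
      have "real (Suc (i m)) * T / real (Suc m) = real (i m) * T / real (Suc m) + T * (1 / real (Suc m))"
        by (simp only: of_nat_Suc[of "i m"] distrib_right add_divide_distrib) simp
      then show "s - T * (1 / real (Suc m)) \<le> real (i m) * T / real (Suc m)"
        using i(2)[of m] by linarith
    qed
    show "\<forall>\<^sub>F m in sequentially. real (i m) * T / real (Suc m) \<le> s"
      using i(1) by (intro always_eventually allI) (auto intro: less_imp_le)
  qed simp
  then have "(\<lambda>m. T - real (i m) * T / real (Suc m)) \<longlonglongrightarrow> T - s"
    by (intro tendsto_intros)
  then have "(\<lambda>m. K (T - real (i m) * T / real (Suc m))) \<longlonglongrightarrow> K (T - s)"
    using cont[of "T - s"] assms by (intro isCont_tendsto_compose[of "T - s" K]) auto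
  then show ?thesis using assms by (simp add: i(3) profile_def)
qed

lemma step_square_integrable: "integrable lborel (\<lambda>s. (profile T s - step T m s)\<^sup>2)" if "0 \<le> T"
proof (cases "m = 0 \<or> T = 0")
  case True
  then have "step T m = (\<lambda>_. 0)" by (auto simp: step_def)
  then show ?thesis using profile_square_integrable by simp
next
  case False
  then have T: "0 < T" and m: "0 < m" using that by auto
  show ?thesis
  proof (rule Bochner_Integration.integrable_bound[OF profile_square_integrable[of T]])
    show "AE s in lborel. norm ((profile T s - step T m s)\<^sup>2) \<le> norm ((profile T s)\<^sup>2)"
      using AE_lborel_neq[of 0] AE_lborel_neq[of T]
    proof eventually_elim
      case (elim s)
      show ?case
      proof (cases "0 < s \<and> s < T")
        case True
        then have "0 \<le> profile T s - step T m s \<and> profile T s - step T m s \<le> profile T s"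
          using step_le_profile[of s T m] m by auto
        then show ?thesis by (auto intro!: power_mono)
      next
        case False
        then show ?thesis using elim T step_outside[of T s m] by (auto simp: profile_def)
      qed
    qed
  qed simp
qed

lemma step_approximates_profile:
  assumes T: "0 \<le> T" and e: "0 < e"
  shows "\<exists>m>0. (\<integral>s. (profile T s - step T m s)\<^sup>2 \<partial>lborel) < e"
proof (cases "T = 0")
  case True
  then have "profile T = (\<lambda>_. 0)" "step T 1 = (\<lambda>_. 0)" by (auto simp: profile_def step_def)
  then show ?thesis using e by (intro exI[of _ 1]) simp
next
  case False
  then have T: "0 < T" using T by simp
  have "(\<lambda>m. \<integral>s. (profile T s - step T (Suc m) s)\<^sup>2 \<partial>lborel) \<longlonglongrightarrow> (\<integral>s. 0 \<partial>(lborel :: real measure))"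
  proof (rule integral_dominated_convergence[where w="\<lambda>s. (profile T s)\<^sup>2"])
    show "AE s in lborel. (\<lambda>m. (profile T s - step T (Suc m) s)\<^sup>2) \<longlonglongrightarrow> 0"
      using AE_lborel_neq[of 0] AE_lborel_neq[of T]
    proof eventually_elim
      case (elim s)
      show ?case
      proof (cases "0 < s \<and> s < T")
        case True
        then have "(\<lambda>m. (profile T s - step T (Suc m) s)\<^sup>2) \<longlonglongrightarrow> (profile T s - profile T s)\<^sup>2"
          by (intro tendsto_intros step_tendsto_profile) auto
        then show ?thesis by simp
      next
        case False
        then show ?thesis using elim T step_outside[of T s] by (auto simp: profile_def)
      qed
    qed
    show "AE s in lborel. norm ((profile T s - step T (Suc m) s)\<^sup>2) \<le> (profile T s)\<^sup>2" for m
      using AE_lborel_neq[of 0] AE_lborel_neq[of T]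
    proof eventually_elim
      case (elim s)
      show ?case
      proof (cases "0 < s \<and> s < T")
        case True
        then have "0 \<le> profile T s - step T (Suc m) s \<and> profile T s - step T (Suc m) s \<le> profile T s"
          using step_le_profile[of s T "Suc m"] by auto
        then show ?thesis by (auto intro!: power_mono)
      next
        case False
        then show ?thesis using elim T step_outside[of T s "Suc m"] by (auto simp: profile_def)
      qed
    qed
  qed (use profile_square_integrable in auto)
  then have "(\<lambda>m. \<integral>s. (profile T s - step T (Suc m) s)\<^sup>2 \<partial>lborel) \<longlonglongrightarrow> 0" by simp
  then have "\<forall>\<^sub>F m in sequentially. (\<integral>s. (profile T s - step T (Suc m) s)\<^sup>2 \<partial>lborel) < e"
    by (rule order_tendstoD(2)) (rule e)
  then obtain m where "(\<integral>s. (profile T s - step T (Suc m) s)\<^sup>2 \<partial>lborel) < e"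
    by (auto dest: eventually_happens)
  then show ?thesis by blast
qed

end

lemma profile_product_integral:
  assumes K: "monotone_kernel K" and L: "monotone_kernel L" and T: "0 \<le> S" "S \<le> T"
  shows "(\<integral>s. monotone_kernel.profile L T s * monotone_kernel.profile K S s \<partial>lborel) =
    (LBINT r:{0..S}. L ((T - S) + r) * K r)"
proof -
  interpret K: monotone_kernel K by fact
  interpret L: monotone_kernel L by fact
  have "(\<integral>s. L.profile T s * K.profile S s \<partial>lborel) =
      (\<integral>r. L.profile T (S + -1 * r) * K.profile S (S + -1 * r) \<partial>lborel)"
    using lborel_integral_real_affine[of "-1" "\<lambda>s. L.profile T s * K.profile S s" S] by simp
  also have "\<dots> = (\<integral>r. indicator {0..S} r *\<^sub>R (L ((T - S) + r) * K r) \<partial>lborel)"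
    by (rule lborel_integral_cong_except_point[of 0])
       (use T in \<open>auto simp: indicator_def K.profile_def L.profile_def algebra_simps\<close>)
  finally show ?thesis by (simp add: set_lebesgue_integral_def)
qed


section \<open>Convergence in probability\<close>

definition null_in_prob :: "'a measure \<Rightarrow> (nat \<Rightarrow> 'a \<Rightarrow> real) \<Rightarrow> bool" where
  "null_in_prob M W \<longleftrightarrow> (\<forall>n. W n \<in> borel_measurable M) \<and>
     (\<forall>\<epsilon>>0. (\<lambda>n. measure M {\<omega>\<in>space M. \<epsilon> < \<bar>W n \<omega>\<bar>}) \<longlonglongrightarrow> 0)"

lemma null_in_prob_measurable: "null_in_prob M W \<Longrightarrow> W n \<in> borel_measurable M"
  and null_in_probD: "null_in_prob M W \<Longrightarrow> 0 < \<epsilon> \<Longrightarrow>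
    (\<lambda>n. measure M {\<omega>\<in>space M. \<epsilon> < \<bar>W n \<omega>\<bar>}) \<longlonglongrightarrow> 0"
  by (auto simp: null_in_prob_def)

context prob_space
begin

lemma prob_tendsto_0_if_eventually_not:
  assumes E: "\<And>n. E n \<in> events" and ev: "AE \<omega> in M. \<forall>\<^sub>F n in sequentially. \<omega> \<notin> E n"
  shows "(\<lambda>n. prob (E n)) \<longlonglongrightarrow> 0"
proof -
  have "(\<lambda>n. \<integral>\<omega>. indicat_real (E n) \<omega> \<partial>M) \<longlonglongrightarrow> (\<integral>\<omega>. 0 \<partial>M)"
  proof (rule integral_dominated_convergence[where w="\<lambda>_. 1"])
    show "AE \<omega> in M. (\<lambda>n. indicat_real (E n) \<omega>) \<longlonglongrightarrow> 0"
      using ev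
    proof eventually_elim
      case (elim \<omega>)
      then have "\<forall>\<^sub>F n in sequentially. indicat_real (E n) \<omega> = 0"
        by eventually_elim simp
      then show ?case by (rule tendsto_eventually)
    qed
  qed (use E in \<open>auto simp: indicator_def\<close>)
  then show ?thesis using E by simp
qed

lemma null_in_prob_AE:
  assumes [measurable]: "\<And>n. W n \<in> borel_measurable M" and lim: "AE \<omega> in M. (\<lambda>n. W n \<omega>) \<longlonglongrightarrow> 0"
  shows "null_in_prob M W"
  unfolding null_in_prob_def
proof (intro conjI allI impI)
  fix \<epsilon> :: real assume e: "0 < \<epsilon>"
  show "(\<lambda>n. prob {\<omega>\<in>space M. \<epsilon> < \<bar>W n \<omega>\<bar>}) \<longlonglongrightarrow> 0"
  proof (rule prob_tendsto_0_if_eventually_not)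
    show "AE \<omega> in M. \<forall>\<^sub>F n in sequentially. \<omega> \<notin> {\<omega>\<in>space M. \<epsilon> < \<bar>W n \<omega>\<bar>}"
      using lim
    proof eventually_elim
      case (elim \<omega>)
      from tendstoD[OF elim e] show ?case by eventually_elim (auto simp: dist_real_def)
    qed
  qed measurable
qed simp

lemma null_in_prob_add:
  assumes V: "null_in_prob M V" and W: "null_in_prob M W"
  shows "null_in_prob M (\<lambda>n \<omega>. V n \<omega> + W n \<omega>)"
proof -
  have [measurable]: "V n \<in> borel_measurable M" "W n \<in> borel_measurable M" for n
    using V W by (auto simp: null_in_prob_def)
  have "(\<lambda>n. prob {\<omega>\<in>space M. \<epsilon> < \<bar>V n \<omega> + W n \<omega>\<bar>}) \<longlonglongrightarrow> 0" if e: "0 < \<epsilon>" for \<epsilon>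
  proof (rule tendsto_sandwich[where f="\<lambda>_. 0"])
    show "(\<lambda>n. prob {\<omega>\<in>space M. \<epsilon> / 2 < \<bar>V n \<omega>\<bar>} + prob {\<omega>\<in>space M. \<epsilon> / 2 < \<bar>W n \<omega>\<bar>}) \<longlonglongrightarrow> 0"
      using tendsto_add[OF null_in_probD[OF V half_gt_zero[OF e]] null_in_probD[OF W half_gt_zero[OF e]]]
      by (simp only: add_0_right)
    show "\<forall>\<^sub>F n in sequentially. prob {\<omega>\<in>space M. \<epsilon> < \<bar>V n \<omega> + W n \<omega>\<bar>} \<le>
        prob {\<omega>\<in>space M. \<epsilon> / 2 < \<bar>V n \<omega>\<bar>} + prob {\<omega>\<in>space M. \<epsilon> / 2 < \<bar>W n \<omega>\<bar>}"
    proof (intro always_eventually allI)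
      fix n
      have "prob {\<omega>\<in>space M. \<epsilon> < \<bar>V n \<omega> + W n \<omega>\<bar>} \<le>
          prob ({\<omega>\<in>space M. \<epsilon> / 2 < \<bar>V n \<omega>\<bar>} \<union> {\<omega>\<in>space M. \<epsilon> / 2 < \<bar>W n \<omega>\<bar>})"
        by (rule finite_measure_mono) auto
      also have "\<dots> \<le> prob {\<omega>\<in>space M. \<epsilon> / 2 < \<bar>V n \<omega>\<bar>} + prob {\<omega>\<in>space M. \<epsilon> / 2 < \<bar>W n \<omega>\<bar>}"
        by (intro measure_Un_le) measurable
      finally show "prob {\<omega>\<in>space M. \<epsilon> < \<bar>V n \<omega> + W n \<omega>\<bar>} \<le>
        prob {\<omega>\<in>space M. \<epsilon> / 2 < \<bar>V n \<omega>\<bar>} + prob {\<omega>\<in>space M. \<epsilon> / 2 < \<bar>W n \<omega>\<bar>}" .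
    qed
  qed auto
  then show ?thesis by (simp add: null_in_prob_def)
qed

lemma null_in_prob_scale:
  assumes W: "null_in_prob M W"
  shows "null_in_prob M (\<lambda>n \<omega>. c * W n \<omega>)"
proof (cases "c = 0")
  case False
  have "(\<epsilon> < \<bar>c * W n \<omega>\<bar>) = (\<epsilon> / \<bar>c\<bar> < \<bar>W n \<omega>\<bar>)" for \<epsilon> n \<omega>
    using False by (simp add: abs_mult pos_divide_less_eq mult.commute)
  moreover have "(\<lambda>n. prob {\<omega>\<in>space M. \<epsilon> / \<bar>c\<bar> < \<bar>W n \<omega>\<bar>}) \<longlonglongrightarrow> 0" if "0 < \<epsilon>" for \<epsilon>
    using null_in_probD[OF W, of "\<epsilon> / \<bar>c\<bar>"] that False by simp
  ultimately show ?thesis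
    using null_in_prob_measurable[OF W] by (simp add: null_in_prob_def borel_measurable_times)
qed (simp add: null_in_prob_def)

lemma null_in_prob_sum:
  assumes "finite A" "\<And>i. i \<in> A \<Longrightarrow> null_in_prob M (W i)"
  shows "null_in_prob M (\<lambda>n \<omega>. \<Sum>i\<in>A. W i n \<omega>)"
  using assms
proof (induction A rule: finite_induct)
  case empty
  then show ?case by (simp add: null_in_prob_def)
next
  case (insert i A)
  then show ?case using null_in_prob_add[of "W i" "\<lambda>n \<omega>. \<Sum>i\<in>A. W i n \<omega>"] by simp
qed

lemma char_tendsto_perturbation:
  assumes [measurable]: "\<And>n. A n \<in> borel_measurable M" and W: "null_in_prob M W"
    and lim: "(\<lambda>n. expectation (\<lambda>\<omega>. iexp (A n \<omega>))) \<longlonglongrightarrow> l"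
  shows "(\<lambda>n. expectation (\<lambda>\<omega>. iexp (A n \<omega> + W n \<omega>))) \<longlonglongrightarrow> l"
proof -
  have [measurable]: "W n \<in> borel_measurable M" for n using W by (simp add: null_in_prob_def)
  have bound: "norm (expectation (\<lambda>\<omega>. iexp (A n \<omega> + W n \<omega>)) - expectation (\<lambda>\<omega>. iexp (A n \<omega>)))
      \<le> e + 2 * prob {\<omega>\<in>space M. e < \<bar>W n \<omega>\<bar>}" if e: "0 < e" for n e
  proof -
    let ?E = "{\<omega>\<in>space M. e < \<bar>W n \<omega>\<bar>}"
    have i: "integrable M (\<lambda>\<omega>. iexp (A n \<omega> + W n \<omega>))" "integrable M (\<lambda>\<omega>. iexp (A n \<omega>))"
      by (auto intro!: integrable_const_bound[where B=1])
    have iE: "integrable M (indicat_real ?E)"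
      by (rule integrable_const_bound[where B=1]) (auto simp: indicator_def)
    have "norm (expectation (\<lambda>\<omega>. iexp (A n \<omega> + W n \<omega>)) - expectation (\<lambda>\<omega>. iexp (A n \<omega>))) =
        norm (expectation (\<lambda>\<omega>. iexp (A n \<omega> + W n \<omega>) - iexp (A n \<omega>)))"
      using i by simp
    also have "\<dots> \<le> expectation (\<lambda>\<omega>. norm (iexp (A n \<omega> + W n \<omega>) - iexp (A n \<omega>)))"
      by (rule integral_norm_bound)
    also have "\<dots> \<le> expectation (\<lambda>\<omega>. e + 2 * indicat_real ?E \<omega>)"
    proof (rule integral_mono)
      fix \<omega> assume \<omega>: "\<omega> \<in> space M"
      have "iexp (A n \<omega> + W n \<omega>) - iexp (A n \<omega>) = iexp (A n \<omega>) * (iexp (W n \<omega>) - 1)"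
        by (simp add: exp_add distrib_left algebra_simps)
      then have "norm (iexp (A n \<omega> + W n \<omega>) - iexp (A n \<omega>)) = norm (iexp (W n \<omega>) - 1)"
        by (simp add: norm_mult)
      moreover have "norm (iexp (W n \<omega>) - 1) \<le> \<bar>W n \<omega>\<bar>"
        using iexp_approx1[of "W n \<omega>" 0] by simp
      moreover have "norm (iexp (W n \<omega>) - 1) \<le> 2"
        using norm_triangle_ineq4[of "iexp (W n \<omega>)" 1] by simp
      ultimately show "norm (iexp (A n \<omega> + W n \<omega>) - iexp (A n \<omega>)) \<le> e + 2 * indicat_real ?E \<omega>"
        using e \<omega> by (cases "e < \<bar>W n \<omega>\<bar>") auto
    qed (use i iE in auto)
    also have "\<dots> = e + 2 * prob ?E"
      using iE by (simp add: prob_space)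
    finally show ?thesis .
  qed
  have "(\<lambda>n. expectation (\<lambda>\<omega>. iexp (A n \<omega> + W n \<omega>)) - expectation (\<lambda>\<omega>. iexp (A n \<omega>))) \<longlonglongrightarrow> 0"
  proof (rule LIMSEQ_I)
    fix r :: real assume r: "0 < r"
    have "(\<lambda>n. prob {\<omega>\<in>space M. r / 2 < \<bar>W n \<omega>\<bar>}) \<longlonglongrightarrow> 0"
      by (rule null_in_probD[OF W half_gt_zero[OF r]])
    then have "\<forall>\<^sub>F n in sequentially. prob {\<omega>\<in>space M. r / 2 < \<bar>W n \<omega>\<bar>} < r / 4"
      by (rule order_tendstoD(2)) (use r in simp)
    then have "\<forall>\<^sub>F n in sequentially. norm (expectation (\<lambda>\<omega>. iexp (A n \<omega> + W n \<omega>)) - expectation (\<lambda>\<omega>. iexp (A n \<omega>)) - 0) < r"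
    proof eventually_elim
      case (elim n)
      have "norm (expectation (\<lambda>\<omega>. iexp (A n \<omega> + W n \<omega>)) - expectation (\<lambda>\<omega>. iexp (A n \<omega>)))
          \<le> r / 2 + 2 * prob {\<omega>\<in>space M. r / 2 < \<bar>W n \<omega>\<bar>}"
        by (rule bound) (use r in simp)
      then show ?case using elim by simp
    qed
    then show "\<exists>no. \<forall>n\<ge>no. norm (expectation (\<lambda>\<omega>. iexp (A n \<omega> + W n \<omega>)) - expectation (\<lambda>\<omega>. iexp (A n \<omega>)) - 0) < r"
      by (simp add: eventually_sequentially)
  qed
  from tendsto_add[OF this lim] show ?thesis by simp
qed

end


section \<open>Small-time behaviour of Volterra processes\<close>

text \<open>
  Limits of Gram matrices are stable under perturbations that tend to \<open>0\<close> in \<open>L\<^sup>2\<close>.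
\<close>

lemma quadratic_form_tendsto:
  fixes \<psi> \<phi> :: "'n::finite \<Rightarrow> nat \<Rightarrow> real \<Rightarrow> real"
  assumes [measurable]: "\<And>j n. \<psi> j n \<in> borel_measurable borel" "\<And>j n. \<phi> j n \<in> borel_measurable borel"
    and \<psi>2: "\<And>j n. integrable lborel (\<lambda>s. (\<psi> j n s)\<^sup>2)"
    and e2: "\<And>j n. integrable lborel (\<lambda>s. (\<psi> j n s - \<phi> j n s)\<^sup>2)"
    and small: "\<And>j n. 1 \<le> n \<Longrightarrow> (\<integral>s. (\<psi> j n s - \<phi> j n s)\<^sup>2 \<partial>lborel) \<le> 1 / (real n)\<^sup>2"
    and lim: "\<And>i j. (\<lambda>n. \<integral>s. \<psi> i n s * \<psi> j n s \<partial>lborel) \<longlonglongrightarrow> S i j"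
  shows "(\<lambda>n. \<integral>s. (\<Sum>j\<in>UNIV. u j * \<phi> j n s)\<^sup>2 \<partial>lborel) \<longlonglongrightarrow> (\<Sum>i\<in>UNIV. \<Sum>j\<in>UNIV. u i * u j * S i j)"
proof -
  define U where "U n s = (\<Sum>j\<in>UNIV. u j * \<psi> j n s)" for n s
  define E where "E n s = (\<Sum>j\<in>UNIV. u j * (\<psi> j n s - \<phi> j n s))" for n s
  have [measurable]: "U n \<in> borel_measurable borel" "E n \<in> borel_measurable borel" for n
    unfolding U_def E_def by measurable
  have prod: "integrable lborel (\<lambda>s. \<psi> i n s * \<psi> j n s)" for i j n
  proof (rule Bochner_Integration.integrable_bound)
    show "integrable lborel (\<lambda>s. (\<psi> i n s)\<^sup>2 + (\<psi> j n s)\<^sup>2)"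
      using \<psi>2 by (intro Bochner_Integration.integrable_add)
    show "AE s in lborel. norm (\<psi> i n s * \<psi> j n s) \<le> norm ((\<psi> i n s)\<^sup>2 + (\<psi> j n s)\<^sup>2)"
    proof (rule AE_I2)
      fix s
      have "2 * (\<bar>\<psi> i n s\<bar> * \<bar>\<psi> j n s\<bar>) \<le> (\<psi> i n s)\<^sup>2 + (\<psi> j n s)\<^sup>2"
        using zero_le_power2[of "\<bar>\<psi> i n s\<bar> - \<bar>\<psi> j n s\<bar>"] by (simp add: power2_diff)
      moreover have "0 \<le> \<bar>\<psi> i n s\<bar> * \<bar>\<psi> j n s\<bar>" by simp
      ultimately show "norm (\<psi> i n s * \<psi> j n s) \<le> norm ((\<psi> i n s)\<^sup>2 + (\<psi> j n s)\<^sup>2)"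
        unfolding real_norm_def abs_mult by linarith
    qed
  qed simp
  have U2: "(U n s)\<^sup>2 = (\<Sum>i\<in>UNIV. \<Sum>j\<in>UNIV. u i * u j * (\<psi> i n s * \<psi> j n s))" for n s
    unfolding U_def power2_eq_square sum_product by (simp add: mult.assoc mult.left_commute)
  have iU: "integrable lborel (\<lambda>s. (U n s)\<^sup>2)" for n
    unfolding U2 using prod by (intro Bochner_Integration.integrable_sum integrable_mult_right)
  have "(\<integral>s. (U n s)\<^sup>2 \<partial>lborel) = (\<Sum>i\<in>UNIV. \<Sum>j\<in>UNIV. u i * u j * (\<integral>s. \<psi> i n s * \<psi> j n s \<partial>lborel))" for n
    unfolding U2 using prod by (simp add: Bochner_Integration.integral_sum Bochner_Integration.integrable_sum)
  then have limU: "(\<lambda>n. \<integral>s. (U n s)\<^sup>2 \<partial>lborel) \<longlonglongrightarrow> (\<Sum>i\<in>UNIV. \<Sum>j\<in>UNIV. u i * u j * S i j)"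
    using lim by (simp add: tendsto_sum tendsto_mult_left)
  \<comment> \<open>The Cauchy-Schwarz inequality for the sum over the index type yields the factor \<open>CARD('n)\<close>.\<close>
  define c where "c = real (CARD('n)) * (\<Sum>j\<in>UNIV. (u j)\<^sup>2)"
  let ?e = "\<lambda>n s. real (CARD('n)) * (\<Sum>j\<in>UNIV. (u j)\<^sup>2 * (\<psi> j n s - \<phi> j n s)\<^sup>2)"
  have E_le: "(E n s)\<^sup>2 \<le> ?e n s" for n s
    using sum_squared_le_sum_of_squares[of "\<lambda>j. u j * (\<psi> j n s - \<phi> j n s)" UNIV]
    by (simp add: E_def power_mult_distrib mult.commute)
  have ie: "integrable lborel (?e n)" for n
    using e2 by (intro integrable_mult_right Bochner_Integration.integrable_sum)
  have iE: "integrable lborel (\<lambda>s. (E n s)\<^sup>2)" for n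
    using E_le by (intro Bochner_Integration.integrable_bound[OF ie[of n]]) (auto intro!: AE_I2 intro: order_trans[OF _ abs_ge_self])
  have E_small: "(\<integral>s. (E n s)\<^sup>2 \<partial>lborel) \<le> c / (real n)\<^sup>2" if n: "1 \<le> n" for n
  proof -
    have "(\<integral>s. (E n s)\<^sup>2 \<partial>lborel) \<le> (\<integral>s. ?e n s \<partial>lborel)"
      by (rule integral_mono[OF iE ie E_le])
    also have "\<dots> = real (CARD('n)) * (\<Sum>j\<in>UNIV. (u j)\<^sup>2 * (\<integral>s. (\<psi> j n s - \<phi> j n s)\<^sup>2 \<partial>lborel))"
      using e2 by (simp add: Bochner_Integration.integral_sum)
    also have "\<dots> \<le> real (CARD('n)) * (\<Sum>j\<in>UNIV. (u j)\<^sup>2 * (1 / (real n)\<^sup>2))"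
      using small[OF n] by (intro mult_left_mono sum_mono) auto
    also have "\<dots> = c / (real n)\<^sup>2" by (simp add: c_def sum_distrib_right[symmetric] sum_divide_distrib[symmetric])
    finally show ?thesis .
  qed
  let ?I = "\<lambda>n. \<integral>s. (U n s)\<^sup>2 \<partial>lborel"
  have phi: "(\<Sum>j\<in>UNIV. u j * \<phi> j n s) = U n s - E n s" for n s
    by (simp add: U_def E_def sum_subtractf[symmetric] algebra_simps)
  \<comment> \<open>Young's inequality with weight \<open>n\<close> absorbs the cross term, as the error is of order \<open>n\<^sup>-\<^sup>2\<close>.\<close>
  have young: "2 * \<bar>x * y\<bar> \<le> x\<^sup>2 / real n + real n * y\<^sup>2" if "1 \<le> n" for x y :: real and n
  proof -
    have "0 \<le> (\<bar>x\<bar> - real n * \<bar>y\<bar>)\<^sup>2 / real n" by simp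
    also have "\<dots> = x\<^sup>2 / real n + real n * y\<^sup>2 - 2 * \<bar>x * y\<bar>"
      using that by (simp add: power2_diff power_mult_distrib abs_mult field_simps power2_eq_square)
    finally show ?thesis by simp
  qed
  have iUE: "integrable lborel (\<lambda>s. (U n s - E n s)\<^sup>2)" for n
  proof (rule Bochner_Integration.integrable_bound)
    show "integrable lborel (\<lambda>s. 2 * (U n s)\<^sup>2 + 2 * (E n s)\<^sup>2)"
      using iU iE by (intro Bochner_Integration.integrable_add integrable_mult_right)
    show "AE s in lborel. norm ((U n s - E n s)\<^sup>2) \<le> norm (2 * (U n s)\<^sup>2 + 2 * (E n s)\<^sup>2)"
    proof (rule AE_I2)
      fix s
      show "norm ((U n s - E n s)\<^sup>2) \<le> norm (2 * (U n s)\<^sup>2 + 2 * (E n s)\<^sup>2)"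
        using zero_le_power2[of "U n s + E n s"] unfolding real_norm_def abs_power2
        by (simp add: power2_sum power2_diff)
    qed
  qed simp
  have upper: "(\<integral>s. (U n s - E n s)\<^sup>2 \<partial>lborel) \<le> ?I n + ?I n / real n + (real n + 1) * (c / (real n)\<^sup>2)"
    and lower: "?I n - ?I n / real n - real n * (c / (real n)\<^sup>2) \<le> (\<integral>s. (U n s - E n s)\<^sup>2 \<partial>lborel)"
    if n: "1 \<le> n" for n
  proof -
    have "(\<integral>s. (U n s - E n s)\<^sup>2 \<partial>lborel) \<le>
        (\<integral>s. (U n s)\<^sup>2 + (1 / real n) * (U n s)\<^sup>2 + (real n + 1) * (E n s)\<^sup>2 \<partial>lborel)"
    proof (rule integral_mono[OF iUE])
      show "integrable lborel (\<lambda>s. (U n s)\<^sup>2 + (1 / real n) * (U n s)\<^sup>2 + (real n + 1) * (E n s)\<^sup>2)"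
        using iU iE by (intro Bochner_Integration.integrable_add integrable_mult_right)
      show "(U n s - E n s)\<^sup>2 \<le> (U n s)\<^sup>2 + (1 / real n) * (U n s)\<^sup>2 + (real n + 1) * (E n s)\<^sup>2" for s
        using young[OF n, of "U n s" "E n s"] abs_ge_minus_self[of "U n s * E n s"]
        unfolding power2_diff by (simp add: algebra_simps)
    qed
    also have "\<dots> = ?I n + ?I n / real n + (real n + 1) * (\<integral>s. (E n s)\<^sup>2 \<partial>lborel)"
      using iU iE by simp
    also have "\<dots> \<le> ?I n + ?I n / real n + (real n + 1) * (c / (real n)\<^sup>2)"
      using E_small[OF n] by (intro add_left_mono mult_left_mono) auto
    finally show "(\<integral>s. (U n s - E n s)\<^sup>2 \<partial>lborel) \<le> ?I n + ?I n / real n + (real n + 1) * (c / (real n)\<^sup>2)" .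
    have "?I n - ?I n / real n - real n * (c / (real n)\<^sup>2) \<le>
        ?I n - ?I n / real n - real n * (\<integral>s. (E n s)\<^sup>2 \<partial>lborel)"
      using E_small[OF n] by (intro diff_left_mono mult_left_mono) auto
    also have "\<dots> = (\<integral>s. (U n s)\<^sup>2 - (1 / real n) * (U n s)\<^sup>2 - real n * (E n s)\<^sup>2 \<partial>lborel)"
      using iU iE by simp
    also have "\<dots> \<le> (\<integral>s. (U n s - E n s)\<^sup>2 \<partial>lborel)"
    proof (rule integral_mono[OF _ iUE])
      show "integrable lborel (\<lambda>s. (U n s)\<^sup>2 - (1 / real n) * (U n s)\<^sup>2 - real n * (E n s)\<^sup>2)"
        using iU iE by (intro Bochner_Integration.integrable_diff integrable_mult_right)
      show "(U n s)\<^sup>2 - (1 / real n) * (U n s)\<^sup>2 - real n * (E n s)\<^sup>2 \<le> (U n s - E n s)\<^sup>2" for s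
        using young[OF n, of "U n s" "E n s"] abs_ge_self[of "U n s * E n s"] zero_le_power2[of "E n s"]
        unfolding power2_diff mult.assoc times_divide_eq_left mult_1 by linarith
    qed
    finally show "?I n - ?I n / real n - real n * (c / (real n)\<^sup>2) \<le> (\<integral>s. (U n s - E n s)\<^sup>2 \<partial>lborel)" .
  qed
  let ?S = "\<Sum>i\<in>UNIV. \<Sum>j\<in>UNIV. u i * u j * S i j"
  have Ir: "(\<lambda>n. ?I n / real n) \<longlonglongrightarrow> 0"
    using tendsto_mult[OF limU lim_1_over_n] by simp
  have c1: "(\<lambda>n. (real n + 1) * (c / (real n)\<^sup>2)) \<longlonglongrightarrow> 0" and c2: "(\<lambda>n. real n * (c / (real n)\<^sup>2)) \<longlonglongrightarrow> 0"
    by real_asymp+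
  have ev: "\<forall>\<^sub>F n in sequentially. 1 \<le> n" by (rule eventually_ge_at_top)
  show ?thesis
    unfolding phi
  proof (rule tendsto_sandwich)
    show "\<forall>\<^sub>F n in sequentially. ?I n - ?I n / real n - real n * (c / (real n)\<^sup>2) \<le> (\<integral>s. (U n s - E n s)\<^sup>2 \<partial>lborel)"
      using ev by eventually_elim (rule lower)
    show "\<forall>\<^sub>F n in sequentially. (\<integral>s. (U n s - E n s)\<^sup>2 \<partial>lborel) \<le> ?I n + ?I n / real n + (real n + 1) * (c / (real n)\<^sup>2)"
      using ev by eventually_elim (rule upper)
    show "(\<lambda>n. ?I n - ?I n / real n - real n * (c / (real n)\<^sup>2)) \<longlonglongrightarrow> ?S"
      using tendsto_diff[OF tendsto_diff[OF limU Ir] c2] by simp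
    show "(\<lambda>n. ?I n + ?I n / real n + (real n + 1) * (c / (real n)\<^sup>2)) \<longlonglongrightarrow> ?S"
      using tendsto_add[OF tendsto_add[OF limU Ir] c1] by simp
  qed
qed

context brownian
begin

text \<open>
  The Wiener integral of the step approximation to \<open>s \<mapsto> K (T - s)\<close>.
\<close>

definition wiener_step :: "(real \<Rightarrow> real) \<Rightarrow> real \<Rightarrow> nat \<Rightarrow> 'a \<Rightarrow> real" where
  "wiener_step K T m \<omega> = (\<Sum>i<m. K (T - real i * T / real m) *
     (B (real (Suc i) * T / real m) \<omega> - B (real i * T / real m) \<omega>))"

lemma wiener_step_measurable: "0 \<le> T \<Longrightarrow> wiener_step K T m \<in> borel_measurable M"
  unfolding wiener_step_def
  by (intro borel_measurable_sum borel_measurable_times borel_measurable_diff B_measurable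
      borel_measurable_const) auto

text \<open>
  As \<open>X\<close> is continuous at \<open>0\<close>, on \<open>[0, T n]\<close> the coefficient \<open>\<sigma> (X s)\<close> is uniformly close to
  \<open>\<sigma> x0\<close> for large \<open>n\<close>. Replacing it costs a square error that is small compared with the square
  integral of the kernel, which the weight \<open>w n\<close> normalises to a bounded quantity.
\<close>

lemma stochastic_term_localises:
  assumes K: "monotone_kernel K" and \<sigma>: "continuous_on UNIV \<sigma>"
    and X: "continuous_paths M X" and X0: "AE \<omega> in M. X 0 \<omega> = x0"
    and T: "\<And>n. 0 \<le> T n" "T \<longlonglongrightarrow> 0" and w: "\<And>n. 1 \<le> n \<Longrightarrow> 0 < w n"
    and D: "(\<lambda>n. w n * (\<integral>s. (monotone_kernel.profile K (T n) s)\<^sup>2 \<partial>lborel)) \<longlonglongrightarrow> D"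
    and m: "\<And>n. 1 \<le> n \<Longrightarrow> 0 < m n"
    and err: "\<And>n. 1 \<le> n \<Longrightarrow>
      (\<integral>s. (monotone_kernel.profile K (T n) s - monotone_kernel.step K (T n) (m n) s)\<^sup>2 \<partial>lborel)
        \<le> 1 / (w n * (real n)\<^sup>2)"
    and I: "\<And>n. has_ito_integral M F B (T n) (\<lambda>s \<omega>. K (T n - s) * \<sigma> (X s \<omega>)) (I n)"
  shows "null_in_prob M (\<lambda>n \<omega>. sqrt (w n) * (I n \<omega> - \<sigma> x0 * wiener_step K (T n) (m n) \<omega>))"
proof -
  interpret K: monotone_kernel K by fact
  define W where "W n \<omega> = sqrt (w n) * (I n \<omega> - \<sigma> x0 * wiener_step K (T n) (m n) \<omega>)" for n \<omega>
  define Q where "Q n \<omega> = (\<integral>\<^sup>+s\<in>{0..T n}. ennreal ((K (T n - s) * \<sigma> (X s \<omega>) - \<sigma> x0 * K.step (T n) (m n) s)\<^sup>2) \<partial>lborel)"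
    for n \<omega>
  have [measurable]: "I n \<in> borel_measurable M" for n using I by (simp add: has_ito_integral_def)
  note wiener_step_measurable[OF T(1), measurable]
  have W_meas [measurable]: "W n \<in> borel_measurable M" for n unfolding W_def by measurable
  have Q_meas [measurable]: "Q n \<in> borel_measurable M" for n
    unfolding Q_def using I T(1) by (intro integrand_error_measurable) (auto simp: has_ito_integral_def)
  let ?J = "\<lambda>n. \<integral>s. (K.profile (T n) s)\<^sup>2 \<partial>lborel"
  let ?E = "\<lambda>n. \<integral>s. (K.profile (T n) s - K.step (T n) (m n) s)\<^sup>2 \<partial>lborel"
  have bound: "prob {\<omega>\<in>space M. e < \<bar>W n \<omega>\<bar>} \<le> 16 * \<eta> / e\<^sup>2 + prob {\<omega>\<in>space M. ennreal (\<eta> / w n) < Q n \<omega>}"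
    if n: "1 \<le> n" and e: "0 < e" and \<eta>: "0 < \<eta>" for n e \<eta>
  proof -
    \<comment> \<open>The thresholds before multiplication by \<open>sqrt (w n)\<close>.\<close>
    let ?\<epsilon> = "e / (2 * sqrt (w n))"
    have l: "0 < w n" by (rule w[OF n])
    have G: "\<sigma> x0 * wiener_step K (T n) (m n) \<omega> =
        (\<Sum>i<m n. (\<sigma> x0 * K (T n - real i * T n / real (m n))) *
          (B (real (Suc i) * T n / real (m n)) \<omega> - B (real i * T n / real (m n)) \<omega>))" for \<omega>
      by (simp only: wiener_step_def sum_distrib_left mult.assoc)
    have \<phi>: "\<sigma> x0 * K.step (T n) (m n) s =
        (\<Sum>i<m n. (\<sigma> x0 * K (T n - real i * T n / real (m n))) *
          indicator {real i * T n / real (m n)<..real (Suc i) * T n / real (m n)} s)" for s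
      by (simp only: K.step_def sum_distrib_left mult.assoc)
    have "prob {\<omega>\<in>space M. 2 * ?\<epsilon> < \<bar>I n \<omega> - \<sigma> x0 * wiener_step K (T n) (m n) \<omega>\<bar>} \<le>
        4 * (\<eta> / w n) / ?\<epsilon>\<^sup>2 + prob {\<omega>\<in>space M. ennreal (\<eta> / w n) < Q n \<omega>}"
      unfolding Q_def G \<phi>
    proof (rule ito_integral_error[OF I T(1) finite_lessThan])
      fix i assume "i \<in> {..<m n}"
      then have i: "Suc i \<le> m n" "0 < real (m n)" by auto
      have "real (Suc i) * T n \<le> real (m n) * T n"
        using i T(1)[of n] by (intro mult_right_mono) auto
      then have "real (Suc i) * T n / real (m n) \<le> T n"
        using i by (simp add: divide_le_eq mult.commute)
      moreover have "real i * T n / real (m n) \<le> real (Suc i) * T n / real (m n)"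
        using T(1)[of n] by (intro divide_right_mono mult_right_mono) auto
      moreover have "0 \<le> real i * T n / real (m n)" using T(1)[of n] by simp
      ultimately show "0 \<le> real i * T n / real (m n) \<and>
          real i * T n / real (m n) \<le> real (Suc i) * T n / real (m n) \<and>
          real (Suc i) * T n / real (m n) \<le> T n" by blast
    qed (use e l \<eta> in auto)
    moreover have "2 * ?\<epsilon> < \<bar>x\<bar> \<longleftrightarrow> e < \<bar>sqrt (w n) * x\<bar>" for x
      using l by (simp add: abs_mult field_simps)
    moreover have "4 * (\<eta> / w n) / ?\<epsilon>\<^sup>2 = 16 * \<eta> / e\<^sup>2"
      using l e by (simp add: power_divide power_mult_distrib field_simps)
    ultimately show ?thesis by (simp only: W_def)
  qed
  have Q_lim: "(\<lambda>n. prob {\<omega>\<in>space M. ennreal (\<eta> / w n) < Q n \<omega>}) \<longlonglongrightarrow> 0" if \<eta>: "0 < \<eta>" for \<eta>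
  proof (rule prob_tendsto_0_if_eventually_not)
    show "AE \<omega> in M. \<forall>\<^sub>F n in sequentially. \<omega> \<notin> {\<omega>\<in>space M. ennreal (\<eta> / w n) < Q n \<omega>}"
      using X0 AE_space
    proof eventually_elim
      case (elim \<omega>)
      have D0: "0 \<le> D"
      proof (rule tendsto_lowerbound[OF D])
        show "\<forall>\<^sub>F n in sequentially. 0 \<le> w n * ?J n"
          using eventually_ge_at_top[of 1]
          by eventually_elim (auto intro!: mult_nonneg_nonneg integral_nonneg_AE less_imp_le[OF w])
      qed simp
      \<comment> \<open>The tolerance for \<open>\<sigma> (X s)\<close>: the weighted square integral of the kernel is eventually below
        \<open>D + 1\<close>, so this error uses up half of \<open>\<eta>\<close>; the other half is left for the step approximation.\<close>
      define \<kappa> where "\<kappa> = sqrt (\<eta> / (4 * (D + 1)))"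
      have \<kappa>: "0 < \<kappa>" "\<kappa>\<^sup>2 = \<eta> / (4 * (D + 1))" using \<eta> D0 by (auto simp: \<kappa>_def)
      have "continuous_on {0..} (\<lambda>s. X s \<omega>)"
        using X elim by (simp add: continuous_paths_def)
      then have "continuous_on {0..} (\<lambda>s. \<sigma> (X s \<omega>))"
        by (rule continuous_on_compose2[OF \<sigma>]) simp
      then have "\<exists>d>0. \<forall>s\<in>{0..}. dist s 0 < d \<longrightarrow> dist (\<sigma> (X s \<omega>)) (\<sigma> (X 0 \<omega>)) < \<kappa>"
        unfolding continuous_on_iff using \<kappa>(1) by (metis atLeast_iff order_refl)
      then obtain d where d: "0 < d" and near: "\<forall>s\<in>{0..}. dist s 0 < d \<longrightarrow> dist (\<sigma> (X s \<omega>)) (\<sigma> (X 0 \<omega>)) < \<kappa>"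
        by blast
      have near': "\<bar>\<sigma> (X s \<omega>) - \<sigma> x0\<bar> < \<kappa>" if "0 \<le> s" "s < d" for s
        using near[rule_format, of s] that elim by (simp add: dist_real_def)
      have ev1: "\<forall>\<^sub>F n in sequentially. T n < d" by (rule order_tendstoD(2)[OF T(2) d])
      have ev2: "\<forall>\<^sub>F n in sequentially. w n * ?J n < D + 1" by (rule order_tendstoD(2)[OF D]) simp
      have "(\<lambda>n. 2 * (\<sigma> x0)\<^sup>2 / (real n)\<^sup>2) \<longlonglongrightarrow> 0" by real_asymp
      then have ev3: "\<forall>\<^sub>F n in sequentially. 2 * (\<sigma> x0)\<^sup>2 / (real n)\<^sup>2 < \<eta> / 2"
        by (rule order_tendstoD(2)) (use \<eta> in simp)
      show ?case
        using ev1 ev2 ev3 eventually_ge_at_top[of 1]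
      proof eventually_elim
        case (elim n)
        have l: "0 < w n" by (rule w[OF elim(4)])
        have "Q n \<omega> \<le> (\<integral>\<^sup>+s. ennreal (2 * \<kappa>\<^sup>2 * (K.profile (T n) s)\<^sup>2 +
            2 * (\<sigma> x0)\<^sup>2 * (K.profile (T n) s - K.step (T n) (m n) s)\<^sup>2) \<partial>lborel)"
          unfolding Q_def
        proof (rule nn_integral_mono_AE)
          show "AE s in lborel. ennreal ((K (T n - s) * \<sigma> (X s \<omega>) - \<sigma> x0 * K.step (T n) (m n) s)\<^sup>2) * indicator {0..T n} s
            \<le> ennreal (2 * \<kappa>\<^sup>2 * (K.profile (T n) s)\<^sup>2 + 2 * (\<sigma> x0)\<^sup>2 * (K.profile (T n) s - K.step (T n) (m n) s)\<^sup>2)"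
            using AE_lborel_neq[of "T n"]
          proof eventually_elim
            fix s assume sT: "s \<noteq> T n"
            show "ennreal ((K (T n - s) * \<sigma> (X s \<omega>) - \<sigma> x0 * K.step (T n) (m n) s)\<^sup>2) * indicator {0..T n} s
              \<le> ennreal (2 * \<kappa>\<^sup>2 * (K.profile (T n) s)\<^sup>2 + 2 * (\<sigma> x0)\<^sup>2 * (K.profile (T n) s - K.step (T n) (m n) s)\<^sup>2)"
            proof (cases "0 \<le> s \<and> s < T n")
              case True
              define p where "p = K.profile (T n) s"
              define q where "q = K.step (T n) (m n) s"
              define \<Delta> where "\<Delta> = \<sigma> (X s \<omega>) - \<sigma> x0"
              have "K (T n - s) = p" using True by (simp add: p_def K.profile_def)
              moreover have "\<sigma> (X s \<omega>) = \<sigma> x0 + \<Delta>" by (simp add: \<Delta>_def)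
              moreover have "(p * (\<sigma> x0 + \<Delta>) - \<sigma> x0 * q)\<^sup>2 \<le> 2 * (p * \<Delta>)\<^sup>2 + 2 * (\<sigma> x0 * (p - q))\<^sup>2"
                using zero_le_power2[of "p * \<Delta> - \<sigma> x0 * (p - q)"]
                by (simp add: power2_eq_square algebra_simps)
              moreover have "(p * \<Delta>)\<^sup>2 \<le> p\<^sup>2 * \<kappa>\<^sup>2"
              proof -
                have "\<bar>\<Delta>\<bar> \<le> \<kappa>" using near'[of s] True elim(1) by (simp add: \<Delta>_def)
                then have "\<Delta>\<^sup>2 \<le> \<kappa>\<^sup>2" using \<kappa>(1) by (simp add: abs_le_square_iff[symmetric])
                then show ?thesis by (simp add: power_mult_distrib mult_left_mono)
              qed
              ultimately have "(K (T n - s) * \<sigma> (X s \<omega>) - \<sigma> x0 * q)\<^sup>2 \<le> 2 * \<kappa>\<^sup>2 * p\<^sup>2 + 2 * (\<sigma> x0)\<^sup>2 * (p - q)\<^sup>2"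
                by (simp add: power_mult_distrib mult_ac)
              then show ?thesis using True unfolding p_def q_def by (simp add: ennreal_leI del: ennreal_plus)
            next
              case False
              then have "s \<notin> {0..T n}" using sT by auto
              then show ?thesis by simp
            qed
          qed
        qed
        also have "\<dots> = ennreal (2 * \<kappa>\<^sup>2 * ?J n + 2 * (\<sigma> x0)\<^sup>2 * ?E n)"
        proof -
          have i: "integrable lborel (\<lambda>s. 2 * \<kappa>\<^sup>2 * (K.profile (T n) s)\<^sup>2 +
            2 * (\<sigma> x0)\<^sup>2 * (K.profile (T n) s - K.step (T n) (m n) s)\<^sup>2)"
            using K.profile_square_integrable K.step_square_integrable[OF T(1)]
            by (intro Bochner_Integration.integrable_add integrable_mult_right)
          show ?thesis
            using K.profile_square_integrable K.step_square_integrable[OF T(1)]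
            by (subst nn_integral_eq_integral[OF i]) auto
        qed
        also have "\<dots> \<le> ennreal (\<eta> / w n)"
        proof (rule ennreal_leI)
          have half: "2 * (\<eta> / (4 * x)) * x = \<eta> / 2" if "0 < x" for x using that by simp
          have "2 * \<kappa>\<^sup>2 * (w n * ?J n) \<le> 2 * \<kappa>\<^sup>2 * (D + 1)"
            using elim(2) by (intro mult_left_mono) auto
          also have "\<dots> = \<eta> / 2"
            using half[of "D + 1"] D0 by (simp only: \<kappa>(2))
          finally have 1: "w n * (2 * \<kappa>\<^sup>2 * ?J n) \<le> \<eta> / 2" by (simp add: mult.assoc mult.left_commute)
          have "w n * (2 * (\<sigma> x0)\<^sup>2 * ?E n) \<le> w n * (2 * (\<sigma> x0)\<^sup>2 * (1 / (w n * (real n)\<^sup>2)))"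
            using err[OF elim(4)] l by (intro mult_left_mono) auto
          also have "\<dots> = 2 * (\<sigma> x0)\<^sup>2 / (real n)\<^sup>2" using l by simp
          finally have 2: "w n * (2 * (\<sigma> x0)\<^sup>2 * ?E n) \<le> \<eta> / 2" using elim(3) by simp
          have "w n * (2 * \<kappa>\<^sup>2 * ?J n + 2 * (\<sigma> x0)\<^sup>2 * ?E n) \<le> \<eta>"
            using 1 2 by (simp add: distrib_left)
          then show "2 * \<kappa>\<^sup>2 * ?J n + 2 * (\<sigma> x0)\<^sup>2 * ?E n \<le> \<eta> / w n"
            using l by (simp add: pos_le_divide_eq mult.commute)
        qed
        finally show ?case by (simp add: not_less)
      qed
    qed
  qed measurable
  have "null_in_prob M W"
    unfolding null_in_prob_def
  proof (intro conjI allI impI W_meas)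
    fix e :: real assume e: "0 < e"
    show "(\<lambda>n. prob {\<omega>\<in>space M. e < \<bar>W n \<omega>\<bar>}) \<longlonglongrightarrow> 0"
    proof (rule LIMSEQ_I)
      fix r :: real assume r: "0 < r"
      define \<eta> where "\<eta> = r * e\<^sup>2 / 32"
      have \<eta>: "0 < \<eta>" "16 * \<eta> / e\<^sup>2 = r / 2" using r e by (auto simp: \<eta>_def)
      have "\<forall>\<^sub>F n in sequentially. prob {\<omega>\<in>space M. ennreal (\<eta> / w n) < Q n \<omega>} < r / 2"
        by (rule order_tendstoD(2)[OF Q_lim[OF \<eta>(1)]]) (use r in simp)
      then have "\<forall>\<^sub>F n in sequentially. norm (prob {\<omega>\<in>space M. e < \<bar>W n \<omega>\<bar>} - 0) < r"
        using eventually_ge_at_top[of 1]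
      proof eventually_elim
        case (elim n)
        then show ?case using bound[OF elim(2) e \<eta>(1)] \<eta>(2) by simp
      qed
      then show "\<exists>no. \<forall>n\<ge>no. norm (prob {\<omega>\<in>space M. e < \<bar>W n \<omega>\<bar>} - 0) < r"
        by (simp add: eventually_sequentially)
    qed
  qed
  then show ?thesis by (simp only: W_def[abs_def])
qed

text \<open>
  The drift is of order \<open>sqrt (T n)\<close> relative to the stochastic term: by the Cauchy-Schwarz inequality
  its square is at most \<open>T n\<close> times the square integral of the kernel, up to a path dependent constant.
\<close>

lemma volterra_small_time_expansion:
  assumes K: "monotone_kernel K" and b: "continuous_on UNIV b" and \<sigma>: "continuous_on UNIV \<sigma>"
    and X: "continuous_paths M X" and X0: "AE \<omega> in M. X 0 \<omega> = x0"
    and Y: "\<And>s. 0 \<le> s \<Longrightarrow> Y s \<in> borel_measurable M" "volterra_ito M F B K b \<sigma> X (\<lambda>_. 0) Y"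
    and T: "\<And>n. 0 \<le> T n" "T \<longlonglongrightarrow> 0" and w: "\<And>n. 1 \<le> n \<Longrightarrow> 0 < w n"
    and D: "(\<lambda>n. w n * (\<integral>s. (monotone_kernel.profile K (T n) s)\<^sup>2 \<partial>lborel)) \<longlonglongrightarrow> D"
    and m: "\<And>n. 1 \<le> n \<Longrightarrow> 0 < m n"
    and err: "\<And>n. 1 \<le> n \<Longrightarrow>
      (\<integral>s. (monotone_kernel.profile K (T n) s - monotone_kernel.step K (T n) (m n) s)\<^sup>2 \<partial>lborel)
        \<le> 1 / (w n * (real n)\<^sup>2)"
  shows "null_in_prob M (\<lambda>n \<omega>. sqrt (w n) * Y (T n) \<omega> - \<sigma> x0 * (sqrt (w n) * wiener_step K (T n) (m n) \<omega>))"
proof -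
  interpret K: monotone_kernel K by fact
  have "\<forall>n. \<exists>I. has_ito_integral M F B (T n) (\<lambda>s \<omega>. K (T n - s) * \<sigma> (X s \<omega>)) I \<and>
      (AE \<omega> in M. Y (T n) \<omega> = 0 + (LBINT s:{0..T n}. K (T n - s) * b (X s \<omega>)) + I \<omega>)"
    using Y(2) T(1) by (simp add: volterra_ito_def)
  then obtain I where I': "\<forall>n. has_ito_integral M F B (T n) (\<lambda>s \<omega>. K (T n - s) * \<sigma> (X s \<omega>)) (I n) \<and>
      (AE \<omega> in M. Y (T n) \<omega> = 0 + (LBINT s:{0..T n}. K (T n - s) * b (X s \<omega>)) + I n \<omega>)"
    by (rule choice[THEN exE])
  then have I: "\<And>n. has_ito_integral M F B (T n) (\<lambda>s \<omega>. K (T n - s) * \<sigma> (X s \<omega>)) (I n)"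
    and AE_Y: "\<And>n. AE \<omega> in M. Y (T n) \<omega> = 0 + (LBINT s:{0..T n}. K (T n - s) * b (X s \<omega>)) + I n \<omega>"
    by blast+
  have [measurable]: "I n \<in> borel_measurable M" "Y (T n) \<in> borel_measurable M" for n
    using I Y(1) T(1) by (auto simp: has_ito_integral_def)
  let ?J = "\<lambda>n. \<integral>s. (K.profile (T n) s)\<^sup>2 \<partial>lborel"
  have drift: "null_in_prob M (\<lambda>n \<omega>. sqrt (w n) * (Y (T n) \<omega> - I n \<omega>))"
  proof (rule null_in_prob_AE)
    have "AE \<omega> in M. \<forall>n. Y (T n) \<omega> = 0 + (LBINT s:{0..T n}. K (T n - s) * b (X s \<omega>)) + I n \<omega>"
      using AE_Y by (simp add: AE_all_countable)
    then show "AE \<omega> in M. (\<lambda>n. sqrt (w n) * (Y (T n) \<omega> - I n \<omega>)) \<longlonglongrightarrow> 0"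
      using AE_space
    proof eventually_elim
      case (elim \<omega>)
      have "continuous_on {0..} (\<lambda>s. X s \<omega>)"
        using X elim by (simp add: continuous_paths_def)
      then have "continuous_on {0..} (\<lambda>s. b (X s \<omega>))"
        by (rule continuous_on_compose2[OF b]) simp
      then have "continuous_on {0..1} (\<lambda>s. b (X s \<omega>))"
        by (rule continuous_on_subset) auto
      then have "bounded ((\<lambda>s. b (X s \<omega>)) ` {0..1})"
        by (intro compact_imp_bounded compact_continuous_image) auto
      then obtain c where "\<forall>s\<in>{0..1}. \<bar>b (X s \<omega>)\<bar> \<le> c"
        unfolding bounded_iff by auto
      then have c: "\<bar>b (X s \<omega>)\<bar> \<le> c" if "0 \<le> s" "s \<le> 1" for s using that by simp
      have ev: "\<forall>\<^sub>F n in sequentially. T n < 1" by (rule order_tendstoD(2)[OF T(2)]) simp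
      show ?case
      proof (rule Lim_null_comparison)
        show "\<forall>\<^sub>F n in sequentially. norm (sqrt (w n) * (Y (T n) \<omega> - I n \<omega>)) \<le> c * sqrt (T n * (w n * ?J n))"
          using ev eventually_ge_at_top[of 1]
        proof eventually_elim
          case (elim n)
          have l: "0 < w n" by (rule w[OF elim(2)])
          have "\<bar>LBINT s:{0..T n}. K (T n - s) * b (X s \<omega>)\<bar> \<le> c * sqrt (T n * ?J n)"
            using c elim(1) by (intro K.drift_bound[OF T(1)]) auto
          then have "sqrt (w n) * \<bar>Y (T n) \<omega> - I n \<omega>\<bar> \<le> sqrt (w n) * (c * sqrt (T n * ?J n))"
            using l \<open>\<forall>n. Y (T n) \<omega> = _ + I n \<omega>\<close> by (intro mult_left_mono) auto
          also have "\<dots> = c * sqrt (T n * (w n * ?J n))"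
            by (simp add: real_sqrt_mult)
          finally show ?case using l by (simp add: abs_mult)
        qed
        have "(\<lambda>n. c * sqrt (T n * (w n * ?J n))) \<longlonglongrightarrow> c * sqrt (0 * D)"
          by (intro tendsto_intros T(2) D)
        then show "(\<lambda>n. c * sqrt (T n * (w n * ?J n))) \<longlonglongrightarrow> 0" by simp
      qed
    qed
  qed measurable
  have "null_in_prob M (\<lambda>n \<omega>. sqrt (w n) * (I n \<omega> - \<sigma> x0 * wiener_step K (T n) (m n) \<omega>))"
    by (rule stochastic_term_localises[OF K \<sigma> X X0 T w D m err I])
  from null_in_prob_add[OF drift this] show ?thesis
    by (simp add: algebra_simps)
qed

lemma solution_initial_value:
  assumes "volterra_ito M F B K b \<sigma> X g X"
  shows "AE \<omega> in M. X 0 \<omega> = g 0"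
proof -
  obtain I where I: "has_ito_integral M F B 0 (\<lambda>s \<omega>. K (0 - s) * \<sigma> (X s \<omega>)) I"
    and X: "AE \<omega> in M. X 0 \<omega> = g 0 + (LBINT s:{0..0}. K (0 - s) * b (X s \<omega>)) + I \<omega>"
    using assms unfolding volterra_ito_def by blast
  have "(LBINT s:{0..0::real}. f s) = (0::real)" for f
    unfolding set_lebesgue_integral_def
    using lborel_integral_cong_except_point[of 0 "\<lambda>s. indicator {0..0} s *\<^sub>R f s" "\<lambda>_. 0"] by (simp add: indicator_def)
  with X ito_integral_at_0[OF I] show ?thesis by auto
qed

text \<open>
  A linear combination of the integrals for several kernels is again a Wiener integral of one step
  function, over the disjoint union of the grids; this gives joint normality.
\<close>

lemma wiener_step_vector_char:
  fixes K :: "'n::finite \<Rightarrow> real \<Rightarrow> real"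
  assumes K: "\<And>j. monotone_kernel (K j)" and T: "\<And>j. 0 \<le> T j"
  shows "expectation (\<lambda>\<omega>. iexp (\<Sum>j\<in>UNIV. u j * wiener_step (K j) (T j) (m j) \<omega>)) =
    of_real (exp (- ((\<integral>s. (\<Sum>j\<in>UNIV. u j * monotone_kernel.step (K j) (T j) (m j) s)\<^sup>2 \<partial>lborel) / 2)))"
proof -
  let ?A = "SIGMA j:UNIV. {..<m j}"
  let ?c = "\<lambda>x. u (fst x) * K (fst x) (T (fst x) - real (snd x) * T (fst x) / real (m (fst x)))"
  let ?a = "\<lambda>x. real (snd x) * T (fst x) / real (m (fst x))"
  let ?b = "\<lambda>x. real (Suc (snd x)) * T (fst x) / real (m (fst x))"
  have 1: "(\<Sum>j\<in>UNIV. u j * wiener_step (K j) (T j) (m j) \<omega>) = (\<Sum>x\<in>?A. ?c x * (B (?b x) \<omega> - B (?a x) \<omega>))" for \<omega>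
    unfolding wiener_step_def sum_distrib_left
    by (subst sum.Sigma) (simp_all only: finite_lessThan finite split_def mult.assoc ball_simps ball_UNIV simp_thms)
  have 2: "(\<Sum>j\<in>UNIV. u j * monotone_kernel.step (K j) (T j) (m j) s) = (\<Sum>x\<in>?A. ?c x * indicator {?a x<..?b x} s)" for s
    unfolding monotone_kernel.step_def[OF K] sum_distrib_left
    by (subst sum.Sigma) (simp_all only: finite_lessThan finite split_def mult.assoc ball_simps ball_UNIV simp_thms)
  show ?thesis
    unfolding 1 2
  proof (rule wiener_char)
    show "0 \<le> ?a x \<and> ?a x \<le> ?b x" for x
      using T[of "fst x"] by (auto intro!: divide_right_mono mult_right_mono)
  qed auto
qed

end


section \<open>Joint convergence to the normal law\<close>

theorem corollary4p9:
  fixes K b \<sigma> g :: "real \<Rightarrow> real"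
    and Kinf chi_b chi_s \<eta>g \<gamma> C C' :: real
    and \<mu> :: "real measure"
    and M :: "'a measure" and F :: "real \<Rightarrow> 'a measure"
    and B X :: "real \<Rightarrow> 'a \<Rightarrow> real"
    and Kj :: "'n::{finite,linorder} \<Rightarrow> real \<Rightarrow> real"
    and \<nu> :: "'n \<Rightarrow> real measure" and h :: "'n \<Rightarrow> real \<Rightarrow> real"
    and \<rho> t :: "'n \<Rightarrow> real"
    and \<Sigma> :: "((real, 'n) vec, 'n) vec"
    and Xbar :: "'n \<Rightarrow> real \<Rightarrow> 'a \<Rightarrow> real"
  assumes "condition_A K Kinf \<mu>"
    and "0 < chi_b" "chi_b \<le> 1" "holder chi_b b"
    and "0 < chi_s" "chi_s \<le> 1" "holder chi_s \<sigma>"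
    and "eta_star \<mu> < ereal \<eta>g" "g \<in> G_space \<mu> \<eta>g"
    and "continuous_weak_solution M F B g K b \<sigma> X"
    and "\<And>j. completely_monotone (Kj j)"
    and "\<And>j. measure_on_Rplus (\<nu> j)"
    and "\<And>j s. 0 < s \<Longrightarrow> integrable (\<nu> j) (\<lambda>x. exp (- (s * x)))
                     \<and> Kj j s = (\<integral>x. exp (- (s * x)) \<partial>\<nu> j)"
    and "\<And>j. absolutely_continuous (atom0_plus Kinf \<mu>) (\<nu> j)"
    and "\<And>j. is_density_version (atom0_plus Kinf \<mu>) (\<nu> j) (h j)"
    and "\<And>j. (\<integral>\<^sup>+x\<in>{0..1}. ennreal ((h j x)\<^sup>2) \<partial>atom0_plus 1 \<mu>) < \<infinity>"
    and "0 < C" "\<And>j x. 1 \<le> x \<Longrightarrow> h j x \<le> C * (1 + x) powr \<rho> j"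
    and "\<And>j. ereal (\<rho> j) < ereal (1/2) - eta_star \<mu>"
    and "\<And>j. 0 \<le> t j" "mono t"
    and "0 < \<gamma>" "0 < C'"
    and "\<And>j n. 1 \<le> n \<Longrightarrow> 0 < (LBINT r:{0..1 / real n}. (Kj j r)\<^sup>2)
                      \<and> scaling (Kj j) n \<le> C' * real n powr (2 * \<gamma>)"
    and "ereal \<gamma> < ereal (1/2) - max (eta_star \<mu> + ereal (Max (range \<rho>))) 0
                  + min (ereal (1/2) - max (eta_star \<mu>) 0) ((ereal \<eta>g - eta_star \<mu>) / 2) * ereal chi_s"
    and "transpose \<Sigma> = \<Sigma>" "\<And>u. 0 \<le> u \<bullet> (\<Sigma> *v u)"
    and "\<And>i j. i \<le> j \<Longrightarrow>
          (\<lambda>n. sqrt (scaling (Kj i) n * scaling (Kj j) n) *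
               (LBINT r:{0..t i / real n}. Kj j ((t j - t i) / real n + r) * Kj i r))
          \<longlonglongrightarrow> \<Sigma> $ i $ j"
    and "\<And>j s. 0 \<le> s \<Longrightarrow> Xbar j s \<in> borel_measurable M"
    and "\<And>j. continuous_paths M (Xbar j)"
    and "\<And>j. volterra_ito M F B (Kj j) b \<sigma> X (\<lambda>_. 0) (Xbar j)"
  shows "\<exists>N. multivariate_normal 0 ((\<sigma> (g 0))\<^sup>2 *\<^sub>R \<Sigma>) N \<and>
             converges_in_distribution M
               (\<lambda>n \<omega>. \<chi> j. sqrt (scaling (Kj j) n) * Xbar j (t j / real n) \<omega>) N"
proof -
  note A = assms
  let ?\<sigma>0 = "\<sigma> (g 0)"
  have b: "continuous_on UNIV b" and \<sigma>: "continuous_on UNIV \<sigma>"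
    using holder_continuous A(2,4,5,7) by blast+
  interpret brownian M F B
    by (intro brownian.intro brownian_axioms.intro)
       (use A(10) in \<open>auto simp: continuous_weak_solution_def filtered_prob_space_def\<close>)
  have X: "continuous_paths M X" and X0: "AE \<omega> in M. X 0 \<omega> = g 0"
    using A(10) solution_initial_value[of K b \<sigma> X g] by (auto simp: continuous_weak_solution_def)
  have kernel: "monotone_kernel (Kj j)" for j
  proof
    have "0 < (LBINT r:{0..1 / real 1}. (Kj j r)\<^sup>2)" using A(24)[of 1 j] by simp
    then show "set_integrable lborel {0..1} (\<lambda>r. (Kj j r)\<^sup>2)"
      unfolding set_integrable_def set_lebesgue_integral_def
      using not_integrable_integral_eq by fastforce
  qed (use completely_monotone_kernel[OF A(11)[of j]] in auto)
  let ?P = "\<lambda>j. monotone_kernel.profile (Kj j)" and ?S = "\<lambda>j. monotone_kernel.step (Kj j)"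
  define w where "w j n = scaling (Kj j) n" for j n
  define T where "T j n = t j / real n" for j n
  have w: "0 < w j n" if "1 \<le> n" for j n
    using A(24)[OF that, of j] by (simp add: w_def scaling_def)
  have T: "0 \<le> T j n" "T j \<longlonglongrightarrow> 0" for j n
    using A(20)[of j] tendsto_mult[OF tendsto_const lim_1_over_n, of "t j"] by (simp_all add: T_def[abs_def])

  \<comment> \<open>After multiplication by the scaling the square error is at most \<open>1 / n\<^sup>2\<close>.\<close>
  have "\<forall>j n. \<exists>m>0. 1 \<le> n \<longrightarrow>
      (\<integral>s. (?P j (T j n) s - ?S j (T j n) m s)\<^sup>2 \<partial>lborel) \<le> 1 / (w j n * (real n)\<^sup>2)"
  proof (intro allI)
    fix j n
    show "\<exists>m>0. 1 \<le> n \<longrightarrow> (\<integral>s. (?P j (T j n) s - ?S j (T j n) m s)\<^sup>2 \<partial>lborel) \<le> 1 / (w j n * (real n)\<^sup>2)"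
    proof (cases "1 \<le> n")
      case True
      then have "0 < 1 / (w j n * (real n)\<^sup>2)" using w[OF True, of j] by simp
      from monotone_kernel.step_approximates_profile[OF kernel T(1) this]
      show ?thesis by (blast intro: less_imp_le)
    qed auto
  qed
  then obtain m where m: "\<And>j n. 0 < m j n" and err: "\<And>j n. 1 \<le> n \<Longrightarrow>
      (\<integral>s. (?P j (T j n) s - ?S j (T j n) (m j n) s)\<^sup>2 \<partial>lborel) \<le> 1 / (w j n * (real n)\<^sup>2)"
    by metis

  have sym: "\<Sigma> $ i $ j = \<Sigma> $ j $ i" for i j
  proof -
    have "\<Sigma> $ i $ j = transpose \<Sigma> $ i $ j" using A(26) by simp
    then show ?thesis by (simp add: transpose_def)
  qed
  have cov: "(\<lambda>n. \<integral>s. (sqrt (w i n) * ?P i (T i n) s) * (sqrt (w j n) * ?P j (T j n) s) \<partial>lborel) \<longlonglongrightarrow> \<Sigma> $ i $ j"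
    for i j
  proof -
    have *: "(\<lambda>n. \<integral>s. (sqrt (w i n) * ?P i (T i n) s) * (sqrt (w j n) * ?P j (T j n) s) \<partial>lborel) \<longlonglongrightarrow> \<Sigma> $ i $ j"
      if ij: "i \<le> j" for i j
    proof -
      have "(\<integral>s. (sqrt (w i n) * ?P i (T i n) s) * (sqrt (w j n) * ?P j (T j n) s) \<partial>lborel) =
          sqrt (scaling (Kj i) n * scaling (Kj j) n) *
               (LBINT r:{0..t i / real n}. Kj j ((t j - t i) / real n + r) * Kj i r)" for n
      proof -
        have le: "T i n \<le> T j n"
          using ij A(21) by (auto simp: T_def mono_def intro!: divide_right_mono)
        have "(\<lambda>s. (sqrt (w i n) * ?P i (T i n) s) * (sqrt (w j n) * ?P j (T j n) s)) =
            (\<lambda>s. sqrt (w i n * w j n) * (?P j (T j n) s * ?P i (T i n) s))"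
          by (simp add: real_sqrt_mult mult_ac)
        then show ?thesis
          using profile_product_integral[OF kernel[of i] kernel[of j] T(1) le]
          by (simp add: w_def T_def diff_divide_distrib)
      qed
      then show ?thesis using A(28)[OF ij] by simp
    qed
    show ?thesis
    proof (cases "i \<le> j")
      case False
      then have "j \<le> i" by simp
      from *[OF this] show ?thesis by (simp add: sym[of i j] mult.commute)
    qed (rule *)
  qed
  \<comment> \<open>On the diagonal the covariance condition says that the weighted square integrals converge.\<close>
  have D: "(\<lambda>n. w j n * (\<integral>s. (?P j (T j n) s)\<^sup>2 \<partial>lborel)) \<longlonglongrightarrow> \<Sigma> $ j $ j" for j
  proof (rule Lim_transform_eventually[OF cov[of j j]])
    show "\<forall>\<^sub>F n in sequentially. (\<integral>s. (sqrt (w j n) * ?P j (T j n) s) * (sqrt (w j n) * ?P j (T j n) s) \<partial>lborel) =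
        w j n * (\<integral>s. (?P j (T j n) s)\<^sup>2 \<partial>lborel)"
      using eventually_ge_at_top[of 1]
    proof eventually_elim
      case (elim n)
      have "(\<lambda>s. (sqrt (w j n) * ?P j (T j n) s) * (sqrt (w j n) * ?P j (T j n) s)) =
          (\<lambda>s. w j n * (?P j (T j n) s)\<^sup>2)"
      proof
        fix s
        have "(sqrt (w j n) * ?P j (T j n) s) * (sqrt (w j n) * ?P j (T j n) s) =
            (sqrt (w j n) * sqrt (w j n)) * (?P j (T j n) s)\<^sup>2"
          by (simp only: power2_eq_square mult_ac)
        then show "(sqrt (w j n) * ?P j (T j n) s) * (sqrt (w j n) * ?P j (T j n) s) = w j n * (?P j (T j n) s)\<^sup>2"
          using w[OF elim, of j] by simp
      qed
      then show ?case by simp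
    qed
  qed

  \<comment> \<open>The rescaled vector is \<open>\<sigma> (g 0)\<close> times a Gaussian vector \<open>G\<close> plus a remainder that tends to \<open>0\<close> in
    probability; the remainder does not affect the limit of the characteristic functions.\<close>
  define G where "G j n \<omega> = sqrt (w j n) * wiener_step (Kj j) (T j n) (m j n) \<omega>" for j n \<omega>
  define Z where "Z n \<omega> = (\<chi> j. sqrt (w j n) * Xbar j (T j n) \<omega>)" for n \<omega>
  have G_meas [measurable]: "G j n \<in> borel_measurable M" for j n
    unfolding G_def using wiener_step_measurable[OF T(1)] by (intro borel_measurable_times) auto
  have "(\<lambda>\<omega>. Z n \<omega> $ j) \<in> borel_measurable M" for n j
    unfolding Z_def using A(29)[OF T(1)] by simp
  then have Z_meas: "Z n \<in> borel_measurable M" for n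
    by (auto simp: borel_measurable_euclidean_space[of "Z n"] Basis_vec_def inner_axis)

  have null: "null_in_prob M (\<lambda>n \<omega>. Z n \<omega> $ j - ?\<sigma>0 * G j n \<omega>)" for j
    unfolding Z_def G_def vec_lambda_beta
    by (rule volterra_small_time_expansion[OF kernel b \<sigma> X X0 A(29) A(31) T w D m err]) auto

  have chars: "(\<lambda>n. expectation (\<lambda>\<omega>. iexp (u \<bullet> Z n \<omega>))) \<longlonglongrightarrow>
      of_real (exp (- (?\<sigma>0\<^sup>2 * (u \<bullet> (\<Sigma> *v u)) / 2)))" for u
  proof -
    have gauss: "expectation (\<lambda>\<omega>. iexp (\<Sum>j\<in>UNIV. (u $ j * ?\<sigma>0) * G j n \<omega>)) =
      of_real (exp (- ((\<integral>s. (\<Sum>j\<in>UNIV. (u $ j * ?\<sigma>0) * (sqrt (w j n) * ?S j (T j n) (m j n) s))\<^sup>2 \<partial>lborel) / 2)))" for n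
      using wiener_step_vector_char[of Kj "\<lambda>j. T j n" "\<lambda>j. u $ j * ?\<sigma>0 * sqrt (w j n)" "\<lambda>j. m j n"] kernel T(1)
      by (simp add: G_def mult.assoc)
    have "(\<lambda>n. \<integral>s. (\<Sum>j\<in>UNIV. (u $ j * ?\<sigma>0) * (sqrt (w j n) * ?S j (T j n) (m j n) s))\<^sup>2 \<partial>lborel) \<longlonglongrightarrow>
        (\<Sum>i\<in>UNIV. \<Sum>j\<in>UNIV. (u $ i * ?\<sigma>0) * (u $ j * ?\<sigma>0) * \<Sigma> $ i $ j)"
    proof (rule quadratic_form_tendsto[where \<psi>="\<lambda>j n s. sqrt (w j n) * ?P j (T j n) s"])
      fix i j n
      interpret monotone_kernel "Kj j" by (rule kernel)
      show "(\<lambda>s. sqrt (w j n) * ?P j (T j n) s) \<in> borel_measurable borel"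
        "(\<lambda>s. sqrt (w j n) * ?S j (T j n) (m j n) s) \<in> borel_measurable borel"
        by measurable
      show "integrable lborel (\<lambda>s. (sqrt (w j n) * ?P j (T j n) s)\<^sup>2)"
        using profile_square_integrable by (simp add: power_mult_distrib)
      have eq: "(sqrt (w j n) * ?P j (T j n) s - sqrt (w j n) * ?S j (T j n) (m j n) s)\<^sup>2 =
          (sqrt (w j n))\<^sup>2 * (?P j (T j n) s - ?S j (T j n) (m j n) s)\<^sup>2" for s
        by (simp only: right_diff_distrib[symmetric] power_mult_distrib)
      show "integrable lborel (\<lambda>s. (sqrt (w j n) * ?P j (T j n) s - sqrt (w j n) * ?S j (T j n) (m j n) s)\<^sup>2)"
        unfolding eq using step_square_integrable[OF T(1)] by (rule integrable_mult_right)
      show "(\<integral>s. (sqrt (w j n) * ?P j (T j n) s - sqrt (w j n) * ?S j (T j n) (m j n) s)\<^sup>2 \<partial>lborel) \<le> 1 / (real n)\<^sup>2"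
        if n: "1 \<le> n"
      proof -
        have "w j n * (\<integral>s. (?P j (T j n) s - ?S j (T j n) (m j n) s)\<^sup>2 \<partial>lborel) \<le> w j n * (1 / (w j n * (real n)\<^sup>2))"
          using err[OF n] w[OF n, of j] by (intro mult_left_mono) auto
        then show ?thesis unfolding eq using w[OF n, of j] by simp
      qed
    qed (rule cov)
    also have "(\<Sum>i\<in>UNIV. \<Sum>j\<in>UNIV. (u $ i * ?\<sigma>0) * (u $ j * ?\<sigma>0) * \<Sigma> $ i $ j) = ?\<sigma>0\<^sup>2 * (u \<bullet> (\<Sigma> *v u))"
      by (simp add: inner_vec_def matrix_vector_mult_def sum_distrib_left power2_eq_square mult_ac)
    finally have lim: "(\<lambda>n. expectation (\<lambda>\<omega>. iexp (\<Sum>j\<in>UNIV. (u $ j * ?\<sigma>0) * G j n \<omega>))) \<longlonglongrightarrow>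
        of_real (exp (- (?\<sigma>0\<^sup>2 * (u \<bullet> (\<Sigma> *v u)) / 2)))"
      unfolding gauss by (intro tendsto_intros) auto
    have "null_in_prob M (\<lambda>n \<omega>. \<Sum>j\<in>UNIV. u $ j * (Z n \<omega> $ j - ?\<sigma>0 * G j n \<omega>))"
      by (intro null_in_prob_sum null_in_prob_scale null) simp
    from char_tendsto_perturbation[OF _ this lim]
    have "(\<lambda>n. expectation (\<lambda>\<omega>. iexp ((\<Sum>j\<in>UNIV. (u $ j * ?\<sigma>0) * G j n \<omega>) +
        (\<Sum>j\<in>UNIV. u $ j * (Z n \<omega> $ j - ?\<sigma>0 * G j n \<omega>))))) \<longlonglongrightarrow>
        of_real (exp (- (?\<sigma>0\<^sup>2 * (u \<bullet> (\<Sigma> *v u)) / 2)))"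
      by simp
    moreover have "(\<Sum>j\<in>UNIV. (u $ j * ?\<sigma>0) * G j n \<omega>) +
        (\<Sum>j\<in>UNIV. u $ j * (Z n \<omega> $ j - ?\<sigma>0 * G j n \<omega>)) = u \<bullet> Z n \<omega>" for n \<omega>
      by (simp add: inner_vec_def sum.distrib[symmetric] algebra_simps)
    ultimately show ?thesis by simp
  qed

  have form: "u \<bullet> ((?\<sigma>0\<^sup>2 *\<^sub>R \<Sigma>) *v u) = ?\<sigma>0\<^sup>2 * (u \<bullet> (\<Sigma> *v u))" for u
    by (simp add: scaleR_matrix_vector_assoc[symmetric])
  obtain N where N: "multivariate_normal 0 (?\<sigma>0\<^sup>2 *\<^sub>R \<Sigma>) N"
  proof -
    have "transpose (?\<sigma>0\<^sup>2 *\<^sub>R \<Sigma>) = ?\<sigma>0\<^sup>2 *\<^sub>R \<Sigma>"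
      using sym by (simp add: transpose_def vec_eq_iff)
    then show ?thesis
      using multivariate_normal_exists[of "?\<sigma>0\<^sup>2 *\<^sub>R \<Sigma>"] A(27) that by (auto simp: form)
  qed
  have "converges_in_distribution M Z N"
  proof (rule converges_in_distribution_if_char_converges)
    show "prob_space M" by (rule prob_space_axioms)
    show "prob_space N" "sets N = sets borel" using N by (auto simp: multivariate_normal_def)
    have "(CLINT x|N. iexp (u \<bullet> x)) = exp (of_real (- (?\<sigma>0\<^sup>2 * (u \<bullet> (\<Sigma> *v u)) / 2)))" for u
      using N by (simp add: multivariate_normal_def form)
    then have "(CLINT x|N. iexp (u \<bullet> x)) = of_real (exp (- (?\<sigma>0\<^sup>2 * (u \<bullet> (\<Sigma> *v u)) / 2)))" for u
      by (simp only: exp_of_real)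
    then show "(\<lambda>n. CLINT \<omega>|M. iexp (u \<bullet> Z n \<omega>)) \<longlonglongrightarrow> (CLINT x|N. iexp (u \<bullet> x))" for u
      using chars[of u] by simp
  qed (rule Z_meas)
  then show ?thesis using N by (auto simp: Z_def[abs_def] w_def T_def)
qed

end
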